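(* Let $\Sigma\subset\mathbb{N}^*$ be finite and let $L$ be a subfield of $\mathbb{K}_\Sigma$ containing $A$ and stable under $\tau$. Every element $f$ of $\mathfrak{K}_L$ (the $v$-adic completion of the fraction field of the ring $\mathcal{T}(L)$ of tame series with coefficients in $L$) can be expanded in a unique way as a sum $$f=\sum_{i\ge i_0}f_i\,e^{-i},\qquad f_i\in\mathcal{T}^\circ(L),$$ where $e=e_0$ is the function $z\mapsto\exp_C(\widetilde\pi z)$.
   Context: $q$ is a power of a prime $p$; $A=\mathbb{F}_q[\theta]$, $K_\infty=\mathbb{F}_q((1/\theta))$, $|\theta|=q$, $\mathbb{C}_\infty$ is the completion of a separable closure of $K_\infty$. $\exp_C(X)=\sum_{i\ge0}X^{q^i}/d_i$ with $d_i=\prod_{j<i}(\theta^{q^i}-\theta^{q^j})$ is the Carlitz exponential, with kernel $\widetilde\pi A$. For finite $\Sigma\subset\mathbb{N}^*$ (positive integers), $\underline t_\Sigma=(t_i)_{i\in\Sigma}$ are independent variables and $\mathbb{K}_\Sigma$ is the completion of $\mathbb{C}_\infty(\underline t_\Sigma)$ for the Gauss norm $\|\cdot\|$; $\tau$ is the continuous $\mathbb{F}_q(\underline t_\Sigma)$-linear automorphism of $\mathbb{K}_\Sigma$ extending $c\mapsto c^q$ on $\mathbb{C}_\infty$. For $i\in\mathbb{Z}$, $e_i(z)=\exp_C(\widetilde\pi z/\theta^i)$ as a function of $z\in\mathbb{C}_\infty$. For $j\in\mathbb{Z}[1/p]_{\ge0}$ with base-$q$ expansion $j=\sum_{k\in\mathbb{Z}}j_kq^{-k}$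 ($0\le j_k\le q-1$, almost all zero), $\langle e\rangle^j=\prod_ke_k^{j_k}$ and $\ell_q(j)=\sum_kj_k$. A tame series with coefficients in $L$ is a function $\mathbb{C}_\infty\to\mathbb{K}_\Sigma$ given by an everywhere convergent series $f=\sum_jf_j\langle e\rangle^j$ with $f_j\in L$ such that: $\ell_q(j)$ is bounded over the $j$ with $f_j\ne0$; the set of $j$ with $f_j\neq0$ is bounded above; $\sup_j\|f_j\|<\infty$. These functions form a ring $\mathcal{T}(L)$ and the expansion of a tame series is unique; $v(f)=-\max\{j:f_j\ne0\}$ (and $v(0)=\infty$) defines an additive valuation on $\mathcal{T}(L)$. $\mathcal{T}^\circ(L)\subset\mathcal{T}(L)$ is the $L$-subspace of those tame series in which only the functions $e_1,e_2,\dots$ occur (i.e. $f_j\neq0$ implies $j<1$). Infinite sums in $\mathfrak{K}_L$ are $v$-adically convergent sums. *)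

theory Defs
  imports
    "HOL-Analysis.Analysis"
    "HOL-Computational_Algebra.Computational_Algebra"
    "HOL-Library.Poly_Mapping"
begin

section \<open>Fields with a non-archimedean absolute value\<close>

text \<open>
  The absolute value is the distance to \<open>0\<close>, so the topological notions of the library
  (closure, continuity, infinite sums, completeness) are those of the valued field.
\<close>

class nonarch_field = field + metric_space +
  assumes dist_translate: "dist (x + z) (y + z) = dist x y"
    and dist_mult_zero: "dist (x * y) 0 = dist x 0 * dist y 0"
    and dist_ultrametric: "dist x z \<le> max (dist x y) (dist y z)"

definition absv :: "'a::nonarch_field \<Rightarrow> real"
  where "absv x = dist x 0"

definition field_hom :: "('a::field \<Rightarrow> 'b::field) \<Rightarrow> bool"
  where "field_hom h \<longleftrightarrow>
    h 1 = 1 \<and> (\<forall>x y. h (x + y) = h x + h y) \<and> (\<forall>x y. h (x * y) = h x * h y)"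

definition is_subfield :: "'a::field set \<Rightarrow> bool"
  where "is_subfield L \<longleftrightarrow>
    0 \<in> L \<and> 1 \<in> L \<and> (\<forall>x\<in>L. \<forall>y\<in>L. x - y \<in> L \<and> x * y \<in> L) \<and> (\<forall>x\<in>L. inverse x \<in> L)"


section \<open>The field \<open>C\<^sub>\<infinity>\<close>\<close>

text \<open>
  \<open>\<F>\<^sub>q\<close> is the finite field \<open>'a\<close>, so that \<open>q = CARD('a)\<close> and \<open>p = CHAR('a)\<close>. The field
  \<open>K\<^sub>\<infinity> = \<F>\<^sub>q((1/\<theta>))\<close> is the type \<open>'a fls\<close> of formal Laurent series, whose variable \<open>fls_X\<close> stands
  for \<open>1/\<theta>\<close>. All other fields are given together with the embedding of the smaller one:
  \<open>\<phi>\<close> embeds \<open>K\<^sub>\<infinity>\<close> into \<open>C\<^sub>\<infinity>\<close>, and later \<open>\<iota>\<close> embeds \<open>C\<^sub>\<infinity>\<close> into \<open>K\<^sub>\<Sigma>\<close>.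
\<close>

definition theta :: "('a::{finite,field} fls \<Rightarrow> 'c::field) \<Rightarrow> 'c"
  where "theta \<phi> = inverse (\<phi> fls_X)"

definition Fq_set :: "('a::{finite,field} fls \<Rightarrow> 'c::field) \<Rightarrow> 'c set"
  where "Fq_set \<phi> = range (\<lambda>a. \<phi> (fls_const a))"

definition A_ring :: "('a::{finite,field} fls \<Rightarrow> 'c::field) \<Rightarrow> 'c set"
  where "A_ring \<phi> = {poly P (theta \<phi>) | P. \<forall>n. coeff P n \<in> Fq_set \<phi>}"

text \<open>The elements that are separable algebraic over a subfield \<open>K\<close>.\<close>

definition separable_elements :: "'c::field set \<Rightarrow> 'c set"
  where "separable_elements K =
    {x. \<exists>P. (\<forall>n. coeff P n \<in> K) \<and> coprime P (pderiv P) \<and> poly P x = 0}"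

definition separably_closed :: "'c::field set \<Rightarrow> bool"
  where "separably_closed K \<longleftrightarrow>
    (\<forall>P. (\<forall>n. coeff P n \<in> K) \<and> coprime P (pderiv P) \<and> degree P > 0 \<longrightarrow> (\<exists>x\<in>K. poly P x = 0))"

text \<open>
  \<open>'c\<close> is a completion of a separable closure of \<open>K\<^sub>\<infinity>\<close>. Completeness of \<open>'c\<close> is part of its sort.
\<close>

definition is_C_infinity ::
    "('a::{finite,field} fls \<Rightarrow> 'c::{nonarch_field,complete_space}) \<Rightarrow> bool"
  where "is_C_infinity \<phi> \<longleftrightarrow>
    field_hom \<phi> \<and>
    (\<forall>f. f \<noteq> 0 \<longrightarrow> absv (\<phi> f) = real CARD('a) powi (- fls_subdegree f)) \<and>
    separably_closed (separable_elements (range \<phi>)) \<and>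
    closure (separable_elements (range \<phi>)) = UNIV"


section \<open>The Carlitz exponential\<close>

definition carlitz_d :: "('a::{finite,field} fls \<Rightarrow> 'c::field) \<Rightarrow> nat \<Rightarrow> 'c"
  where "carlitz_d \<phi> i =
    (\<Prod>j<i. theta \<phi> ^ (CARD('a) ^ i) - theta \<phi> ^ (CARD('a) ^ j))"

definition carlitz_exp :: "('a::{finite,field} fls \<Rightarrow> 'c::nonarch_field) \<Rightarrow> 'c \<Rightarrow> 'c"
  where "carlitz_exp \<phi> X = suminf (\<lambda>i. X ^ (CARD('a) ^ i) / carlitz_d \<phi> i)"

definition is_carlitz_period :: "('a::{finite,field} fls \<Rightarrow> 'c::nonarch_field) \<Rightarrow> 'c \<Rightarrow> bool"
  where "is_carlitz_period \<phi> \<pi> \<longleftrightarrow>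
    \<pi> \<noteq> 0 \<and> {X. carlitz_exp \<phi> X = 0} = (\<lambda>a. \<pi> * a) ` A_ring \<phi>"

definition e_fun :: "('a::{finite,field} fls \<Rightarrow> 'c::nonarch_field) \<Rightarrow> 'c \<Rightarrow> int \<Rightarrow> 'c \<Rightarrow> 'c"
  where "e_fun \<phi> \<pi> i z = carlitz_exp \<phi> (\<pi> * z / theta \<phi> powi i)"


section \<open>The field \<open>K\<^sub>\<Sigma>\<close>\<close>

text \<open>
  A polynomial in the variables \<open>t\<^sub>i\<close> is an element of \<open>(nat \<Rightarrow>\<^sub>0 nat) \<Rightarrow>\<^sub>0 'c\<close>; its monomials are
  finitely supported exponent functions.
\<close>

definition polys_in :: "'c::zero set \<Rightarrow> nat set \<Rightarrow> ((nat \<Rightarrow>\<^sub>0 nat) \<Rightarrow>\<^sub>0 'c) set"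
  where "polys_in F S =
    {P. (\<forall>m\<in>Poly_Mapping.keys P. Poly_Mapping.lookup P m \<in> F \<and> Poly_Mapping.keys m \<subseteq> S)}"

definition eval_poly ::
    "('c::zero \<Rightarrow> 'k::field) \<Rightarrow> (nat \<Rightarrow> 'k) \<Rightarrow> ((nat \<Rightarrow>\<^sub>0 nat) \<Rightarrow>\<^sub>0 'c) \<Rightarrow> 'k"
  where "eval_poly \<iota> t P =
    (\<Sum>m\<in>Poly_Mapping.keys P. \<iota> (Poly_Mapping.lookup P m) *
       (\<Prod>i\<in>Poly_Mapping.keys m. t i ^ Poly_Mapping.lookup m i))"

definition gauss_norm :: "((nat \<Rightarrow>\<^sub>0 nat) \<Rightarrow>\<^sub>0 'c::nonarch_field) \<Rightarrow> real"
  where "gauss_norm P =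
    Max (insert 0 ((\<lambda>m. absv (Poly_Mapping.lookup P m)) ` Poly_Mapping.keys P))"

text \<open>The subfield \<open>F(t\<^sub>i : i \<in> S)\<close>.\<close>

definition rational_functions ::
    "('c::zero \<Rightarrow> 'k::field) \<Rightarrow> (nat \<Rightarrow> 'k) \<Rightarrow> 'c set \<Rightarrow> nat set \<Rightarrow> 'k set"
  where "rational_functions \<iota> t F S =
    {eval_poly \<iota> t P / eval_poly \<iota> t Q | P Q.
       P \<in> polys_in F S \<and> Q \<in> polys_in F S \<and> eval_poly \<iota> t Q \<noteq> 0}"

text \<open>
  \<open>'k\<close> is a completion of \<open>C\<^sub>\<infinity>(t\<^sub>S)\<close> for the Gauss norm. The second condition makes the \<open>t\<^sub>i\<close>
  algebraically independent over \<open>C\<^sub>\<infinity>\<close>.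
\<close>

definition is_K_Sigma ::
    "('c::nonarch_field \<Rightarrow> 'k::{nonarch_field,complete_space}) \<Rightarrow> nat set \<Rightarrow> (nat \<Rightarrow> 'k) \<Rightarrow> bool"
  where "is_K_Sigma \<iota> S t \<longleftrightarrow>
    field_hom \<iota> \<and>
    (\<forall>P\<in>polys_in UNIV S. absv (eval_poly \<iota> t P) = gauss_norm P) \<and>
    closure (rational_functions \<iota> t UNIV S) = UNIV"

definition is_tau ::
    "('a::{finite,field} fls \<Rightarrow> 'c::nonarch_field) \<Rightarrow> ('c \<Rightarrow> 'k::nonarch_field) \<Rightarrow> nat set \<Rightarrow>
     (nat \<Rightarrow> 'k) \<Rightarrow> ('k \<Rightarrow> 'k) \<Rightarrow> bool"
  where "is_tau \<phi> \<iota> S t \<tau> \<longleftrightarrow>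
    field_hom \<tau> \<and> bij \<tau> \<and> continuous_on UNIV \<tau> \<and>
    (\<forall>a\<in>rational_functions \<iota> t (Fq_set \<phi>) S. \<forall>x. \<tau> (a * x) = a * \<tau> x) \<and>
    (\<forall>c. \<tau> (\<iota> c) = \<iota> (c ^ CARD('a)))"


section \<open>Tame series\<close>

definition Zp_nonneg :: "nat \<Rightarrow> real set"
  where "Zp_nonneg p = {real a / real p ^ n | a n. True}"

definition is_q_expansion :: "nat \<Rightarrow> real \<Rightarrow> (int \<Rightarrow> nat) \<Rightarrow> bool"
  where "is_q_expansion q j d \<longleftrightarrow>
    (\<forall>k. d k < q) \<and> finite {k. d k \<noteq> 0} \<and>
    j = (\<Sum>k | d k \<noteq> 0. real (d k) * real q powi (- k))"

definition q_digit :: "nat \<Rightarrow> real \<Rightarrow> int \<Rightarrow> nat"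
  where "q_digit q j = (THE d. is_q_expansion q j d)"

definition digit_sum :: "nat \<Rightarrow> real \<Rightarrow> nat"
  where "digit_sum q j = (\<Sum>k | q_digit q j k \<noteq> 0. q_digit q j k)"

definition e_monomial ::
    "('a::{finite,field} fls \<Rightarrow> 'c::nonarch_field) \<Rightarrow> 'c \<Rightarrow> real \<Rightarrow> 'c \<Rightarrow> 'c"
  where "e_monomial \<phi> \<pi> j z =
    (\<Prod>k | q_digit CARD('a) j k \<noteq> 0. e_fun \<phi> \<pi> k z ^ q_digit CARD('a) j k)"

text \<open>
  The coefficient family \<open>c\<close> is indexed by \<open>\<real>\<close> and vanishes outside \<open>\<int>[1/p]\<^sub>\<ge>\<^sub>0\<close>.
\<close>

definition is_tame_expansion ::
    "('a::{finite,field} fls \<Rightarrow> 'c::nonarch_field) \<Rightarrow> 'c \<Rightarrow> ('c \<Rightarrow> 'k::nonarch_field) \<Rightarrow> 'k set \<Rightarrow>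
     (real \<Rightarrow> 'k) \<Rightarrow> ('c \<Rightarrow> 'k) \<Rightarrow> bool"
  where "is_tame_expansion \<phi> \<pi> \<iota> L c f \<longleftrightarrow>
    (\<forall>j. j \<notin> Zp_nonneg CHAR('a) \<longrightarrow> c j = 0) \<and>
    (\<forall>j. c j \<in> L) \<and>
    (\<exists>B. \<forall>j. c j \<noteq> 0 \<longrightarrow> digit_sum CARD('a) j \<le> B) \<and>
    bdd_above {j. c j \<noteq> 0} \<and>
    bdd_above (range (\<lambda>j. absv (c j))) \<and>
    (\<forall>z. ((\<lambda>j. c j * \<iota> (e_monomial \<phi> \<pi> j z)) has_sum f z) (Zp_nonneg CHAR('a)))"

definition tame_series ::
    "('a::{finite,field} fls \<Rightarrow> 'c::nonarch_field) \<Rightarrow> 'c \<Rightarrow> ('c \<Rightarrow> 'k::nonarch_field) \<Rightarrow> 'k set \<Rightarrow>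
     ('c \<Rightarrow> 'k) set"
  where "tame_series \<phi> \<pi> \<iota> L = {f. \<exists>c. is_tame_expansion \<phi> \<pi> \<iota> L c f}"

definition tame_series0 ::
    "('a::{finite,field} fls \<Rightarrow> 'c::nonarch_field) \<Rightarrow> 'c \<Rightarrow> ('c \<Rightarrow> 'k::nonarch_field) \<Rightarrow> 'k set \<Rightarrow>
     ('c \<Rightarrow> 'k) set"
  where "tame_series0 \<phi> \<pi> \<iota> L =
    {f. \<exists>c. is_tame_expansion \<phi> \<pi> \<iota> L c f \<and> (\<forall>j. c j \<noteq> 0 \<longrightarrow> j < 1)}"

definition tame_coeff ::
    "('a::{finite,field} fls \<Rightarrow> 'c::nonarch_field) \<Rightarrow> 'c \<Rightarrow> ('c \<Rightarrow> 'k::nonarch_field) \<Rightarrow> 'k set \<Rightarrow>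
     ('c \<Rightarrow> 'k) \<Rightarrow> real \<Rightarrow> 'k"
  where "tame_coeff \<phi> \<pi> \<iota> L f = (THE c. is_tame_expansion \<phi> \<pi> \<iota> L c f)"

definition tame_val ::
    "('a::{finite,field} fls \<Rightarrow> 'c::nonarch_field) \<Rightarrow> 'c \<Rightarrow> ('c \<Rightarrow> 'k::nonarch_field) \<Rightarrow> 'k set \<Rightarrow>
     ('c \<Rightarrow> 'k) \<Rightarrow> ereal"
  where "tame_val \<phi> \<pi> \<iota> L f =
    (if f = (\<lambda>_. 0) then \<infinity> else ereal (- (GREATEST j. tame_coeff \<phi> \<pi> \<iota> L f j \<noteq> 0)))"


section \<open>Completed fraction fields\<close>

definition additive_valuation :: "('f::field \<Rightarrow> ereal) \<Rightarrow> bool"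
  where "additive_valuation w \<longleftrightarrow>
    (\<forall>x. w x = \<infinity> \<longleftrightarrow> x = 0) \<and> (\<forall>x. w x \<noteq> -\<infinity>) \<and>
    (\<forall>x y. w (x * y) = w x + w y) \<and> (\<forall>x y. w (x + y) \<ge> min (w x) (w y))"

definition val_tendsto :: "('f::field \<Rightarrow> ereal) \<Rightarrow> ('i \<Rightarrow> 'f) \<Rightarrow> 'f \<Rightarrow> 'i filter \<Rightarrow> bool"
  where "val_tendsto w X l F \<longleftrightarrow> ((\<lambda>n. w (X n - l)) \<longlongrightarrow> \<infinity>) F"

definition val_Cauchy :: "('f::field \<Rightarrow> ereal) \<Rightarrow> (nat \<Rightarrow> 'f) \<Rightarrow> bool"
  where "val_Cauchy w X \<longleftrightarrow>
    (\<forall>B::real. \<exists>N. \<forall>m\<ge>N. \<forall>n\<ge>N. w (X m - X n) > ereal B)"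

text \<open>
  For a ring \<open>R\<close> of functions with pointwise operations and a valuation \<open>v\<close> on it: \<open>'f\<close> with the
  valuation \<open>w\<close> and the embedding \<open>emb\<close> of \<open>R\<close> is a \<open>v\<close>-adic completion of the fraction field
  of \<open>R\<close>. The values of \<open>emb\<close> outside \<open>R\<close> are irrelevant.
\<close>

definition is_completed_fraction_field ::
    "('x \<Rightarrow> 'k::field) set \<Rightarrow> (('x \<Rightarrow> 'k) \<Rightarrow> ereal) \<Rightarrow> (('x \<Rightarrow> 'k) \<Rightarrow> 'f::field) \<Rightarrow>
     ('f \<Rightarrow> ereal) \<Rightarrow> bool"
  where "is_completed_fraction_field R v emb w \<longleftrightarrow>
    inj_on emb R \<and> emb (\<lambda>_. 1) = 1 \<and>
    (\<forall>f\<in>R. \<forall>g\<in>R. emb (\<lambda>z. f z + g z) = emb f + emb g) \<and>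
    (\<forall>f\<in>R. \<forall>g\<in>R. emb (\<lambda>z. f z * g z) = emb f * emb g) \<and>
    additive_valuation w \<and>
    (\<forall>f\<in>R. w (emb f) = v f) \<and>
    (\<forall>x. \<forall>B::real. \<exists>f\<in>R. \<exists>g\<in>R. g \<noteq> (\<lambda>_. 0) \<and> w (x - emb f / emb g) > ereal B) \<and>
    (\<forall>X. val_Cauchy w X \<longrightarrow> (\<exists>l. val_tendsto w X l sequentially))"

end

(*
  Write e = e_0, T for the ring of tame series and T0 for the tame series of weight < 1.

  A monomial in the e_k is a finite multiset of integers. A bounded family of coefficients, supported
  on multisets of bounded size with elements bounded below, converges everywhere, since e_k(z) tends
  to 0 as k tends to infinity. The functional equation gives e_k^q = e_(k-1) - theta e_k. Rewriting
  with it lowers the degree, and only finitely many monomials of bounded degree lead to a given one;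
  hence products of tame series are tame and T = T0[e]. At suitable points a monomial of weight j
  has absolute value about exp(j Y) with Y arbitrarily large, so a series with nonzero leading
  coefficient is not the zero function: the tame expansion is unique and v can be read off from it.

  If g is tame and nonzero, a monomial m turns the leading exponent of g into an integer n, so that
  g m = kappa e^n (1 - u) with v(u) > 0. Expanding 1 / (1 - u) shows that T[1/e] = T0[e, 1/e] is dense.
  As v takes values in (-1, 0] on nonzero elements of T0, an element of valuation > m of T0[e, 1/e]
  has no terms f_i e^(-i) with i <= m. So the coefficients of approximations stabilise, which gives
  existence, and uniqueness follows in the same way.
*)

theory Submission
  imports Defs "HOL-Algebra.Sylow" "HOL-Algebra.Multiplicative_Group"
begin

section \<open>Non-archimedean fields\<close>

text \<open>Two obstacles shape the argument. Real exponents name only reduced monomials, whereas a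
  product of reduced monomials may contain q or more copies of some e_k, and the carry e_k^q =
  e_(k-1) - theta e_k is not exact. Indexing by multisets keeps unreduced monomials in play, and the
  carry is applied to a whole convergent series at once; the ultrametric inequality keeps the
  coefficients bounded, however many terms collect at one monomial. The exponents of a tame series
  can be infinite in number and can accumulate, for instance 1 + q^(-k) at 1. Bounded size forces
  accumulation to be from above only, so every nonempty part of a support has a largest weight. This
  provides both a leading exponent and a gap below it, and the gap lets the leading term dominate at
  the test points. The test points come from a root X of X^(q+1) = theta: the values exp_C(X /
  theta^k) avoid the one slope at which both terms of the recursion have equal absolute value.
  Scaling X by theta^n shifts the index k by n and makes the growth exact on ever larger ranges of
  k.\<close>

lemma absv_zero [simp]: "absv 0 = 0"
  by (simp add: absv_def)

lemma absv_eq_zero_iff [simp]: "absv x = 0 \<longleftrightarrow> x = 0"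
  by (simp add: absv_def)

lemma absv_nonneg [simp]: "absv x \<ge> 0"
  by (simp add: absv_def)

lemma absv_pos_iff [simp]: "absv x > 0 \<longleftrightarrow> x \<noteq> 0"
  by (simp add: absv_def)

lemma absv_mult: "absv (x * y) = absv x * absv y"
  by (simp add: absv_def dist_mult_zero)

lemma absv_one [simp]: "absv (1 :: 'a::nonarch_field) = 1"
  using absv_mult[of "1::'a" 1] absv_eq_zero_iff[of "1::'a"] by simp

lemma absv_power: "absv (x ^ n) = absv x ^ n"
  by (induction n) (simp_all add: absv_mult)

lemma absv_minus [simp]: "absv (- x) = absv (x :: 'a::nonarch_field)"
proof -
  have "absv (- x) ^ 2 = absv x ^ 2"
    by (metis absv_power power2_minus)
  thus ?thesis
    by (simp add: power2_eq_iff_nonneg)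
qed

lemma dist_eq_absv: "dist x y = absv (x - y :: 'a::nonarch_field)"
  using dist_translate[of x "- y" y] by (simp add: absv_def)

lemma absv_add_le: "absv (x + y) \<le> max (absv x) (absv (y :: 'a::nonarch_field))"
  using dist_ultrametric[of "x + y" 0 y] by (simp add: dist_eq_absv)

lemma absv_diff_le: "absv (x - y) \<le> max (absv x) (absv (y :: 'a::nonarch_field))"
  using absv_add_le[of x "- y"] by simp

text \<open>The isosceles principle: writing x as (x + y) - y gives the reverse inequality. The
  later comparisons of a dominant term with the others rest on it.\<close>

lemma absv_add_eq:
  fixes x y :: "'a::nonarch_field"
  assumes "absv y < absv x"
  shows "absv (x + y) = absv x"
proof (rule antisym)
  show "absv (x + y) \<le> absv x"
    using absv_add_le[of x y] assms by simp
  show "absv x \<le> absv (x + y)"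
    using absv_diff_le[of "x + y" y] assms by (simp add: max_def split: if_splits)
qed

lemma absv_diff_eq:
  fixes x y :: "'a::nonarch_field"
  assumes "absv y < absv x"
  shows "absv (x - y) = absv x"
  using absv_add_eq[of "- y" x] assms by simp

lemma absv_inverse: "absv (inverse x) = inverse (absv (x :: 'a::nonarch_field))"
proof (cases "x = 0")
  case False
  hence "absv x * absv (inverse x) = 1"
    by (simp flip: absv_mult)
  thus ?thesis
    using inverse_unique by metis
qed simp

lemma absv_divide: "absv (x / y) = absv x / absv (y :: 'a::nonarch_field)"
  by (simp add: divide_inverse absv_mult absv_inverse)

lemma absv_prod: "absv (prod f A) = (\<Prod>i\<in>A. absv (f i :: 'a::nonarch_field))"
  by (induction A rule: infinite_finite_induct) (simp_all add: absv_mult)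

lemma absv_sum_le:
  fixes f :: "'i \<Rightarrow> 'a::nonarch_field"
  assumes "\<And>i. i \<in> A \<Longrightarrow> absv (f i) \<le> B" "B \<ge> 0"
  shows "absv (sum f A) \<le> B"
  using assms(1)
proof (induction A rule: infinite_finite_induct)
  case (insert x F)
  have "absv (f x + sum f F) \<le> max (absv (f x)) (absv (sum f F))"
    by (rule absv_add_le)
  also have "\<dots> \<le> B"
    using insert by simp
  finally show ?case
    using insert by simp
qed (use assms(2) in auto)

lemma tendsto_absv_iff:
  fixes f :: "'i \<Rightarrow> 'a::nonarch_field"
  shows "(f \<longlongrightarrow> l) F \<longleftrightarrow> ((\<lambda>x. absv (f x - l)) \<longlongrightarrow> 0) F"
  by (subst tendsto_dist_iff) (simp add: dist_eq_absv)

text \<open>The laws for adding, negating and regrouping infinite sums are stated for topological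
  groups or monoids and become available through this instance.\<close>

instance nonarch_field \<subseteq> topological_ab_group_add
proof
  fix a b :: 'a
  show "LIM x (nhds a \<times>\<^sub>F nhds b). fst x + snd x :> nhds (a + b)"
    unfolding tendsto_absv_iff
  proof (rule tendsto_sandwich[OF _ _ tendsto_const])
    have "(fst \<longlongrightarrow> a) (nhds a \<times>\<^sub>F nhds b)" "(snd \<longlongrightarrow> b) (nhds a \<times>\<^sub>F nhds b)"
      by (rule filterlim_fst, rule filterlim_snd)
    hence "((\<lambda>x. absv (fst x - a)) \<longlongrightarrow> 0) (nhds a \<times>\<^sub>F nhds b)"
      "((\<lambda>x. absv (snd x - b)) \<longlongrightarrow> 0) (nhds a \<times>\<^sub>F nhds b)"
      by (simp_all add: tendsto_absv_iff)
    from tendsto_max[OF this]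
    show "((\<lambda>x. max (absv (fst x - a)) (absv (snd x - b))) \<longlongrightarrow> 0) (nhds a \<times>\<^sub>F nhds b)"
      by simp
    show "\<forall>\<^sub>F x in nhds a \<times>\<^sub>F nhds b.
            absv (fst x + snd x - (a + b)) \<le> max (absv (fst x - a)) (absv (snd x - b))"
    proof (intro always_eventually allI)
      fix x :: "'a \<times> 'a"
      show "absv (fst x + snd x - (a + b)) \<le> max (absv (fst x - a)) (absv (snd x - b))"
        using absv_add_le[of "fst x - a" "snd x - b"] by (simp add: algebra_simps)
    qed
  qed (auto intro: always_eventually)
  have "absv (- x - - a) = absv (x - a)" for x
    using absv_minus[of "x - a"] by (simp add: algebra_simps)
  moreover have "((\<lambda>x. absv (x - a)) \<longlongrightarrow> 0) (nhds a)"
    using tendsto_absv_iff[of "\<lambda>x. x" a "nhds a"] filterlim_ident by blast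
  ultimately show "(uminus \<longlongrightarrow> - a) (nhds a)"
    by (simp add: tendsto_absv_iff)
qed

lemma continuous_on_mult_nonarch: "continuous_on UNIV (\<lambda>x. c * x :: 'a::nonarch_field)"
  unfolding continuous_on_def tendsto_absv_iff right_diff_distrib[symmetric] absv_mult
proof (intro ballI)
  fix x :: 'a
  have "((\<lambda>y. absv (y - x)) \<longlongrightarrow> 0) (at x)"
    using tendsto_ident_at[of x UNIV] by (simp only: tendsto_absv_iff)
  from tendsto_mult_left[OF this, of "absv c"]
  show "((\<lambda>y. absv c * absv (y - x)) \<longlongrightarrow> 0) (at x)"
    by simp
qed

lemma has_sum_cmult_nonarch:
  fixes f :: "'i \<Rightarrow> 'a::nonarch_field"
  assumes "(f has_sum s) A"
  shows "((\<lambda>i. c * f i) has_sum (c * s)) A"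
  by (rule has_sum_homomorphism[OF assms _ _ continuous_on_mult_nonarch]) (simp_all add: algebra_simps)

text \<open>A finite subsum that avoids the finite set \<open>X n\<close> is at most 1 / (n + 1), no
  matter how many terms it has. So terms that become small suffice for unconditional convergence,
  and the sums over \<open>X n\<close> form a Cauchy sequence with the required limit.\<close>

lemma summable_on_nonarch:
  fixes f :: "'i \<Rightarrow> 'a::{nonarch_field,complete_space}"
  assumes small: "\<And>\<epsilon>. \<epsilon> > 0 \<Longrightarrow> finite {i\<in>I. absv (f i) \<ge> \<epsilon>}"
  shows "f summable_on I"
proof -
  define X where "X n = {i\<in>I. absv (f i) \<ge> inverse (real (Suc n))}" for n
  have fin: "finite (X n)" for n
    unfolding X_def by (rule small) simp
  have near: "absv (sum f Y - sum f (X n)) \<le> inverse (real (Suc n))"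
    if "finite Y" "X n \<subseteq> Y" "Y \<subseteq> I" for Y n
  proof -
    have "sum f Y - sum f (X n) = sum f (Y - X n)"
      using that fin by (simp add: sum_diff)
    also have "absv \<dots> \<le> inverse (real (Suc n))"
      using that by (intro absv_sum_le) (auto simp: X_def)
    finally show ?thesis .
  qed
  have mono: "X m \<subseteq> X n" if "m \<le> n" for m n
  proof -
    have "inverse (real (Suc n)) \<le> inverse (real (Suc m))"
      using that by (intro le_imp_inverse_le) auto
    thus ?thesis
      unfolding X_def using order_trans[of _ "inverse (real (Suc m))"]
      by (intro subsetI CollectI conjI) (blast, metis (mono_tags, lifting) mem_Collect_eq)
  qed
  have "Cauchy (\<lambda>n. sum f (X n))"
  proof (rule metric_CauchyI)
    fix e :: real assume "e > 0"
    then obtain N where N: "inverse (real (Suc N)) < e"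
      using reals_Archimedean[of e] by auto
    have "dist (sum f (X m)) (sum f (X n)) < e" if "m \<ge> N" "n \<ge> N" for m n
    proof -
      have "sum f (X m) - sum f (X n) = (sum f (X m) - sum f (X N)) - (sum f (X n) - sum f (X N))"
        by simp
      also have "absv \<dots> \<le> max (absv (sum f (X m) - sum f (X N))) (absv (sum f (X n) - sum f (X N)))"
        by (rule absv_diff_le)
      also have "\<dots> \<le> inverse (real (Suc N))"
        using that fin mono by (intro max.boundedI near) (auto simp: X_def)
      finally show ?thesis
        using N by (simp add: dist_eq_absv)
    qed
    thus "\<exists>M. \<forall>m\<ge>M. \<forall>n\<ge>M. dist (sum f (X m)) (sum f (X n)) < e"
      by blast
  qed
  then obtain s where s: "(\<lambda>n. sum f (X n)) \<longlonglongrightarrow> s"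
    by (metis Cauchy_convergent convergent_def)
  have "(sum f \<longlongrightarrow> s) (finite_subsets_at_top I)"
  proof (rule tendstoI)
    fix e :: real assume "e > 0"
    then obtain N where N: "inverse (real (Suc N)) < e"
      using reals_Archimedean[of e] by auto
    have "\<forall>\<^sub>F n in sequentially. dist (sum f (X n)) s < e"
      using s \<open>e > 0\<close> by (rule tendstoD)
    hence "\<forall>\<^sub>F n in sequentially. n \<ge> N \<and> dist (sum f (X n)) s < e"
      using eventually_ge_at_top by (rule eventually_conj[rotated])
    then obtain n where n: "n \<ge> N" "dist (sum f (X n)) s < e"
      using eventually_happens' trivial_limit_sequentially by blast
    have n': "inverse (real (Suc n)) < e"
      by (rule le_less_trans[OF le_imp_inverse_le N]) (use n(1) in auto)
    show "\<forall>\<^sub>F Y in finite_subsets_at_top I. dist (sum f Y) s < e"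
      unfolding eventually_finite_subsets_at_top
    proof (intro exI[of _ "X n"] conjI allI impI)
      fix Y assume Y: "finite Y \<and> X n \<subseteq> Y \<and> Y \<subseteq> I"
      have "dist (sum f Y) s \<le> max (dist (sum f Y) (sum f (X n))) (dist (sum f (X n)) s)"
        by (rule dist_ultrametric)
      also have "\<dots> < e"
        using n(2) n' near[of Y n] Y by (simp add: dist_eq_absv)
      finally show "dist (sum f Y) s < e" .
    qed (use fin in \<open>auto simp: X_def\<close>)
  qed
  thus ?thesis
    by (auto simp: summable_on_def has_sum_def)
qed

text \<open>If the limit s were larger than B, a finite subsum closer to s than
  \<open>absv s\<close> would itself have absolute value \<open>absv s\<close>, against the bound
  for finite sums.\<close>

lemma absv_has_sum_le:
  fixes f :: "'i \<Rightarrow> 'a::nonarch_field"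
  assumes "(f has_sum s) I" "\<And>i. i \<in> I \<Longrightarrow> absv (f i) \<le> B" "B \<ge> 0"
  shows "absv s \<le> B"
proof (rule ccontr)
  assume "\<not> absv s \<le> B"
  hence B: "B < absv s" by simp
  have "absv s > 0" using B assms(3) by linarith
  have "\<forall>\<^sub>F Y in finite_subsets_at_top I. dist (sum f Y) s < absv s"
    using assms(1) \<open>absv s > 0\<close> unfolding has_sum_def by (rule tendstoD)
  then obtain X where X: "finite X" "X \<subseteq> I"
    "\<forall>Y. finite Y \<and> X \<subseteq> Y \<and> Y \<subseteq> I \<longrightarrow> dist (sum f Y) s < absv s"
    unfolding eventually_finite_subsets_at_top by auto
  have "dist (sum f X) s < absv s"
    using X by auto
  hence "absv (s - sum f X) < absv s"
    by (subst (asm) dist_commute) (simp add: dist_eq_absv)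
  hence "absv (s - (s - sum f X)) = absv s"
    by (rule absv_diff_eq)
  moreover have "absv (sum f X) \<le> B"
    using X(2) assms by (intro absv_sum_le) auto
  ultimately show False
    using B by simp
qed

section \<open>Field homomorphisms and the characteristic\<close>

lemma field_hom_simps:
  assumes "field_hom h"
  shows "h 0 = 0" "h (- x) = - h x" "h (x - y) = h x - h y" "h (x + y) = h x + h y"
    "h (x * y) = h x * h y" "h 1 = 1" "h (x ^ n) = h x ^ n" "h (of_nat n) = of_nat n"
    "h x = 0 \<longleftrightarrow> x = 0"
proof -
  have add: "h (x + y) = h x + h y" and mult: "h (x * y) = h x * h y" and one: "h 1 = 1" for x y
    using assms by (auto simp: field_hom_def)
  show "h (x + y) = h x + h y" "h (x * y) = h x * h y" "h 1 = 1"
    by (fact add mult one)+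
  show zero: "h 0 = 0"
    using add[of 0 0] by (metis add.right_neutral add_left_cancel)
  show minus: "h (- x) = - h x" for x
    using add[of x "- x"] zero by (simp add: eq_neg_iff_add_eq_0 add.commute)
  show "h (x - y) = h x - h y"
    using add[of x "- y"] minus by simp
  show "h (x ^ n) = h x ^ n"
    by (induction n) (simp_all add: one mult)
  show "h (of_nat n) = of_nat n"
    by (induction n) (simp_all add: zero one add)
  show "h x = 0 \<longleftrightarrow> x = 0"
    using mult[of x "inverse x"] one zero by (cases "x = 0") auto
qed

lemma field_hom_CHAR:
  assumes "field_hom (h :: 'a::field \<Rightarrow> 'b::field)"
  shows "CHAR('b) = CHAR('a)"
proof (rule CHAR_eqI)
  show "of_nat CHAR('a) = (0 :: 'b)"
    using field_hom_simps(8)[OF assms, of "CHAR('a)"] field_hom_simps(1)[OF assms] by simp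
  show "CHAR('a) dvd n" if "of_nat n = (0 :: 'b)" for n
  proof -
    have "h (of_nat n) = 0"
      using that field_hom_simps(8)[OF assms, of n] by simp
    thus ?thesis
      using field_hom_simps(9)[OF assms] by (simp add: of_nat_eq_0_iff_char_dvd)
  qed
qed

text \<open>A prime r dividing the order of the additive group yields, by Sylow, a subgroup of order
  r and thus a nonzero x with r x = 0. So r is the characteristic, and no other prime divides the
  cardinality.\<close>

lemma CARD_finite_field_eq_CHAR_power:
  obtains n where "CARD('a::{finite,field}) = CHAR('a) ^ n" "n > 0"
proof -
  have pos: "CHAR('a) > 0"
    by (rule finite_imp_CHAR_pos) simp
  have prime: "prime CHAR('a)"
    using prime_CHAR_semidom[OF pos] .
  have "r = CHAR('a)" if r: "prime r" "r dvd CARD('a)" for r :: nat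
  proof -
    define G where "G = \<lparr>carrier = (UNIV :: 'a set), monoid.mult = (+), one = (0 :: 'a)\<rparr>"
    interpret group G
    proof (rule groupI)
      fix x assume "x \<in> carrier G"
      show "\<exists>y\<in>carrier G. y \<otimes>\<^bsub>G\<^esub> x = \<one>\<^bsub>G\<^esub>"
        by (intro bexI[of _ "- x"]) (auto simp: G_def)
    qed (auto simp: G_def add_ac)
    obtain m where m: "CARD('a) = r ^ 1 * m"
      using r(2) by auto
    have "\<exists>H. subgroup H G \<and> card H = r ^ 1"
      using m by (intro sylow_thm r(1) is_group) (auto simp: G_def order_def)
    then obtain H where H: "subgroup H G" "card H = r"
      by auto
    interpret H: group "G\<lparr>carrier := H\<rparr>"
      using H(1) by (rule subgroup.subgroup_is_group) (rule is_group)
    have "\<not> H \<subseteq> {0}"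
      using H(2) prime_gt_1_nat[OF r(1)] card_mono[of "{0}" H] by auto
    then obtain x where x: "x \<in> H" "x \<noteq> 0"
      by blast
    have "x [^]\<^bsub>G\<lparr>carrier := H\<rparr>\<^esub> n = of_nat n * x" for n :: nat
      by (induction n) (auto simp: G_def algebra_simps nat_pow_def)
    moreover have "x [^]\<^bsub>G\<lparr>carrier := H\<rparr>\<^esub> order (G\<lparr>carrier := H\<rparr>) = \<one>\<^bsub>G\<lparr>carrier := H\<rparr>\<^esub>"
      using x(1) by (intro H.pow_order_eq_1) simp
    ultimately have "of_nat r * x = 0"
      using H(2) by (simp add: G_def order_def)
    hence "of_nat r = (0 :: 'a)"
      using x(2) by simp
    hence "CHAR('a) dvd r"
      by (simp add: of_nat_eq_0_iff_char_dvd)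
    thus ?thesis
      using r(1) prime by (metis primes_dvd_imp_eq)
  qed
  hence pf: "prime_factors CARD('a) \<subseteq> {CHAR('a)}"
    by (auto simp: prime_factors_dvd)
  have "CARD('a) \<noteq> 0"
    by simp
  hence "CARD('a) = (\<Prod>p\<in>prime_factors CARD('a). p ^ multiplicity p CARD('a))"
    by (simp add: prod_prime_factors)
  also have "\<dots> = CHAR('a) ^ multiplicity CHAR('a) CARD('a)"
    by (subst prod.mono_neutral_left[OF _ pf])
       (use prime in \<open>auto simp: prime_factors_multiplicity\<close>)
  finally have eq: "CARD('a) = CHAR('a) ^ multiplicity CHAR('a) CARD('a)" .
  have "card {0, 1 :: 'a} \<le> CARD('a)"
    by (intro card_mono) auto
  hence "CARD('a) > 1"
    by simp
  hence "multiplicity CHAR('a) CARD('a) > 0"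
    using eq by (metis gr0I less_irrefl power_0)
  with eq show ?thesis
    using that by blast
qed

section \<open>Digit expansions as multisets\<close>

text \<open>
  A multiset \<open>M\<close> of integers stands for the monomial \<open>\<Prod>\<^sub>k e\<^sub>k ^ count M k\<close>. It is reduced if all
  multiplicities are digits in base \<open>q\<close>; then it is the expansion of its weight.
\<close>

definition wt :: "nat \<Rightarrow> int multiset \<Rightarrow> real"
  where "wt q M = (\<Sum>k\<in>#M. real q powi (- k))"

definition reduced :: "nat \<Rightarrow> int multiset \<Rightarrow> bool"
  where "reduced q M \<longleftrightarrow> (\<forall>k. count M k < q)"

lemma wt_empty [simp]: "wt q {#} = 0"
  by (simp add: wt_def)

lemma wt_add_mset [simp]: "wt q (add_mset k M) = real q powi (- k) + wt q M"
  by (simp add: wt_def)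

lemma wt_union [simp]: "wt q (M + N) = wt q M + wt q N"
  by (simp add: wt_def)

lemma wt_replicate [simp]: "wt q (replicate_mset n k) = real n * real q powi (- k)"
  by (induction n) (simp_all add: algebra_simps)

lemma wt_nonneg [simp]: "wt q M \<ge> 0"
  by (induction M) simp_all

lemma wt_diff: "N \<subseteq># M \<Longrightarrow> wt q (M - N) = wt q M - wt q N"
  by (metis add_diff_cancel_right' subset_mset.diff_add wt_union)

lemma wt_ge_member: "k \<in># M \<Longrightarrow> real q powi (- k) \<le> wt q M"
  by (metis insert_DiffM le_add_same_cancel1 wt_add_mset wt_nonneg)

lemma wt_eq_sum: "wt q M = (\<Sum>k\<in>set_mset M. real (count M k) * real q powi (- k))"
proof (induction M)
  case (add x M)
  show ?case
  proof (cases "x \<in># M")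
    case True
    have "(\<Sum>k\<in>set_mset (add_mset x M). real (count (add_mset x M) k) * real q powi (- k)) =
      (\<Sum>k\<in>set_mset M. real (count M k) * real q powi (- k) + (if k = x then real q powi (- x) else 0))"
      using True by (intro sum.cong) (auto simp: algebra_simps)
    thus ?thesis
      using True add by (simp add: sum.distrib)
  next
    case False
    hence "count M x = 0"
      by (simp add: not_in_iff)
    moreover have "(\<Sum>k\<in>set_mset M. real (count (add_mset x M) k) * real q powi (- k)) =
      (\<Sum>k\<in>set_mset M. real (count M k) * real q powi (- k))"
      using False by (intro sum.cong) auto
    ultimately show ?thesis
      using False add by simp
  qed
qed simp

lemma finite_bounded_multisets:
  assumes "finite A"
  shows "finite {M. set_mset M \<subseteq> A \<and> size M \<le> D}"
proof (rule finite_subset)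
  show "{M. set_mset M \<subseteq> A \<and> size M \<le> D} \<subseteq> mset ` {xs. set xs \<subseteq> A \<and> length xs \<le> D}"
  proof
    fix M assume M: "M \<in> {M. set_mset M \<subseteq> A \<and> size M \<le> D}"
    obtain xs where "mset xs = M"
      using ex_mset by blast
    thus "M \<in> mset ` {xs. set xs \<subseteq> A \<and> length xs \<le> D}"
      using M by auto
  qed
  show "finite (mset ` {xs. set xs \<subseteq> A \<and> length xs \<le> D})"
    using finite_lists_length_le[OF assms] by simp
qed

lemma finite_submultisets: "finite {N. N \<subseteq># (M :: 'a multiset)}"
  by (rule finite_subset[OF _ finite_bounded_multisets[of "set_mset M" "size M"]])
     (auto dest: set_mset_mono size_mset_mono mset_subset_eqD)

context
  fixes q :: nat
  assumes q: "q \<ge> 2"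
begin

lemma powi_mono: "k \<le> l \<Longrightarrow> real q powi (- l) \<le> real q powi (- k)"
  using q by (intro power_int_increasing) auto

lemma powi_pos: "real q powi k > 0"
  using q by simp

lemma powi_pred: "real q powi (- (k - 1)) = real q * real q powi (- k)"
  using q power_int_add[of "real q" 1 "- k"] by simp

lemma wt_le_size:
  assumes "\<forall>k\<in>#M. k0 \<le> k"
  shows "wt q M \<le> real (size M) * real q powi (- k0)"
  using assms
proof (induction M)
  case (add k M)
  have "real q powi (- k) \<le> real q powi (- k0)"
    using add.prems by (intro powi_mono) simp
  thus ?case
    using add by (simp add: algebra_simps)
qed simp

text \<open>This replaces finiteness of the support: weights may accumulate, but only from above. A
  multiset of weight at least w0 > 0 must contain an element of a finite interval, since few large
  elements weigh too little. Removing that element lowers the size bound, so induction supplies a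
  maximum for each of the finitely many choices.\<close>

lemma ex_wt_max:
  assumes "S \<noteq> {}" "\<And>M. M \<in> S \<Longrightarrow> size M \<le> D" "\<And>M k. M \<in> S \<Longrightarrow> k \<in># M \<Longrightarrow> k0 \<le> k"
  shows "\<exists>M\<in>S. \<forall>N\<in>S. wt q N \<le> wt q M"
  using assms
proof (induction D arbitrary: S)
  case 0
  hence "M = {#}" if "M \<in> S" for M
    using that by fastforce
  thus ?case
    using \<open>S \<noteq> {}\<close> by force
next
  case (Suc D)
  obtain M0 where M0: "M0 \<in> S"
    using Suc.prems(1) by blast
  show ?case
  proof (cases "\<forall>N\<in>S. wt q N \<le> wt q M0")
    case True
    thus ?thesis
      using M0 by blast
  next
    case False
    \<comment> \<open>If M0 is not maximal, some weight is strictly positive. Such a threshold is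
      essential, as small weights put no upper bound on the elements.\<close>
    then obtain N1 where N1: "N1 \<in> S" "wt q M0 < wt q N1"
      by (auto simp: not_le)
    define w0 where "w0 = wt q N1"
    have w0: "w0 > 0"
      using N1(2) wt_nonneg[of q M0] unfolding w0_def by linarith
    have "w0 / real (Suc D) > 0" "inverse (real q) < 1"
      using w0 q by (simp_all add: inverse_less_1_iff)
    then obtain n where "inverse (real q) ^ n < w0 / real (Suc D)"
      using real_arch_pow_inv by blast
    hence n: "real (Suc D) * real q powi (- int n) < w0"
      by (simp add: pos_less_divide_eq power_int_minus mult.commute power_inverse del: of_nat_Suc)
    have small: "\<exists>k\<in>#N. k \<le> int n" if "N \<in> S" "w0 \<le> wt q N" for N
    proof (rule ccontr)
      assume "\<not> (\<exists>k\<in>#N. k \<le> int n)"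
      hence "wt q N \<le> real (size N) * real q powi (- int n)"
        by (intro wt_le_size) auto
      also have "\<dots> \<le> real (Suc D) * real q powi (- int n)"
        using Suc.prems(2)[OF that(1)] powi_pos[of "- int n"] by (intro mult_right_mono) auto
      finally show False
        using n that(2) by simp
    qed
    define S' where "S' k = (\<lambda>N. N - {#k#}) ` {N\<in>S. k \<in># N}" for k
    define F where "F = {k\<in>{k0..int n}. S' k \<noteq> {}}"
    have "\<exists>M\<in>S' k. \<forall>N\<in>S' k. wt q N \<le> wt q M" if "k \<in> F" for k
    proof (rule Suc.IH)
      show "S' k \<noteq> {}"
        using that by (simp add: F_def)
      show "size M \<le> D" if M: "M \<in> S' k" for M
      proof -
        obtain N where "N \<in> S" "k \<in># N" "M = N - {#k#}"
          using M by (auto simp: S'_def)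
        thus ?thesis
          using Suc.prems(2)[of N] by (simp add: size_Diff_singleton)
      qed
      show "k0 \<le> j" if "M \<in> S' k" "j \<in># M" for M j
        using that Suc.prems(3) by (auto simp: S'_def dest: in_diffD)
    qed
    hence "\<forall>k\<in>F. \<exists>M. M \<in> S' k \<and> (\<forall>N\<in>S' k. wt q N \<le> wt q M)"
      by blast
    then obtain P where P: "\<And>k. k \<in> F \<Longrightarrow> P k \<in> S' k"
      "\<And>k N. k \<in> F \<Longrightarrow> N \<in> S' k \<Longrightarrow> wt q N \<le> wt q (P k)"
      by (auto dest!: bchoice)
    have P_in: "add_mset k (P k) \<in> S" if "k \<in> F" for k
      using P(1)[OF that] by (auto simp: S'_def)
    have "finite F"
      by (rule finite_subset[of _ "{k0..int n}"]) (auto simp: F_def)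
    have F_ex: "\<exists>k\<in>F. wt q N \<le> wt q (add_mset k (P k))" if "N \<in> S" "w0 \<le> wt q N" for N
    proof -
      obtain k where k: "k \<in># N" "k \<le> int n"
        using small[OF \<open>N \<in> S\<close> \<open>w0 \<le> wt q N\<close>] by blast
      have N': "N - {#k#} \<in> S' k"
        using k that by (auto simp: S'_def)
      hence "k \<in> F"
        using k Suc.prems(3) that by (auto simp: F_def)
      moreover have "wt q N = real q powi (- k) + wt q (N - {#k#})"
        using k(1) by (metis insert_DiffM wt_add_mset)
      ultimately show ?thesis
        using P(2)[OF _ N'] by (intro bexI[of _ k]) auto
    qed
    hence "F \<noteq> {}"
      using F_ex[OF N1(1)] by (auto simp: w0_def)
    define m where "m = Max ((\<lambda>k. wt q (add_mset k (P k))) ` F)"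
    have "m \<in> (\<lambda>k. wt q (add_mset k (P k))) ` F"
      unfolding m_def using \<open>finite F\<close> \<open>F \<noteq> {}\<close> by (intro Max_in) auto
    then obtain k where k: "k \<in> F" "m = wt q (add_mset k (P k))"
      by blast
    have le_m: "wt q (add_mset l (P l)) \<le> m" if "l \<in> F" for l
      unfolding m_def using \<open>finite F\<close> that by (intro Max_ge) auto
    have big: "wt q N \<le> m" if "N \<in> S" "w0 \<le> wt q N" for N
      using F_ex[OF that] le_m order_trans by blast
    have "wt q N \<le> m" if "N \<in> S" for N
      using big[OF that] big[OF N1(1)] w0_def by (cases "w0 \<le> wt q N") auto
    thus ?thesis
      using P_in[OF k(1)] k(2) by blast
  qed
qed

section \<open>Existence and uniqueness of reduced expansions\<close>

lemma sum_top_digits: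
  assumes "k \<le> K"
  shows "(\<Sum>j\<in>{k<..K}. (real q - 1) * real q powi (- j)) = real q powi (- k) - real q powi (- K)"
  using assms
proof (induction K rule: int_ge_induct)
  case (step K)
  have "{k<..K + 1} = insert (K + 1) {k<..K}"
    using step.hyps by auto
  moreover have "real q powi (- K) = real q * real q powi (- (K + 1))"
    using powi_pred[of "K + 1"] by simp
  ultimately show ?case
    using step.IH by (simp add: algebra_simps)
qed simp

text \<open>The finite analogue of 0.99...9 < 1: even with all digits equal to q - 1 down to
  position K, the weight falls short by q^(-K).\<close>

lemma reduced_wt_less:
  assumes "reduced q M" "\<forall>j\<in>#M. k < j"
  shows "wt q M < real q powi (- k)"
proof -
  define K where "K = Max (insert k (set_mset M))"
  have K: "k \<le> K" "\<And>j. j \<in># M \<Longrightarrow> j \<le> K"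
    by (auto simp: K_def)
  have "wt q M = (\<Sum>j\<in>set_mset M. real (count M j) * real q powi (- j))"
    by (rule wt_eq_sum)
  also have "\<dots> \<le> (\<Sum>j\<in>set_mset M. (real q - 1) * real q powi (- j))"
  proof (intro sum_mono mult_right_mono)
    fix j
    have "count M j < q"
      using assms(1) by (simp add: reduced_def)
    thus "real (count M j) \<le> real q - 1"
      by linarith
  qed simp
  also have "\<dots> \<le> (\<Sum>j\<in>{k<..K}. (real q - 1) * real q powi (- j))"
    using K assms(2) q by (intro sum_mono2) auto
  also have "\<dots> = real q powi (- k) - real q powi (- K)"
    by (rule sum_top_digits[OF K(1)])
  also have "\<dots> < real q powi (- k)"
    using powi_pos[of "- K"] by simp
  finally show ?thesis .
qed

text \<open>After cancelling the common part, the least remaining element k lies on one side only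
  and contributes q^(-k). Everything on the other side is greater than k and, being still reduced,
  weighs strictly less.\<close>

lemma reduced_wt_inj:
  assumes "reduced q M" "reduced q N" "wt q M = wt q N"
  shows "M = N"
proof (rule ccontr)
  assume "M \<noteq> N"
  define A B where "A = M - N" and "B = N - M"
  have red: "reduced q A" "reduced q B"
    using assms(1,2) by (auto simp: A_def B_def reduced_def less_imp_diff_less)
  have "M \<inter># N \<subseteq># M" "M \<inter># N \<subseteq># N"
    by auto
  moreover have "A = M - (M \<inter># N)" "B = N - (M \<inter># N)"
    by (auto simp: A_def B_def multiset_eq_iff)
  ultimately have eq: "wt q A = wt q B"
    using assms(3) by (simp only: wt_diff)
  have disj: "k \<notin># B" if "k \<in># A" for k
    using that by (simp add: A_def B_def in_diff_count)
  have less: False if "reduced q Y" "k \<in># X" "\<forall>j\<in>#Y. k < j" "wt q X = wt q Y" for X Y k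
    using reduced_wt_less[OF that(1,3)] wt_ge_member[OF that(2), of q] that(4) by linarith
  have "A + B \<noteq> {#}"
    using \<open>M \<noteq> N\<close> by (auto simp: A_def B_def Diff_eq_empty_iff_mset)
  define k where "k = Min (set_mset (A + B))"
  have "k \<in># A + B"
    unfolding k_def using \<open>A + B \<noteq> {#}\<close> by (intro Min_in) (auto simp del: set_mset_union)
  moreover have min: "k \<le> j" if "j \<in># A + B" for j
    unfolding k_def using that by (intro Min_le) auto
  ultimately show False
  proof (cases "k \<in># A")
    case True
    have "\<forall>j\<in>#B. k < j"
      using min disj[OF True] by (force simp: order_less_le)
    thus False
      using less[OF red(2) True] eq by simp
  next
    case False
    hence k: "k \<in># B"
      using \<open>k \<in># A + B\<close> by simp
    have "\<forall>j\<in>#A. k < j"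
      using min False by (force simp: order_less_le)
    thus False
      using less[OF red(1) k] eq by simp
  qed
qed

text \<open>A multiset of least size with the given weight is reduced, since q copies of k could be
  traded for a single k - 1, which has the same weight and lowers the size by q - 1.\<close>

lemma ex_reduced: "\<exists>N. reduced q N \<and> wt q N = wt q M"
proof -
  have "\<exists>N. wt q N = wt q M \<and> (\<forall>N'. wt q N' = wt q M \<longrightarrow> size N \<le> size N')"
    using ex_has_least_nat[of "\<lambda>N. wt q N = wt q M" M size] by blast
  then obtain N where N: "wt q N = wt q M" "\<And>N'. wt q N' = wt q M \<Longrightarrow> size N \<le> size N'"
    by blast
  have "count N k < q" for k
  proof (rule ccontr)
    assume "\<not> count N k < q"
    hence sub: "replicate_mset q k \<subseteq># N"
      by (simp flip: count_le_replicate_mset_subset_eq)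
    define N' where "N' = add_mset (k - 1) (N - replicate_mset q k)"
    have "wt q N' = wt q M"
      using sub N(1) powi_pred[of k] by (simp add: N'_def wt_diff)
    hence "size N \<le> size N'"
      by (rule N(2))
    moreover have "size N' = size N - q + 1" "q \<le> size N"
      using sub size_mset_mono[OF sub] by (simp_all add: N'_def size_Diff_submset)
    ultimately show False
      using q by simp
  qed
  thus ?thesis
    using N(1) by (auto simp: reduced_def)
qed

lemma ex_reduced_fraction: "\<exists>M. reduced q M \<and> wt q M = real a / real q ^ n"
  using ex_reduced[of "replicate_mset a (int n)"] by (simp add: power_int_minus field_simps)

lemma wt_eq_fraction: "\<exists>a n. wt q M = real a / real q ^ n"
proof (induction M)
  case empty
  show ?case
    by (intro exI[of _ 0]) simp
next
  case (add k M)
  then obtain a n where an: "wt q M = real a / real q ^ n"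
    by blast
  define m where "m = nat \<bar>k\<bar> + n"
  have "real q powi (- k) = real (q ^ nat (int m - k)) / real q ^ m"
  proof -
    have nat_eq: "int (nat (int m - k)) = int m - k"
      by (simp add: m_def)
    have "real (q ^ nat (int m - k)) = real q powi (int m - k)"
      by (subst nat_eq [symmetric], subst power_int_of_nat) simp
    also have "\<dots> = real q powi (- k) * real q ^ m"
      using q power_int_add[of "real q" "- k" "int m"] by (simp add: algebra_simps)
    finally show ?thesis
      using q by simp
  qed
  moreover have "real a / real q ^ n = real (a * q ^ (m - n)) / real q ^ m"
    using q by (simp add: m_def power_add)
  ultimately have "wt q (add_mset k M) = real (q ^ nat (int m - k) + a * q ^ (m - n)) / real q ^ m"
    using an by (simp add: add_divide_distrib)
  thus ?case
    by blast
qed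

end

section \<open>Series in monomials\<close>

lemma is_subfield_closed:
  assumes "is_subfield L"
  shows "0 \<in> L" "1 \<in> L" "x \<in> L \<Longrightarrow> y \<in> L \<Longrightarrow> x - y \<in> L" "x \<in> L \<Longrightarrow> - x \<in> L"
    "x \<in> L \<Longrightarrow> y \<in> L \<Longrightarrow> x + y \<in> L" "x \<in> L \<Longrightarrow> y \<in> L \<Longrightarrow> x * y \<in> L" "x \<in> L \<Longrightarrow> inverse x \<in> L"
proof -
  have diff: "x - y \<in> L" if "x \<in> L" "y \<in> L" for x y
    using assms that by (auto simp: is_subfield_def)
  have zero: "0 \<in> L"
    using assms by (simp add: is_subfield_def)
  have uminus: "- x \<in> L" if "x \<in> L" for x
    using diff[OF zero that] by simp
  show "0 \<in> L" "x \<in> L \<Longrightarrow> y \<in> L \<Longrightarrow> x - y \<in> L" "x \<in> L \<Longrightarrow> - x \<in> L"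
    using zero diff uminus by auto
  show "x \<in> L \<Longrightarrow> y \<in> L \<Longrightarrow> x + y \<in> L"
    using diff[of x "- y"] uminus[of y] by simp
  show "1 \<in> L" "x \<in> L \<Longrightarrow> y \<in> L \<Longrightarrow> x * y \<in> L" "x \<in> L \<Longrightarrow> inverse x \<in> L"
    using assms by (auto simp: is_subfield_def)
qed

text \<open>
  The properties of the functions \<open>e\<^sub>k\<close> that matter: the recursion coming from
  \<open>exp\<^sub>C(\<theta>X) = \<theta> exp\<^sub>C(X) + exp\<^sub>C(X)\<^sup>q\<close>, and a sequence of points \<open>\<zeta> n\<close> at which the
  absolute value of a monomial is essentially an exponential function of its weight, with a rate
  \<open>Y n\<close> that tends to infinity.
\<close>

locale tame_system =
  fixes q :: nat
    and e :: "int \<Rightarrow> 'x \<Rightarrow> 'k::{nonarch_field,complete_space}"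
    and th :: 'k
    and L :: "'k set"
    and \<zeta> :: "nat \<Rightarrow> 'x"
    and Y :: "nat \<Rightarrow> real"
  assumes q_ge_2: "q \<ge> 2"
    and e_pred: "e (k - 1) z = e k z ^ q + th * e k z"
    and e_tendsto_0: "(\<lambda>n. e (int n) z) \<longlonglongrightarrow> 0"
    and subfield: "is_subfield L"
    and th_in: "th \<in> L"
    and growth_le: "absv (e k (\<zeta> n)) \<le> exp (Y n * real q powi (- k))"
    and growth_eq: "k < int n \<Longrightarrow> absv (e k (\<zeta> n)) = exp (Y n * real q powi (- k))"
    and Y_at_top: "filterlim Y at_top sequentially"
begin

lemmas L_closed = is_subfield_closed[OF subfield]

lemma L_sum: "(\<And>i. i \<in> A \<Longrightarrow> f i \<in> L) \<Longrightarrow> sum f A \<in> L"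
  by (induction A rule: infinite_finite_induct) (auto intro: L_closed)

definition mon :: "'x \<Rightarrow> int multiset \<Rightarrow> 'k"
  where "mon z M = (\<Prod>k\<in>#M. e k z)"

lemma mon_simps [simp]:
  "mon z {#} = 1" "mon z (add_mset k M) = e k z * mon z M" "mon z (M + N) = mon z M * mon z N"
  "mon z (replicate_mset n k) = e k z ^ n"
  by (simp_all add: mon_def)

text \<open>Reducedness is not demanded, so that the class survives products. The lower bound on the
  elements replaces the upper bound on the exponents: for bounded size the two amount to the same, a
  small index k meaning a large weight q^(-k).\<close>

definition admissible :: "(int multiset \<Rightarrow> 'k) \<Rightarrow> bool"
  where "admissible c \<longleftrightarrow> (\<forall>M. c M \<in> L) \<and> (\<exists>D. \<forall>M. c M \<noteq> 0 \<longrightarrow> size M \<le> D) \<and>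
    (\<exists>k0. \<forall>M k. c M \<noteq> 0 \<longrightarrow> k \<in># M \<longrightarrow> k0 \<le> k) \<and> (\<exists>B. \<forall>M. absv (c M) \<le> B)"

definition represents :: "(int multiset \<Rightarrow> 'k) \<Rightarrow> ('x \<Rightarrow> 'k) \<Rightarrow> bool"
  where "represents c f \<longleftrightarrow>
    admissible c \<and> (\<forall>z. ((\<lambda>M. c M * mon z M) has_sum f z) UNIV)"

definition tame :: "('x \<Rightarrow> 'k) \<Rightarrow> bool"
  where "tame f \<longleftrightarrow> (\<exists>c. represents c f \<and> (\<forall>M. c M \<noteq> 0 \<longrightarrow> reduced q M))"

definition tame0 :: "('x \<Rightarrow> 'k) \<Rightarrow> bool"
  where "tame0 f \<longleftrightarrow> (\<exists>c. represents c f \<and> (\<forall>M. c M \<noteq> 0 \<longrightarrow> reduced q M \<and> wt q M < 1))"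

lemma e_bounded: "\<exists>C\<ge>1. \<forall>k\<ge>k0. absv (e k z) \<le> C"
proof -
  have "\<forall>\<^sub>F n in sequentially. dist (e (int n) z) 0 < 1"
    using e_tendsto_0[of z] by (rule tendstoD) simp
  then obtain n0 where n0: "\<And>n. n \<ge> n0 \<Longrightarrow> absv (e (int n) z) < 1"
    by (auto simp: eventually_sequentially absv_def)
  define C where "C = Max (insert 1 ((\<lambda>k. absv (e k z)) ` {k0..int n0}))"
  have "C \<ge> 1"
    by (simp add: C_def)
  moreover have "absv (e k z) \<le> C" if "k \<ge> k0" for k
  proof (cases "k \<le> int n0")
    case True
    thus ?thesis
      unfolding C_def using that by (intro Max_ge) auto
  next
    case False
    thus ?thesis
      using n0[of "nat k"] \<open>C \<ge> 1\<close> by (simp add: nat_le_iff le_nat_iff)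
  qed
  ultimately show ?thesis
    by blast
qed

lemma absv_mon_le:
  assumes "C \<ge> 0" "\<And>k. k \<in># M \<Longrightarrow> absv (e k z) \<le> C"
  shows "absv (mon z M) \<le> C ^ size M"
  using assms(2) by (induction M) (auto simp: absv_mult intro!: mult_mono assms(1))

text \<open>For fixed z the values e_k(z) drop below \<open>\<delta>\<close> once k is large, and
  one such factor pushes a term below \<open>\<epsilon>\<close>; the other terms involve multisets
  over a finite interval. The index set is kept separate from the multisets because products and
  carries send several terms to the same monomial.\<close>

lemma summable_family:
  assumes coeff: "\<And>i. i \<in> I \<Longrightarrow> absv (a i) \<le> B"
    and size: "\<And>i. i \<in> I \<Longrightarrow> size (N i) \<le> D"
    and low: "\<And>i k. i \<in> I \<Longrightarrow> k \<in># N i \<Longrightarrow> k0 \<le> k"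
    and fibre: "\<And>M. finite {i\<in>I. N i = M}"
  shows "(\<lambda>i. a i * mon z (N i)) summable_on I"
proof (rule summable_on_nonarch)
  fix \<epsilon> :: real assume \<epsilon>: "\<epsilon> > 0"
  obtain C where C: "C \<ge> 1" "\<And>k. k \<ge> k0 \<Longrightarrow> absv (e k z) \<le> C"
    using e_bounded by blast
  \<comment> \<open>The divisor accounts for the coefficient, at most \<open>max B 1\<close>, and
    for the fewer than D other factors, at most C \<ge> 1 each.\<close>
  define \<delta> where "\<delta> = \<epsilon> / (max B 1 * C ^ D)"
  have "\<delta> > 0"
    using \<epsilon> C(1) by (simp add: \<delta>_def)
  hence "\<forall>\<^sub>F n in sequentially. dist (e (int n) z) 0 < \<delta>"
    using e_tendsto_0[of z] by (intro tendstoD)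
  then obtain n0 where n0: "\<And>n. n \<ge> n0 \<Longrightarrow> absv (e (int n) z) < \<delta>"
    by (auto simp: eventually_sequentially absv_def)
  define F where "F = {M. set_mset M \<subseteq> {k0..int n0} \<and> size M \<le> D}"
  have "N i \<in> F" if i: "i \<in> I" and ge: "absv (a i * mon z (N i)) \<ge> \<epsilon>" for i
  proof -
    have "k \<le> int n0" if k: "k \<in># N i" for k
    proof (rule ccontr)
      assume "\<not> k \<le> int n0"
      hence ek: "absv (e k z) < \<delta>"
        using n0[of "nat k"] by simp
      obtain M where M: "N i = add_mset k M"
        using k by (metis insert_DiffM)
      have "absv (mon z M) \<le> C ^ size M"
        using low[OF i] C by (intro absv_mon_le) (auto simp: M)
      also have "\<dots> \<le> C ^ D"
        using size[OF i] C(1) by (intro power_increasing) (auto simp: M)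
      finally have "absv (e k z) * absv (mon z M) \<le> absv (e k z) * C ^ D"
        by (intro mult_left_mono) auto
      also have "\<dots> < \<delta> * C ^ D"
        using ek C(1) by (intro mult_strict_right_mono) auto
      finally have "absv (e k z) * absv (mon z M) < \<delta> * C ^ D" .
      hence "max B 1 * (absv (e k z) * absv (mon z M)) < max B 1 * (\<delta> * C ^ D)"
        by (intro mult_strict_left_mono) auto
      moreover have "absv (a i) * (absv (e k z) * absv (mon z M))
          \<le> max B 1 * (absv (e k z) * absv (mon z M))"
        using coeff[OF i] by (intro mult_right_mono) (auto intro: max.coboundedI1)
      ultimately have "absv (a i) * (absv (e k z) * absv (mon z M)) < max B 1 * (\<delta> * C ^ D)"
        by linarith
      also have "\<dots> = \<epsilon>"
        using C(1) by (simp add: \<delta>_def)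
      finally show False
        using ge by (simp add: M absv_mult)
    qed
    thus ?thesis
      using low[OF i] size[OF i] by (auto simp: F_def)
  qed
  hence "{i\<in>I. absv (a i * mon z (N i)) \<ge> \<epsilon>} \<subseteq> (\<Union>M\<in>F. {i\<in>I. N i = M})"
    by auto
  moreover have "finite F"
    unfolding F_def by (intro finite_bounded_multisets) simp
  ultimately show "finite {i\<in>I. absv (a i * mon z (N i)) \<ge> \<epsilon>}"
    using fibre by (meson finite_UN_I finite_subset)
qed

text \<open>Summing over the fibres of \<open>N\<close> turns the family into a series over
  monomials. The ultrametric inequality preserves a common coefficient bound without any bound on
  the size of the fibres.\<close>

lemma regroup_family:
  assumes coeff: "\<And>i. i \<in> I \<Longrightarrow> absv (a i) \<le> B" and L: "\<And>i. i \<in> I \<Longrightarrow> a i \<in> L"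
    and size: "\<And>i. i \<in> I \<Longrightarrow> size (N i) \<le> D"
    and low: "\<And>i k. i \<in> I \<Longrightarrow> k \<in># N i \<Longrightarrow> k0 \<le> k"
    and fibre: "\<And>M. finite {i\<in>I. N i = M}"
    and sum: "\<And>z. ((\<lambda>i. a i * mon z (N i)) has_sum f z) I"
  shows "represents (\<lambda>M. \<Sum>i\<in>{i\<in>I. N i = M}. a i) f"
proof -
  define c where "c = (\<lambda>M. \<Sum>i\<in>{i\<in>I. N i = M}. a i)"
  have nz: "\<exists>i\<in>I. N i = M" if "c M \<noteq> 0" for M
    using that unfolding c_def by (metis (mono_tags, lifting) mem_Collect_eq sum.not_neutral_contains_not_neutral)
  have "absv (c M) \<le> max B 0" for M
    unfolding c_def by (intro absv_sum_le) (auto intro: max.coboundedI1 coeff)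
  moreover have "c M \<in> L" for M
    unfolding c_def by (intro L_sum) (auto intro: L)
  moreover have "size M \<le> D" if "c M \<noteq> 0" for M
    using nz[OF that] size by auto
  moreover have "k0 \<le> k" if "c M \<noteq> 0" "k \<in># M" for M k
    using nz[OF that(1)] that(2) low by auto
  ultimately have "admissible c"
    unfolding admissible_def by blast
  moreover have "((\<lambda>M. c M * mon z M) has_sum f z) UNIV" for z
  proof (rule has_sum_SigmaD)
    have "bij_betw (\<lambda>i. (N i, i)) I (SIGMA M:UNIV. {i\<in>I. N i = M})"
      by (rule bij_betwI[where g = snd]) auto
    from has_sum_reindex_bij_betw[OF this, of "\<lambda>(M, i). a i * mon z (N i)"]
    show "((\<lambda>(M, i). a i * mon z (N i)) has_sum f z) (SIGMA M:UNIV. {i\<in>I. N i = M})"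
      using sum[of z] by simp
    show "((\<lambda>i. case (M, i) of (M, i) \<Rightarrow> a i * mon z (N i)) has_sum c M * mon z M) {i\<in>I. N i = M}"
      for M
      using fibre[of M] by (intro has_sum_finiteI) (auto simp: c_def sum_distrib_right)
  qed
  ultimately have "represents c f"
    by (simp add: represents_def)
  thus ?thesis
    by (simp only: c_def)
qed

lemma admissibleE:
  assumes "admissible c"
  obtains D k0 B where "\<And>M. c M \<in> L" "\<And>M. c M \<noteq> 0 \<Longrightarrow> size M \<le> D"
    "\<And>M k. c M \<noteq> 0 \<Longrightarrow> k \<in># M \<Longrightarrow> k0 \<le> k" "\<And>M. absv (c M) \<le> B"
  using assms unfolding admissible_def by blast

lemma admissible_summable:
  assumes "admissible c"
  shows "(\<lambda>M. c M * mon z M) summable_on UNIV"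
proof -
  obtain D k0 B where adm: "\<And>M. c M \<noteq> 0 \<Longrightarrow> size M \<le> D"
    "\<And>M k. c M \<noteq> 0 \<Longrightarrow> k \<in># M \<Longrightarrow> k0 \<le> k" "\<And>M. absv (c M) \<le> B"
    using admissibleE[OF assms] by metis
  have "(\<lambda>M. c M * mon z M) summable_on {M. c M \<noteq> 0}"
    by (rule summable_family[where B = B and D = D and ?k0.0 = k0]) (use adm in auto)
  thus ?thesis
    by (rule summable_on_cong_neutral[THEN iffD1, rotated -1]) auto
qed

lemma admissible_represents:
  assumes "admissible c"
  shows "represents c (\<lambda>z. \<Sum>\<^sub>\<infinity>M. c M * mon z M)"
  using assms admissible_summable by (simp add: represents_def)

lemma admissible_restrict:
  assumes "admissible c" "\<And>M. d M \<noteq> 0 \<Longrightarrow> d M = c M"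
  shows "admissible d"
proof -
  obtain D k0 B where adm: "\<And>M. c M \<in> L" "\<And>M. c M \<noteq> 0 \<Longrightarrow> size M \<le> D"
    "\<And>M k. c M \<noteq> 0 \<Longrightarrow> k \<in># M \<Longrightarrow> k0 \<le> k" "\<And>M. absv (c M) \<le> B"
    using admissibleE[OF assms(1)] by metis
  have "d M \<in> L" for M
    using adm(1)[of M] assms(2)[of M] L_closed(1) by (cases "d M = 0") auto
  moreover have "size M \<le> D" if "d M \<noteq> 0" for M
    using that adm(2)[of M] assms(2)[of M] by auto
  moreover have "k0 \<le> k" if "d M \<noteq> 0" "k \<in># M" for M k
    using that adm(3)[of M] assms(2)[of M] by auto
  moreover have "absv (d M) \<le> max B 0" for M
    using adm(4)[of M] assms(2)[of M] by (cases "d M = 0") auto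
  ultimately show ?thesis
    unfolding admissible_def by blast
qed

lemma represents_cmult:
  assumes "represents c f" "\<kappa> \<in> L"
  shows "represents (\<lambda>M. \<kappa> * c M) (\<lambda>z. \<kappa> * f z)"
proof -
  obtain D k0 B where adm: "\<And>M. c M \<in> L" "\<And>M. c M \<noteq> 0 \<Longrightarrow> size M \<le> D"
    "\<And>M k. c M \<noteq> 0 \<Longrightarrow> k \<in># M \<Longrightarrow> k0 \<le> k" "\<And>M. absv (c M) \<le> B"
    using admissibleE assms(1) unfolding represents_def by metis
  have "\<kappa> * c M \<in> L" "absv (\<kappa> * c M) \<le> absv \<kappa> * B" for M
    using adm(1,4)[of M] assms(2) by (auto intro: L_closed simp: absv_mult mult_left_mono)
  moreover have "size M \<le> D" if "\<kappa> * c M \<noteq> 0" for M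
    using adm(2)[of M] that by simp
  moreover have "k0 \<le> k" if "\<kappa> * c M \<noteq> 0" "k \<in># M" for M k
    using adm(3)[of M k] that by simp
  ultimately have "admissible (\<lambda>M. \<kappa> * c M)"
    unfolding admissible_def by blast
  moreover have "((\<lambda>M. \<kappa> * c M * mon z M) has_sum \<kappa> * f z) UNIV" for z
    using has_sum_cmult_nonarch[of "\<lambda>M. c M * mon z M" UNIV "f z" \<kappa>] assms(1)
    by (simp add: represents_def mult.assoc)
  ultimately show ?thesis
    by (simp add: represents_def)
qed

lemma represents_add:
  assumes "represents c f" "represents d g"
  shows "represents (\<lambda>M. c M + d M) (\<lambda>z. f z + g z)"
proof -
  obtain D k0 B where c: "\<And>M. c M \<in> L" "\<And>M. c M \<noteq> 0 \<Longrightarrow> size M \<le> D"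
    "\<And>M k. c M \<noteq> 0 \<Longrightarrow> k \<in># M \<Longrightarrow> k0 \<le> k" "\<And>M. absv (c M) \<le> B"
    using admissibleE assms(1) unfolding represents_def by metis
  obtain D' k0' B' where d: "\<And>M. d M \<in> L" "\<And>M. d M \<noteq> 0 \<Longrightarrow> size M \<le> D'"
    "\<And>M k. d M \<noteq> 0 \<Longrightarrow> k \<in># M \<Longrightarrow> k0' \<le> k" "\<And>M. absv (d M) \<le> B'"
    using admissibleE assms(2) unfolding represents_def by metis
  have nz: "c M \<noteq> 0 \<or> d M \<noteq> 0" if "c M + d M \<noteq> 0" for M
    using that by auto
  have "c M + d M \<in> L" for M
    using c(1) d(1) by (auto intro: L_closed)
  moreover have "absv (c M + d M) \<le> max B B'" for M
    using absv_add_le[of "c M" "d M"] c(4)[of M] d(4)[of M] by linarith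
  moreover have "size M \<le> max D D'" if "c M + d M \<noteq> 0" for M
    using nz[OF that] c(2)[of M] d(2)[of M] by auto
  moreover have "min k0 k0' \<le> k" if "c M + d M \<noteq> 0" "k \<in># M" for M k
    using nz[OF that(1)] c(3)[of M k] d(3)[of M k] that(2) by auto
  ultimately have "admissible (\<lambda>M. c M + d M)"
    unfolding admissible_def by blast
  moreover have "((\<lambda>M. (c M + d M) * mon z M) has_sum f z + g z) UNIV" for z
    using has_sum_add[of "\<lambda>M. c M * mon z M" UNIV "f z" "\<lambda>M. d M * mon z M" "g z"] assms
    by (simp add: represents_def distrib_right)
  ultimately show ?thesis
    by (simp add: represents_def)
qed

lemma represents_diff:
  assumes "represents c f" "represents d g"
  shows "represents (\<lambda>M. c M - d M) (\<lambda>z. f z - g z)"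
  using represents_add[OF assms(1) represents_cmult[OF assms(2), of "- 1"]] L_closed(2,4) by simp

lemma has_sum_support:
  "((\<lambda>M. c M * mon z M) has_sum s) {M. c M \<noteq> 0} \<longleftrightarrow> ((\<lambda>M. c M * mon z M) has_sum s) UNIV"
  by (rule has_sum_cong_neutral) auto

text \<open>The double series is indexed by pairs from the two supports, where the bounds on sizes
  and elements hold. Only finitely many pairs have a given sum, since both components are
  submultisets of it. The resulting monomials need not be reduced.\<close>

lemma represents_mult:
  assumes "represents c f" "represents d g"
  shows "\<exists>b. represents b (\<lambda>z. f z * g z)"
proof -
  obtain D k0 B where c: "\<And>M. c M \<in> L" "\<And>M. c M \<noteq> 0 \<Longrightarrow> size M \<le> D"
    "\<And>M k. c M \<noteq> 0 \<Longrightarrow> k \<in># M \<Longrightarrow> k0 \<le> k" "\<And>M. absv (c M) \<le> B"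
    using admissibleE assms(1) unfolding represents_def by metis
  obtain D' k0' B' where d: "\<And>M. d M \<in> L" "\<And>M. d M \<noteq> 0 \<Longrightarrow> size M \<le> D'"
    "\<And>M k. d M \<noteq> 0 \<Longrightarrow> k \<in># M \<Longrightarrow> k0' \<le> k" "\<And>M. absv (d M) \<le> B'"
    using admissibleE assms(2) unfolding represents_def by metis
  define I where "I = {M. c M \<noteq> 0} \<times> {N. d N \<noteq> 0}"
  define a where "a = (\<lambda>(M, N). c M * d N)"
  define s where "s = (\<lambda>(M, N). M + N :: int multiset)"
  have fam: "absv (a i) \<le> B * B'" "a i \<in> L" for i
    using mult_mono[OF c(4)[of "fst i"] d(4)[of "snd i"]] c(1) d(1) order_trans[OF absv_nonneg c(4)]
    by (auto simp: a_def absv_mult case_prod_unfold intro: L_closed)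
  have size: "size (s i) \<le> D + D'" if "i \<in> I" for i
    using that c(2) d(2) by (auto simp: s_def I_def add_mono)
  have low: "min k0 k0' \<le> k" if "i \<in> I" "k \<in># s i" for i k
    using that c(3)[of "fst i" k] d(3)[of "snd i" k] by (auto simp: s_def I_def)
  have fibre: "finite {i\<in>I. s i = M}" for M
    by (rule finite_subset[of _ "{N. N \<subseteq># M} \<times> {N. N \<subseteq># M}"])
       (auto simp: s_def finite_submultisets)
  have "((\<lambda>i. a i * mon z (s i)) has_sum f z * g z) I" for z
    unfolding I_def
  proof (rule has_sum_SigmaI)
    have eq: "c M * mon z M * (d N * mon z N) = a (M, N) * mon z (s (M, N))" for M N
      by (simp add: a_def s_def)
    have "((\<lambda>N. c M * mon z M * (d N * mon z N)) has_sum c M * mon z M * g z) {N. d N \<noteq> 0}" for M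
      using assms(2) by (intro has_sum_cmult_nonarch) (simp add: represents_def has_sum_support)
    thus "((\<lambda>N. a (M, N) * mon z (s (M, N))) has_sum c M * mon z M * g z) {N. d N \<noteq> 0}" for M
      by (simp only: eq)
    have "((\<lambda>M. g z * (c M * mon z M)) has_sum g z * f z) {M. c M \<noteq> 0}"
      using assms(1) by (intro has_sum_cmult_nonarch) (simp add: represents_def has_sum_support)
    thus "((\<lambda>M. c M * mon z M * g z) has_sum f z * g z) {M. c M \<noteq> 0}"
      by (simp add: mult_ac)
    show "(\<lambda>i. a i * mon z (s i)) summable_on {M. c M \<noteq> 0} \<times> {N. d N \<noteq> 0}"
      unfolding I_def[symmetric] by (rule summable_family[OF fam(1) size low fibre])
  qed
  hence "represents (\<lambda>M. \<Sum>i\<in>{i\<in>I. s i = M}. a i) (\<lambda>z. f z * g z)"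
    by (intro regroup_family[where B = "B * B'" and D = "D + D'" and ?k0.0 = "min k0 k0'"])
       (use fam size low fibre in auto)
  thus ?thesis
    by blast
qed

lemma represents_mon: "represents (\<lambda>N. if N = M then 1 else 0) (\<lambda>z. mon z M)"
proof -
  have "admissible (\<lambda>N. if N = M then 1 else 0)"
    unfolding admissible_def
  proof (intro conjI exI allI impI)
    show "absv (if N = M then 1 else 0 :: 'k) \<le> 1" for N
      by simp
    show "Min (set_mset M) \<le> k" if "(if N = M then 1 else 0 :: 'k) \<noteq> 0" "k \<in># N" for N k
      using that by (auto split: if_splits)
    show "size N \<le> size M" if "(if N = M then 1 else 0 :: 'k) \<noteq> 0" for N
      using that by (auto split: if_splits)
  qed (auto intro: L_closed)
  moreover have "((\<lambda>N. (if N = M then 1 else 0) * mon z N) has_sum mon z M) UNIV" for z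
    using has_sum_cong_neutral[of "{M}" UNIV "\<lambda>N. (if N = M then 1 else 0) * mon z N" 
        "\<lambda>N. (if N = M then 1 else 0) * mon z N" "mon z M"]
    by (auto simp: has_sum_finite_iff)
  ultimately show ?thesis
    by (simp add: represents_def)
qed


section \<open>Reduction of monomials\<close>

text \<open>
  Rewriting \<open>e\<^sub>k\<^sup>q\<close> as \<open>e\<^bsub>k-1\<^esub> - \<theta> e\<^sub>k\<close> lowers the total degree, and only finitely many monomials
  of bounded degree can be rewritten to a given one, so that all series involved remain admissible.
\<close>

lemma represents_induct [consumes 1, case_names support add base step]:
  assumes rep: "represents c f" and supp: "\<And>M. c M \<noteq> 0 \<Longrightarrow> M \<in> X"
    and add: "\<And>f g. P f \<Longrightarrow> P g \<Longrightarrow> P (\<lambda>z. f z + g z)"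
    and base: "\<And>c f. represents c f \<Longrightarrow> (\<And>M. c M \<noteq> 0 \<Longrightarrow> M \<in> X) \<Longrightarrow>
      (\<And>M k. c M \<noteq> 0 \<Longrightarrow> k \<in> K \<Longrightarrow> count M k < q) \<Longrightarrow> P f"
    and step: "\<And>M k. M \<in> X \<Longrightarrow> k \<in> K \<Longrightarrow> replicate_mset q k \<subseteq># M \<Longrightarrow>
      add_mset (k - 1) (M - replicate_mset q k) \<in> X \<and> M - replicate_mset (q - 1) k \<in> X"
  shows "P f"
proof -
  have "P f" if "represents c f" "\<And>M. c M \<noteq> 0 \<Longrightarrow> M \<in> X" "\<And>M. c M \<noteq> 0 \<Longrightarrow> size M \<le> D"
    for c f D
    using that
  proof (induction D arbitrary: c f)
    case 0
    show ?case
    proof (rule base[OF 0(1,2)])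
      show "count M k < q" if "c M \<noteq> 0" for M k
        using 0(3)[OF that] q_ge_2 by simp
    qed
  next
    case (Suc D)
    obtain k0 B where c: "\<And>M. c M \<in> L"
      "\<And>M k. c M \<noteq> 0 \<Longrightarrow> k \<in># M \<Longrightarrow> k0 \<le> k" "\<And>M. absv (c M) \<le> B"
      using admissibleE Suc.prems(1) unfolding represents_def by metis
    define I where "I = {M. c M \<noteq> 0 \<and> (\<exists>k\<in>K. q \<le> count M k)}"
    define \<kappa> where "\<kappa> M = (SOME k. k \<in> K \<and> q \<le> count M k)" for M
    have \<kappa>: "\<kappa> M \<in> K" "replicate_mset q (\<kappa> M) \<subseteq># M" if "M \<in> I" for M
    proof -
      have "\<kappa> M \<in> K \<and> q \<le> count M (\<kappa> M)"
        unfolding \<kappa>_def by (rule someI_ex) (use that in \<open>auto simp: I_def\<close>)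
      thus "\<kappa> M \<in> K" "replicate_mset q (\<kappa> M) \<subseteq># M"
        by (simp_all flip: count_le_replicate_mset_subset_eq)
    qed
    \<comment> \<open>The monomials of the two terms of the carry, with coefficients
      \<open>c M\<close> and \<open>- th * c M\<close>. Each has q - 1 \<ge> 1 elements fewer than
      M, which drives the induction; at least one copy of \<open>\<kappa> M\<close> remains in
      \<open>s2 M\<close>.\<close>
    define s1 where "s1 M = add_mset (\<kappa> M - 1) (M - replicate_mset q (\<kappa> M))" for M
    define s2 where "s2 M = M - replicate_mset (q - 1) (\<kappa> M)" for M
    have M_eq: "M = (M - replicate_mset q (\<kappa> M)) + replicate_mset q (\<kappa> M)"
      "M = s2 M + replicate_mset (q - 1) (\<kappa> M)"
      if "M \<in> I" for M
    proof -
      have "replicate_mset (q - 1) (\<kappa> M) \<subseteq># replicate_mset q (\<kappa> M)"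
        by (simp flip: count_le_replicate_mset_subset_eq)
      hence "replicate_mset (q - 1) (\<kappa> M) \<subseteq># M"
        using \<kappa>(2)[OF that] by (rule subset_mset.order_trans)
      thus "M = (M - replicate_mset q (\<kappa> M)) + replicate_mset q (\<kappa> M)"
        "M = s2 M + replicate_mset (q - 1) (\<kappa> M)"
        using \<kappa>(2)[OF that] by (simp_all add: s2_def)
    qed
    have mem: "\<kappa> M \<in># M" if "M \<in> I" for M
      using \<kappa>(2)[OF that] q_ge_2 by (metis in_replicate_mset less_le_trans mset_subset_eqD pos2)
    have I: "c M \<noteq> 0" "M \<in> X" "size M \<le> Suc D" "k0 \<le> \<kappa> M" if "M \<in> I" for M
      using that Suc.prems(2,3) c(2) mem[OF that] by (auto simp: I_def)
    have s_size: "size (s1 M) \<le> D" "size (s2 M) \<le> D" if "M \<in> I" for M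
    proof -
      have "size M = size (M - replicate_mset q (\<kappa> M)) + q" "size M = size (s2 M) + (q - 1)"
        using M_eq[OF that] by (metis size_replicate_mset size_union)+
      thus "size (s1 M) \<le> D" "size (s2 M) \<le> D"
        using I(3)[OF that] q_ge_2 by (simp_all add: s1_def)
    qed
    have s_low: "k0 - 1 \<le> k" if "M \<in> I" "k \<in># s1 M \<or> k \<in># s2 M" for M k
    proof -
      have "k = \<kappa> M - 1 \<or> k \<in># M"
        using that(2) by (auto simp: s1_def s2_def dest: in_diffD)
      thus ?thesis
        using I(1,4)[OF that(1)] c(2)[of M k] by auto
    qed
    \<comment> \<open>M is recovered from its image N once the element of N that arose from the
      carry is known, and N has only finitely many elements.\<close>
    have fibre1: "finite {M\<in>I. s1 M = N}" for N
    proof (rule finite_subset)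
      show "{M\<in>I. s1 M = N} \<subseteq> (\<lambda>k. N - {#k#} + replicate_mset q (k + 1)) ` set_mset N"
      proof
        fix M assume M: "M \<in> {M\<in>I. s1 M = N}"
        hence "M = N - {#\<kappa> M - 1#} + replicate_mset q (\<kappa> M - 1 + 1)" "\<kappa> M - 1 \<in># N"
          using M_eq(1)[of M] by (auto simp: s1_def)
        thus "M \<in> (\<lambda>k. N - {#k#} + replicate_mset q (k + 1)) ` set_mset N"
          by blast
      qed
    qed simp
    have fibre2: "finite {M\<in>I. s2 M = N}" for N
    proof (rule finite_subset)
      show "{M\<in>I. s2 M = N} \<subseteq> (\<lambda>k. N + replicate_mset (q - 1) k) ` set_mset N"
      proof
        fix M assume M: "M \<in> {M\<in>I. s2 M = N}"
        have "count N (\<kappa> M) = count M (\<kappa> M) - (q - 1)"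
          using M by (auto simp: s2_def)
        moreover have "q \<le> count M (\<kappa> M)"
          using \<kappa>(2)[of M] M by (simp add: count_le_replicate_mset_subset_eq)
        ultimately have "\<kappa> M \<in># N"
          using q_ge_2 by (auto simp flip: count_greater_zero_iff)
        moreover have "M = N + replicate_mset (q - 1) (\<kappa> M)"
          using M M_eq(2)[of M] by auto
        ultimately show "M \<in> (\<lambda>k. N + replicate_mset (q - 1) k) ` set_mset N"
          by blast
      qed
    qed simp
    have bound2: "absv (- th * c M) \<le> absv th * B" "- th * c M \<in> L" for M
      using c(1,3)[of M] th_in by (auto simp: absv_mult intro: mult_left_mono L_closed)
    define f1 where "f1 z = (\<Sum>\<^sub>\<infinity>M\<in>I. c M * mon z (s1 M))" for z
    define f2 where "f2 z = (\<Sum>\<^sub>\<infinity>M\<in>I. - th * c M * mon z (s2 M))" for z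
    have sum1: "((\<lambda>M. c M * mon z (s1 M)) has_sum f1 z) I" for z
      unfolding f1_def
      by (intro has_sum_infsum summable_family[where B = B and D = D and ?k0.0 = "k0 - 1"])
         (use c(3) s_size s_low fibre1 in blast)+
    have sum2: "((\<lambda>M. - th * c M * mon z (s2 M)) has_sum f2 z) I" for z
      unfolding f2_def
      by (intro has_sum_infsum summable_family[where B = "absv th * B" and D = D and ?k0.0 = "k0 - 1"])
         (use bound2 s_size s_low fibre2 in blast)+
    define c1 where "c1 N = (\<Sum>M\<in>{M\<in>I. s1 M = N}. c M)" for N
    define c2 where "c2 N = (\<Sum>M\<in>{M\<in>I. s2 M = N}. - th * c M)" for N
    have rep1: "represents c1 f1"
      unfolding c1_def
      by (rule regroup_family[where B = B and D = D and ?k0.0 = "k0 - 1"])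
         (use c s_size s_low fibre1 sum1 in blast)+
    have rep2: "represents c2 f2"
      unfolding c2_def
      by (rule regroup_family[where B = "absv th * B" and D = D and ?k0.0 = "k0 - 1"])
         (use bound2 s_size s_low fibre2 sum2 in blast)+
    have nz: "\<exists>M\<in>I. s1 M = N" if "c1 N \<noteq> 0" for N
      using that unfolding c1_def
      by (metis (mono_tags, lifting) mem_Collect_eq sum.not_neutral_contains_not_neutral)
    have nz': "\<exists>M\<in>I. s2 M = N" if "c2 N \<noteq> 0" for N
      using that unfolding c2_def
      by (metis (mono_tags, lifting) mem_Collect_eq sum.not_neutral_contains_not_neutral)
    have "P f1"
    proof (rule Suc.IH[OF rep1])
      fix N assume "c1 N \<noteq> 0"
      then obtain M where M: "M \<in> I" "s1 M = N"
        using nz by blast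
      show "N \<in> X"
        using step[OF I(2)[OF M(1)] \<kappa>[OF M(1)]] M(2) by (simp add: s1_def)
      show "size N \<le> D"
        using s_size(1)[OF M(1)] M(2) by simp
    qed
    moreover have "P f2"
    proof (rule Suc.IH[OF rep2])
      fix N assume "c2 N \<noteq> 0"
      then obtain M where M: "M \<in> I" "s2 M = N"
        using nz' by blast
      show "N \<in> X"
        using step[OF I(2)[OF M(1)] \<kappa>[OF M(1)]] M(2) by (simp add: s2_def)
      show "size N \<le> D"
        using s_size(2)[OF M(1)] M(2) by simp
    qed
    \<comment> \<open>Subtracting the rewritten part leaves exactly the terms outside
      \<open>I\<close>, whose multiplicities on \<open>K\<close> are already below q.\<close>
    moreover have "P (\<lambda>z. f z - (f1 z + f2 z))"
    proof (rule base)
      define c0 where "c0 M = (if M \<in> I then 0 else c M)" for M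
      have "admissible c"
        using Suc.prems(1) by (simp only: represents_def)
      hence "admissible c0"
        by (rule admissible_restrict) (simp add: c0_def split: if_splits)
      moreover have "((\<lambda>M. c0 M * mon z M) has_sum f z - (f1 z + f2 z)) UNIV" for z
      proof -
        have eq: "c M * mon z (s1 M) + - th * c M * mon z (s2 M) = c M * mon z M" if "M \<in> I" for M
        proof -
          define R where "R = M - replicate_mset q (\<kappa> M)"
          have M: "M = R + replicate_mset q (\<kappa> M)"
            unfolding R_def by (rule M_eq(1)[OF that])
          have "s2 M = add_mset (\<kappa> M) R"
          proof -
            have "replicate_mset q (\<kappa> M) = add_mset (\<kappa> M) (replicate_mset (q - 1) (\<kappa> M))"
              using q_ge_2 by (cases q) auto
            moreover have "s2 M + replicate_mset (q - 1) (\<kappa> M) = R + replicate_mset q (\<kappa> M)"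
              by (rule trans[OF M_eq(2)[OF that, symmetric] M])
            ultimately have "s2 M + replicate_mset (q - 1) (\<kappa> M) =
                add_mset (\<kappa> M) R + replicate_mset (q - 1) (\<kappa> M)"
              by simp
            thus ?thesis
              by simp
          qed
          moreover have "mon z M = mon z R * e (\<kappa> M) z ^ q"
            using arg_cong[OF M, of "mon z"] by simp
          moreover have "mon z (s1 M) = e (\<kappa> M - 1) z * mon z R"
            by (simp add: s1_def R_def)
          ultimately show ?thesis
            by (simp add: e_pred algebra_simps)
        qed
        have "((\<lambda>M. c M * mon z M) has_sum f1 z + f2 z) I"
          using has_sum_add[OF sum1[of z] sum2[of z]] eq by (simp cong: has_sum_cong)
        hence "((\<lambda>M. if M \<in> I then c M * mon z M else 0) has_sum f1 z + f2 z) UNIV"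
          by (rule has_sum_cong_neutral[THEN iffD1, rotated -1]) auto
        hence "((\<lambda>M. - (if M \<in> I then c M * mon z M else 0)) has_sum - (f1 z + f2 z)) UNIV"
          by (simp only: has_sum_uminus minus_minus)
        moreover have "((\<lambda>M. c M * mon z M) has_sum f z) UNIV"
          using Suc.prems(1) by (simp add: represents_def)
        ultimately have "((\<lambda>M. c M * mon z M + - (if M \<in> I then c M * mon z M else 0)) has_sum
            f z + - (f1 z + f2 z)) UNIV"
          by (intro has_sum_add)
        moreover have "(\<lambda>M. c M * mon z M + - (if M \<in> I then c M * mon z M else 0)) =
            (\<lambda>M. c0 M * mon z M)"
          by (auto simp: c0_def)
        ultimately show ?thesis
          by (simp only: diff_conv_add_uminus[of "f z"])
      qed
      ultimately show "represents c0 (\<lambda>z. f z - (f1 z + f2 z))"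
        by (simp add: represents_def)
      show "M \<in> X" if "c0 M \<noteq> 0" for M
        using that Suc.prems(2) by (auto simp: c0_def split: if_splits)
      show "count M k < q" if "c0 M \<noteq> 0" "k \<in> K" for M k
        using that by (force simp: c0_def I_def split: if_splits)
    qed
    ultimately have "P (\<lambda>z. (f z - (f1 z + f2 z)) + (f1 z + f2 z))"
      by (intro add)
    thus ?case
      by simp
  qed
  moreover obtain D where "\<And>M. c M \<noteq> 0 \<Longrightarrow> size M \<le> D"
    using admissibleE rep unfolding represents_def by metis
  ultimately show ?thesis
    using rep supp by blast
qed

section \<open>Closure properties of tame series\<close>

lemma tame_add:
  assumes "tame f" "tame g"
  shows "tame (\<lambda>z. f z + g z)"
proof -
  obtain c d where cd: "represents c f" "represents d g"
    "\<And>M. c M \<noteq> 0 \<Longrightarrow> reduced q M" "\<And>M. d M \<noteq> 0 \<Longrightarrow> reduced q M"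
    using assms unfolding tame_def by auto
  have "reduced q M" if "c M + d M \<noteq> 0" for M
    using that cd(3,4)[of M] by (cases "c M = 0") auto
  thus ?thesis
    unfolding tame_def using represents_add[OF cd(1,2)] by blast
qed

text \<open>Here carries are allowed at every index. Consequently any admissible family, reduced or
  not, witnesses tameness, and closure under products follows.\<close>

lemma represents_imp_tame:
  assumes "represents c f"
  shows "tame f"
proof (rule represents_induct[where X = UNIV and K = UNIV and P = tame, OF assms])
  fix c f assume "represents c f" "\<And>M k. c M \<noteq> 0 \<Longrightarrow> k \<in> UNIV \<Longrightarrow> count M k < q"
  thus "tame f"
    unfolding tame_def reduced_def by blast
qed (simp_all add: tame_add)

lemma tame_iff_represents: "tame f \<longleftrightarrow> (\<exists>c. represents c f)"
  using represents_imp_tame by (auto simp: tame_def)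

lemma tame_mult: "tame f \<Longrightarrow> tame g \<Longrightarrow> tame (\<lambda>z. f z * g z)"
  unfolding tame_iff_represents using represents_mult by blast

lemma tame_cmult: "tame f \<Longrightarrow> \<kappa> \<in> L \<Longrightarrow> tame (\<lambda>z. \<kappa> * f z)"
  unfolding tame_iff_represents using represents_cmult by blast

lemma tame_mon: "tame (\<lambda>z. mon z M)"
  unfolding tame_iff_represents using represents_mon by blast

lemma tame_e: "tame (e k)"
  using tame_mon[of "{#k#}"] by simp

lemma tame_const: "\<kappa> \<in> L \<Longrightarrow> tame (\<lambda>_. \<kappa>)"
  using tame_cmult[OF tame_mon[of "{#}"]] by simp

lemma tame_power: "tame f \<Longrightarrow> tame (\<lambda>z. f z ^ n)"
  using tame_const[OF L_closed(2)] by (induction n) (simp_all add: tame_mult)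

lemma tame0_imp_tame: "tame0 f \<Longrightarrow> tame f"
  by (auto simp: tame_def tame0_def)

lemma tame0_diff:
  assumes "tame0 f" "tame0 g"
  shows "tame0 (\<lambda>z. f z - g z)"
proof -
  obtain c d where "represents c f" "represents d g"
    "\<And>M. c M \<noteq> 0 \<Longrightarrow> reduced q M \<and> wt q M < 1" "\<And>M. d M \<noteq> 0 \<Longrightarrow> reduced q M \<and> wt q M < 1"
    using assms unfolding tame0_def by auto
  note cd = this
  have "reduced q M \<and> wt q M < 1" if "c M - d M \<noteq> 0" for M
    using that cd(3,4)[of M] by (cases "c M = 0") auto
  thus ?thesis
    unfolding tame0_def using represents_diff[OF cd(1,2)] by blast
qed

lemma tame0_cmult:
  assumes "tame0 f" "\<kappa> \<in> L"
  shows "tame0 (\<lambda>z. \<kappa> * f z)"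
proof -
  obtain c where c: "represents c f" "\<And>M. c M \<noteq> 0 \<Longrightarrow> reduced q M \<and> wt q M < 1"
    using assms(1) unfolding tame0_def by auto
  have "reduced q M \<and> wt q M < 1" if "\<kappa> * c M \<noteq> 0" for M
    using that c(2)[of M] by auto
  thus ?thesis
    unfolding tame0_def using represents_cmult[OF c(1) assms(2)] by blast
qed

lemma tame0_0: "tame0 (\<lambda>_. 0)"
proof -
  have "admissible (\<lambda>_. 0)"
    unfolding admissible_def using L_closed(1) by auto
  from admissible_represents[OF this] show ?thesis
    unfolding tame0_def by force
qed

lemma tame0_add: "tame0 f \<Longrightarrow> tame0 g \<Longrightarrow> tame0 (\<lambda>z. f z + g z)"
  using tame0_diff[of f "\<lambda>z. 0 - g z"] tame0_diff[OF tame0_0, of g] by simp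

end

context tame_system
begin

section \<open>Tame series as polynomials in the first generator\<close>

text \<open>Grouping the monomials by the multiplicity i of k gives finitely many groups, because i
  is at most the size bound. Within a group, removing the i copies of k is a bijection onto the
  monomials free of k.\<close>

lemma represents_split:
  assumes "represents c f"
  shows "\<exists>D F. (\<forall>z. f z = (\<Sum>i\<le>D. e k z ^ i * F i z)) \<and>
    (\<forall>i. represents (\<lambda>M. if k \<in># M then 0 else c (M + replicate_mset i k)) (F i))"
proof -
  obtain D k0 B where c: "\<And>M. c M \<in> L" "\<And>M. c M \<noteq> 0 \<Longrightarrow> size M \<le> D"
    "\<And>M k. c M \<noteq> 0 \<Longrightarrow> k \<in># M \<Longrightarrow> k0 \<le> k" "\<And>M. absv (c M) \<le> B"
    using admissibleE assms unfolding represents_def by metis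
  define d where "d i = (\<lambda>M. if k \<in># M then 0 else c (M + replicate_mset i k))" for i
  have "admissible (d i)" for i
  proof -
    have "absv (d i M) \<le> max B 0" "d i M \<in> L" for M
      using c(1) c(4)[of "M + replicate_mset i k"] L_closed(1) by (auto simp: d_def)
    moreover have "size M \<le> D" if "d i M \<noteq> 0" for M
      using c(2)[of "M + replicate_mset i k"] that by (auto simp: d_def split: if_splits)
    moreover have "k0 \<le> l" if "d i M \<noteq> 0" "l \<in># M" for M l
      using c(3)[of "M + replicate_mset i k" l] that by (auto simp: d_def split: if_splits)
    ultimately show ?thesis
      unfolding admissible_def by blast
  qed
  note d = admissible_represents[OF this]
  define F where "F i z = (\<Sum>\<^sub>\<infinity>M. d i M * mon z M)" for i z
  have "f z = (\<Sum>i\<le>D. e k z ^ i * F i z)" for z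
  proof -
    have part: "((\<lambda>M. c M * mon z M) has_sum e k z ^ i * F i z) {M. count M k = i}" for i
    proof -
      have "((\<lambda>M. d i M * mon z M) has_sum F i z) UNIV"
        using d[of i] by (simp add: represents_def F_def)
      hence "((\<lambda>M. e k z ^ i * (d i M * mon z M)) has_sum e k z ^ i * F i z) UNIV"
        by (rule has_sum_cmult_nonarch)
      hence "((\<lambda>M. e k z ^ i * (d i M * mon z M)) has_sum e k z ^ i * F i z) {M. k \<notin># M}"
        by (rule has_sum_cong_neutral[THEN iffD1, rotated -1]) (auto simp: d_def)
      hence "((\<lambda>M. c (M + replicate_mset i k) * mon z (M + replicate_mset i k))
          has_sum e k z ^ i * F i z) {M. k \<notin># M}"
        by (rule has_sum_cong[THEN iffD1, rotated]) (simp add: d_def)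
      moreover have "bij_betw (\<lambda>M. M + replicate_mset i k) {M. k \<notin># M} {M. count M k = i}"
        by (rule bij_betwI[where g = "\<lambda>M. M - replicate_mset i k"])
           (auto simp: not_in_iff count_le_replicate_mset_subset_eq[symmetric])
      ultimately show ?thesis
        by (subst has_sum_reindex_bij_betw[symmetric, where g = "\<lambda>M. M + replicate_mset i k"])
    qed
    have "((\<lambda>M. c M * mon z M) has_sum (\<Sum>i\<le>D. e k z ^ i * F i z)) (\<Union>i\<in>{..D}. {M. count M k = i})"
      by (rule sum_has_sum) (auto intro: part)
    hence "((\<lambda>M. c M * mon z M) has_sum (\<Sum>i\<le>D. e k z ^ i * F i z)) UNIV"
    proof (rule has_sum_cong_neutral[THEN iffD1, rotated -1])
      fix M assume "M \<in> UNIV - (\<Union>i\<in>{..D}. {M. count M k = i})"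
      hence "\<not> size M \<le> D"
        using count_le_size[of M k] by auto
      thus "c M * mon z M = 0"
        using c(2)[of M] by auto
    qed auto
    moreover have "((\<lambda>M. c M * mon z M) has_sum f z) UNIV"
      using assms by (simp add: represents_def)
    ultimately show ?thesis
      by (rule has_sum_unique[symmetric])
  qed
  moreover have "represents (d i) (F i)" for i
    using d[of i] by (simp add: F_def[abs_def])
  ultimately show ?thesis
    unfolding d_def by blast
qed

definition poly0 :: "('x \<Rightarrow> 'k) \<Rightarrow> bool"
  where "poly0 f \<longleftrightarrow> (\<exists>n a. (\<forall>i. tame0 (a i)) \<and> (\<forall>z. f z = (\<Sum>i\<le>n. e 0 z ^ i * a i z)))"

lemma poly0_padded:
  assumes "poly0 f"
  shows "\<exists>a n. (\<forall>i. tame0 (a i)) \<and> (\<forall>m\<ge>n. \<forall>z. f z = (\<Sum>i\<le>m. e 0 z ^ i * a i z))"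
proof -
  obtain n a where a: "\<And>i. tame0 (a i)" "\<And>z. f z = (\<Sum>i\<le>n. e 0 z ^ i * a i z)"
    using assms unfolding poly0_def by blast
  define b where "b i = (if i \<le> n then a i else (\<lambda>_. 0))" for i
  have eq: "f z = (\<Sum>i\<le>m. e 0 z ^ i * b i z)" if "m \<ge> n" for m z
    unfolding a(2) using that by (intro sum.mono_neutral_cong_left) (auto simp: b_def)
  have "tame0 (b i)" for i
    using a(1) tame0_0 by (simp add: b_def)
  thus ?thesis
    by (intro exI[of _ b] exI[of _ n]) (simp add: eq)
qed

lemma poly0_add:
  assumes "poly0 f" "poly0 g"
  shows "poly0 (\<lambda>z. f z + g z)"
proof -
  obtain a n where a: "\<forall>i. tame0 (a i)" "\<forall>m\<ge>n. \<forall>z. f z = (\<Sum>i\<le>m. e 0 z ^ i * a i z)"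
    using poly0_padded[OF assms(1)] by blast
  obtain b n' where b: "\<forall>i. tame0 (b i)" "\<forall>m\<ge>n'. \<forall>z. g z = (\<Sum>i\<le>m. e 0 z ^ i * b i z)"
    using poly0_padded[OF assms(2)] by blast
  have "f z + g z = (\<Sum>i\<le>max n n'. e 0 z ^ i * (a i z + b i z))" for z
  proof -
    have "f z = (\<Sum>i\<le>max n n'. e 0 z ^ i * a i z)" "g z = (\<Sum>i\<le>max n n'. e 0 z ^ i * b i z)"
      using a(2) b(2) by (meson max.cobounded1 max.cobounded2)+
    thus ?thesis
      by (simp only: sum.distrib distrib_left)
  qed
  moreover have "tame0 (\<lambda>z. a i z + b i z)" for i
    using a(1) b(1) by (intro tame0_add) auto
  ultimately show ?thesis
    unfolding poly0_def by (intro exI[of _ "max n n'"] exI[of _ "\<lambda>i z. a i z + b i z"]) simp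
qed

lemma poly0_cmult:
  assumes "poly0 f" "\<kappa> \<in> L"
  shows "poly0 (\<lambda>z. \<kappa> * f z)"
proof -
  obtain n a where a: "\<And>i. tame0 (a i)" "\<And>z. f z = (\<Sum>i\<le>n. e 0 z ^ i * a i z)"
    using assms(1) unfolding poly0_def by blast
  have "\<kappa> * f z = (\<Sum>i\<le>n. e 0 z ^ i * (\<kappa> * a i z))" for z
    by (simp add: a(2) sum_distrib_left mult_ac)
  moreover have "tame0 (\<lambda>z. \<kappa> * a i z)" for i
    using a(1) assms(2) by (rule tame0_cmult)
  ultimately show ?thesis
    unfolding poly0_def by (intro exI[of _ n] exI[of _ "\<lambda>i z. \<kappa> * a i z"]) simp
qed

lemma poly0_tame0:
  assumes "tame0 f"
  shows "poly0 f"
  unfolding poly0_def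
  by (rule exI[of _ 0], rule exI[of _ "\<lambda>_. f"]) (simp add: assms)

lemma poly0_e0_mult:
  assumes "poly0 f"
  shows "poly0 (\<lambda>z. e 0 z * f z)"
proof -
  obtain n a where a: "\<And>i. tame0 (a i)" "\<And>z. f z = (\<Sum>i\<le>n. e 0 z ^ i * a i z)"
    using assms(1) unfolding poly0_def by blast
  define b where "b i = (case i of 0 \<Rightarrow> \<lambda>_. 0 | Suc j \<Rightarrow> a j)" for i
  have "e 0 z * f z = (\<Sum>i\<le>Suc n. e 0 z ^ i * b i z)" for z
    by (subst sum.atMost_Suc_shift) (simp add: b_def a(2) sum_distrib_left mult_ac)
  moreover have "tame0 (b i)" for i
    using a(1) tame0_0 by (simp add: b_def split: nat.splits)
  ultimately show ?thesis
    unfolding poly0_def by blast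
qed

lemma poly0_power_mult:
  assumes "\<And>f. poly0 f \<Longrightarrow> poly0 (\<lambda>z. g z * f z)" "poly0 f"
  shows "poly0 (\<lambda>z. g z ^ n * f z)"
proof (induction n)
  case (Suc n)
  thus ?case
    using assms(1)[OF Suc] by (simp add: mult.assoc)
qed (use assms(2) in simp)

text \<open>Going down from index 0, the recursion expresses e_(k-1) as a polynomial in e_k over L,
  so each of these functions is a polynomial in e_0.\<close>

lemma poly0_e_mult:
  assumes "k \<le> 0" "poly0 f"
  shows "poly0 (\<lambda>z. e k z * f z)"
  using assms
proof (induction k arbitrary: f rule: int_le_induct)
  case base
  thus ?case
    by (rule poly0_e0_mult)
next
  case (step k)
  have "poly0 (\<lambda>z. e k z ^ q * f z + th * (e k z * f z))"
    using step th_in by (intro poly0_add poly0_cmult poly0_power_mult) auto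
  thus ?case
    by (simp add: e_pred algebra_simps)
qed

lemma poly0_sum: "(\<And>i. i \<le> D \<Longrightarrow> poly0 (F i)) \<Longrightarrow> poly0 (\<lambda>z. \<Sum>i\<le>(D::nat). F i z)"
  by (induction D) (simp_all add: poly0_add)

lemma represents_split_poly0:
  assumes "represents c f" "k \<le> 0"
    and "\<And>i g. represents (\<lambda>M. if k \<in># M then 0 else c (M + replicate_mset i k)) g \<Longrightarrow> poly0 g"
  shows "poly0 f"
proof -
  obtain D F where F: "\<And>z. f z = (\<Sum>i\<le>D. e k z ^ i * F i z)"
    "\<And>i. represents (\<lambda>M. if k \<in># M then 0 else c (M + replicate_mset i k)) (F i)"
    using represents_split[OF assms(1), of k] by blast
  have "poly0 (\<lambda>z. \<Sum>i\<le>D. e k z ^ i * F i z)"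
    by (intro poly0_sum poly0_power_mult poly0_e_mult[OF assms(2)] assms(3)[OF F(2)])
  thus ?thesis
    by (simp flip: F(1))
qed

text \<open>Carries are made at positive indices only, so that no negative index arises; the
  multiplicity of 0 stays unrestricted and becomes the power of e_0. The cofactors use indices \<ge>
  1 with multiplicities below q, hence have weight below 1.\<close>

lemma poly0_nonneg:
  assumes "represents c f" "\<And>M. c M \<noteq> 0 \<Longrightarrow> \<forall>k\<in>#M. 0 \<le> k"
  shows "poly0 f"
proof (rule represents_induct[where X = "{M. \<forall>k\<in>#M. 0 \<le> k}" and K = "{1..}" and P = poly0, OF assms(1)])
  fix c f assume c: "represents c f" "\<And>M. c M \<noteq> 0 \<Longrightarrow> M \<in> {M. \<forall>k\<in>#M. 0 \<le> k}"
    "\<And>M k. c M \<noteq> 0 \<Longrightarrow> k \<in> {1..} \<Longrightarrow> count M k < q"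
  show "poly0 f"
  proof (rule represents_split_poly0[OF c(1), of 0])
    fix i g assume g: "represents (\<lambda>M. if 0 \<in># M then 0 else c (M + replicate_mset i 0)) g"
    have "reduced q M \<and> wt q M < 1" if M: "0 \<notin># M" "c (M + replicate_mset i 0) \<noteq> 0" for M
    proof
      have pos: "0 < k" if "k \<in># M" for k
        using c(2)[OF M(2)] M(1) that by (cases "k = 0") force+
      have "count M k < q" for k
      proof (cases "k \<in># M")
        case True
        thus ?thesis
          using c(3)[OF M(2), of k] pos[OF True] by simp
      next
        case False
        thus ?thesis
          using q_ge_2 by (simp add: not_in_iff)
      qed
      thus red: "reduced q M"
        by (simp add: reduced_def)
      show "wt q M < 1"
        using reduced_wt_less[OF q_ge_2 red, of 0] pos by simp
    qed
    hence "tame0 g"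
      unfolding tame0_def by (intro exI[of _ "\<lambda>M. if 0 \<in># M then 0 else c (M + replicate_mset i 0)"])
        (simp add: g)
    thus "poly0 g"
      by (rule poly0_tame0)
  qed simp
qed (use assms(2) in \<open>auto simp: poly0_add dest: in_diffD\<close>)

text \<open>The lowest negative index is split off as a power, which \<open>poly0_e_mult\<close>
  absorbs, and the cofactors satisfy a better lower bound; after finitely many such steps all
  indices are nonnegative.\<close>

lemma tame_imp_poly0:
  assumes "tame f"
  shows "poly0 f"
proof -
  have "poly0 f" if "represents c f" "\<And>M k. c M \<noteq> 0 \<Longrightarrow> k \<in># M \<Longrightarrow> - int m \<le> k" for c f m
    using that
  proof (induction m arbitrary: c f)
    case 0
    thus ?case
      by (intro poly0_nonneg[of c]) auto
  next
    case (Suc m)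
    show ?case
    proof (rule represents_split_poly0[OF Suc.prems(1), of "- int (Suc m)"])
      fix i g
      assume g: "represents (\<lambda>M. if - int (Suc m) \<in># M then 0
          else c (M + replicate_mset i (- int (Suc m)))) g"
      show "poly0 g"
      proof (rule Suc.IH[OF g])
        fix M k
        assume M: "(if - int (Suc m) \<in># M then 0 else c (M + replicate_mset i (- int (Suc m)))) \<noteq> 0"
          and k: "k \<in># M"
        hence "- int (Suc m) \<le> k" "k \<noteq> - int (Suc m)"
          using Suc.prems(2)[of "M + replicate_mset i (- int (Suc m))" k] by (auto split: if_splits)
        thus "- int m \<le> k"
          by simp
      qed
    qed simp
  qed
  moreover obtain c where c: "represents c f"
    using assms by (auto simp: tame_def)
  moreover obtain k0 where "\<And>M k. c M \<noteq> 0 \<Longrightarrow> k \<in># M \<Longrightarrow> k0 \<le> k"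
    using admissibleE c unfolding represents_def by metis
  hence "\<And>M k. c M \<noteq> 0 \<Longrightarrow> k \<in># M \<Longrightarrow> - int (nat (- k0)) \<le> k"
    by force
  ultimately show ?thesis
    by blast
qed


section \<open>Uniqueness of tame expansions\<close>

lemma absv_mon_zeta_le: "absv (mon (\<zeta> n) M) \<le> exp (Y n * wt q M)"
proof (induction M)
  case (add k M)
  have "absv (e k (\<zeta> n)) * absv (mon (\<zeta> n) M) \<le> exp (Y n * real q powi (- k)) * exp (Y n * wt q M)"
    using growth_le add by (intro mult_mono) auto
  thus ?case
    by (simp add: absv_mult exp_add algebra_simps)
qed simp

lemma absv_mon_zeta_eq:
  assumes "\<forall>k\<in>#M. k < int n"
  shows "absv (mon (\<zeta> n) M) = exp (Y n * wt q M)"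
  using assms by (induction M) (simp_all add: absv_mult growth_eq exp_add algebra_simps)

definition leading :: "(int multiset \<Rightarrow> 'k) \<Rightarrow> int multiset \<Rightarrow> bool"
  where "leading c M \<longleftrightarrow> c M \<noteq> 0 \<and> (\<forall>N. c N \<noteq> 0 \<longrightarrow> wt q N \<le> wt q M)"

lemma ex_max_in_support:
  assumes "admissible c" "S \<subseteq> {M. c M \<noteq> 0}" "S \<noteq> {}"
  shows "\<exists>M\<in>S. \<forall>N\<in>S. wt q N \<le> wt q M"
proof -
  obtain D k0 B where c: "\<And>M. c M \<noteq> 0 \<Longrightarrow> size M \<le> D"
    "\<And>M k. c M \<noteq> 0 \<Longrightarrow> k \<in># M \<Longrightarrow> k0 \<le> k"
    using admissibleE[OF assms(1)] by metis
  show ?thesis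
    by (rule ex_wt_max[OF q_ge_2 assms(3), of D k0]) (use assms(2) c in auto)
qed

lemma ex_leading:
  assumes "admissible c" "c M \<noteq> 0"
  shows "\<exists>M. leading c M"
  using ex_max_in_support[OF assms(1) subset_refl] assms(2) by (auto simp: leading_def)

text \<open>A nonzero leading coefficient cannot be cancelled: at \<open>\<zeta> n\<close> its term
  has size \<open>absv (c M0) * exp (Y n * wt q M0)\<close>, whereas all others together are at most
  \<open>B * exp (Y n * j1)\<close> with a smaller j1, and \<open>Y n\<close> tends to
  infinity.\<close>

lemma represents_zero_imp_zero:
  assumes rep: "represents c (\<lambda>_. 0)" and red: "\<And>M. c M \<noteq> 0 \<Longrightarrow> reduced q M"
  shows "c M = 0"
proof (rule ccontr)
  assume "c M \<noteq> 0"
  have adm: "admissible c"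
    using rep by (simp add: represents_def)
  obtain B where B: "\<And>M. absv (c M) \<le> B"
    using admissibleE[OF adm] by metis
  obtain M0 where M0: "c M0 \<noteq> 0" "\<And>N. c N \<noteq> 0 \<Longrightarrow> wt q N \<le> wt q M0"
    using ex_leading[OF adm \<open>c M \<noteq> 0\<close>] unfolding leading_def by blast
  have "B > 0"
    using B[of M0] M0(1) absv_pos_iff[of "c M0"] by linarith
  \<comment> \<open>The support without M0 again has a largest weight, and distinct reduced
    multisets have distinct weights. Strict inequality for each N separately would not give a
    uniform j1.\<close>
  have "\<exists>j1<wt q M0. \<forall>N. c N \<noteq> 0 \<longrightarrow> N \<noteq> M0 \<longrightarrow> wt q N \<le> j1"
  proof (cases "{N. c N \<noteq> 0 \<and> N \<noteq> M0} = {}")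
    case True
    hence "N = M0" if "c N \<noteq> 0" for N
      using that by blast
    thus ?thesis
      by (intro exI[of _ "wt q M0 - 1"]) auto
  next
    case False
    have "\<exists>M\<in>{N. c N \<noteq> 0 \<and> N \<noteq> M0}. \<forall>N\<in>{N. c N \<noteq> 0 \<and> N \<noteq> M0}. wt q N \<le> wt q M"
      by (rule ex_max_in_support[OF adm _ False]) auto
    then obtain M1 where M1: "c M1 \<noteq> 0" "M1 \<noteq> M0" "\<And>N. c N \<noteq> 0 \<Longrightarrow> N \<noteq> M0 \<Longrightarrow> wt q N \<le> wt q M1"
      by auto
    have "wt q M1 \<noteq> wt q M0"
      using reduced_wt_inj[OF q_ge_2 red[OF M1(1)] red[OF M0(1)]] M1(2) by auto
    hence "wt q M1 < wt q M0"
      using M0(2)[OF M1(1)] by simp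
    thus ?thesis
      using M1(3) by blast
  qed
  then obtain j1 where j1: "j1 < wt q M0" "\<And>N. c N \<noteq> 0 \<Longrightarrow> N \<noteq> M0 \<Longrightarrow> wt q N \<le> j1"
    by blast
  define d where "d = wt q M0 - j1"
  have "d > 0"
    using j1(1) by (simp add: d_def)
  have bound: "absv (c M0) * exp (Y n * d) \<le> B"
    if n: "\<forall>k\<in>#M0. k < int n" "Y n \<ge> 0" for n
  proof -
    have sum: "((\<lambda>N. c N * mon (\<zeta> n) N) has_sum 0) UNIV"
      using rep by (simp add: represents_def)
    have "((\<lambda>N. if N = M0 then - (c N * mon (\<zeta> n) N) else 0) has_sum - (c M0 * mon (\<zeta> n) M0)) {M0}"
      by (intro has_sum_finiteI) auto
    hence neg: "((\<lambda>N. if N = M0 then - (c N * mon (\<zeta> n) N) else 0) has_sum - (c M0 * mon (\<zeta> n) M0)) UNIV"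
      by (rule has_sum_cong_neutral[THEN iffD1, rotated -1]) auto
    have eq: "(\<lambda>N. if N = M0 then 0 else c N * mon (\<zeta> n) N) =
        (\<lambda>N. c N * mon (\<zeta> n) N + (if N = M0 then - (c N * mon (\<zeta> n) N) else 0))"
      by auto
    have "((\<lambda>N. if N = M0 then 0 else c N * mon (\<zeta> n) N) has_sum - (c M0 * mon (\<zeta> n) M0)) UNIV"
      using has_sum_add[OF sum neg] by (simp only: eq add_0)
    hence "absv (- (c M0 * mon (\<zeta> n) M0)) \<le> B * exp (Y n * j1)"
    proof (rule absv_has_sum_le)
      fix N
      show "absv (if N = M0 then 0 else c N * mon (\<zeta> n) N) \<le> B * exp (Y n * j1)"
      proof (cases "c N \<noteq> 0 \<and> N \<noteq> M0")
        case True
        have "absv (mon (\<zeta> n) N) \<le> exp (Y n * wt q N)"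
          by (rule absv_mon_zeta_le)
        also have "\<dots> \<le> exp (Y n * j1)"
          using j1(2)[of N] True n(2) by (simp add: mult_left_mono)
        finally show ?thesis
          using B[of N] \<open>B > 0\<close> True by (simp add: absv_mult mult_mono)
      next
        case False
        thus ?thesis
          using \<open>B > 0\<close> by auto
      qed
    qed (use \<open>B > 0\<close> in auto)
    hence "absv (c M0) * exp (Y n * wt q M0) \<le> B * exp (Y n * j1)"
      using absv_mon_zeta_eq[OF n(1)] by (simp add: absv_mult)
    moreover have "exp (Y n * wt q M0) = exp (Y n * d) * exp (Y n * j1)"
      by (simp add: d_def flip: exp_add ring_distribs)
    ultimately show ?thesis
      by simp
  qed
  have "\<forall>\<^sub>F n in sequentially. Y n \<ge> max 0 (B / absv (c M0) / d)"
    using Y_at_top unfolding filterlim_at_top by (rule spec)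
  moreover have "\<forall>\<^sub>F n in sequentially. n \<ge> nat (Max (insert 0 (set_mset M0)) + 1)"
    by (rule eventually_ge_at_top)
  ultimately have "\<forall>\<^sub>F n in sequentially. Y n \<ge> max 0 (B / absv (c M0) / d) \<and>
      n \<ge> nat (Max (insert 0 (set_mset M0)) + 1)"
    by (rule eventually_conj)
  \<comment> \<open>Three demands on n: \<open>Y n\<close> is nonnegative, \<open>Y n * d\<close> is
    at least \<open>B / absv (c M0)\<close>, and all elements of M0 lie below n, where the growth is
    exact.\<close>
  then obtain n where n: "Y n \<ge> max 0 (B / absv (c M0) / d)"
    "n \<ge> nat (Max (insert 0 (set_mset M0)) + 1)"
    using eventually_happens' trivial_limit_sequentially by blast
  have "k < int n" if "k \<in># M0" for k
  proof -
    have "k \<le> Max (insert 0 (set_mset M0))"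
      using that by (intro Max_ge) auto
    thus ?thesis
      using n(2) by simp
  qed
  hence "absv (c M0) * exp (Y n * d) \<le> B"
    using n(1) by (intro bound) auto
  moreover have "B \<le> absv (c M0) * (Y n * d)"
    using n(1) \<open>d > 0\<close> M0(1) absv_pos_iff[of "c M0"] by (simp add: field_simps)
  moreover have "absv (c M0) * (Y n * d) < absv (c M0) * exp (Y n * d)"
  proof (rule mult_strict_left_mono)
    show "Y n * d < exp (Y n * d)"
      using exp_ge_add_one_self[of "Y n * d"] by linarith
  qed (use M0(1) in simp)
  ultimately show False
    by linarith
qed

lemma represents_unique:
  assumes "represents c f" "\<And>M. c M \<noteq> 0 \<Longrightarrow> reduced q M"
    and "represents d f" "\<And>M. d M \<noteq> 0 \<Longrightarrow> reduced q M"
  shows "c = d"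
proof
  fix M
  have "represents (\<lambda>M. c M - d M) (\<lambda>_. 0)"
    using represents_diff[OF assms(1,3)] by simp
  moreover have "reduced q M" if "c M - d M \<noteq> 0" for M
    using that assms(2,4)[of M] by (cases "c M = 0") auto
  ultimately have "c M - d M = 0"
    by (rule represents_zero_imp_zero)
  thus "c M = d M"
    by simp
qed

lemma tame0_coeff:
  assumes "tame0 f" "represents c f" "\<And>M. c M \<noteq> 0 \<Longrightarrow> reduced q M" "c M \<noteq> 0"
  shows "wt q M < 1"
proof -
  obtain d where d: "represents d f" "\<And>M. d M \<noteq> 0 \<Longrightarrow> reduced q M \<and> wt q M < 1"
    using assms(1) unfolding tame0_def by auto
  hence "c = d"
    using assms(2,3) by (intro represents_unique) auto
  thus ?thesis
    using d(2) assms(4) by blast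
qed

end

section \<open>Expansions in the completed fraction field\<close>

lemma additive_valuation_simps:
  assumes "additive_valuation w"
  shows "w x = \<infinity> \<longleftrightarrow> x = 0" "w x \<noteq> - \<infinity>" "w (x * y) = w x + w y" "w (- x) = w x" "w 1 = 0"
    "w 0 = \<infinity>" "w x = ereal r \<Longrightarrow> w (x ^ n) = ereal (real n * r)"
    "b < w x \<Longrightarrow> b < w y \<Longrightarrow> b < w (x + y)" "b < w x \<Longrightarrow> b < w y \<Longrightarrow> b < w (x - y)"
proof -
  have inf: "w x = \<infinity> \<longleftrightarrow> x = 0" and minf: "w x \<noteq> - \<infinity>" and mult: "w (x * y) = w x + w y"
    and add: "w (x + y) \<ge> min (w x) (w y)" for x y
    using assms by (auto simp: additive_valuation_def)
  have one: "w 1 = 0"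
    using mult[of 1 1] inf[of 1] minf[of 1] by (cases "w 1") auto
  have "w (- 1) + w (- 1) = 0"
    using mult[of "- 1" "- 1"] one by simp
  hence "w (- 1) = 0"
    by (cases "w (- 1)") auto
  hence uminus: "w (- x) = w x" for x
    using mult[of "- 1" x] by simp
  show "w x = \<infinity> \<longleftrightarrow> x = 0" "w x \<noteq> - \<infinity>" "w (x * y) = w x + w y" "w (- x) = w x" "w 1 = 0"
    by (fact inf minf mult uminus one)+
  show "w 0 = \<infinity>"
    by (simp add: inf)
  show "w (x ^ n) = ereal (real n * r)" if "w x = ereal r"
    using that by (induction n) (simp_all add: one mult algebra_simps zero_ereal_def)
  show gt: "b < w (x + y)" if "b < w x" "b < w y" for b x y
    using add[of x y] that by (meson less_le_trans min_less_iff_conj)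
  show "b < w (x - y)" if "b < w x" "b < w y"
    using gt[of b x "- y"] that by (simp add: uminus)
qed

text \<open>The valuation is described through leading monomials of reduced families, so the
  argument in the completion never unfolds \<open>tame_val\<close> with its definite description and
  its greatest element.\<close>

locale completed_tame_system = tame_system q e th L \<zeta> Y
  for q and e :: "int \<Rightarrow> 'x \<Rightarrow> 'k::{nonarch_field,complete_space}" and th L \<zeta> Y +
  fixes emb :: "('x \<Rightarrow> 'k) \<Rightarrow> 'f::field" and w :: "'f \<Rightarrow> ereal"
  assumes emb_1: "emb (\<lambda>_. 1) = 1"
    and emb_add: "tame f \<Longrightarrow> tame g \<Longrightarrow> emb (\<lambda>z. f z + g z) = emb f + emb g"
    and emb_mult: "tame f \<Longrightarrow> tame g \<Longrightarrow> emb (\<lambda>z. f z * g z) = emb f * emb g"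
    and valuation: "additive_valuation w"
    and w_emb: "represents c f \<Longrightarrow> (\<And>M. c M \<noteq> 0 \<Longrightarrow> reduced q M) \<Longrightarrow> leading c M \<Longrightarrow>
      w (emb f) = ereal (- wt q M)"
    and dense: "\<exists>f g. tame f \<and> tame g \<and> g \<noteq> (\<lambda>_. 0) \<and> w (x - emb f / emb g) > ereal B"
begin

lemmas w_simps = additive_valuation_simps[OF valuation]

lemma tame_0: "tame (\<lambda>_. 0)"
  by (rule tame_const) (rule L_closed)

lemma emb_0: "emb (\<lambda>_. 0) = 0"
  using emb_add[OF tame_0 tame_0] by (simp only: add_0 add_cancel_right_right)

lemma tame_diff: "tame f \<Longrightarrow> tame g \<Longrightarrow> tame (\<lambda>z. f z - g z)"
  unfolding tame_iff_represents using represents_diff by blast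

lemma emb_diff:
  assumes "tame f" "tame g"
  shows "emb (\<lambda>z. f z - g z) = emb f - emb g"
  using emb_add[OF tame_diff[OF assms] assms(2)] by simp

lemma emb_power:
  assumes "tame f"
  shows "emb (\<lambda>z. f z ^ n) = emb f ^ n"
proof (induction n)
  case (Suc n)
  have "emb (\<lambda>z. f z * f z ^ n) = emb f * emb (\<lambda>z. f z ^ n)"
    by (intro emb_mult tame_power assms)
  thus ?case
    using Suc by simp
qed (simp add: emb_1)

lemma emb_cmult: "tame f \<Longrightarrow> \<kappa> \<in> L \<Longrightarrow> emb (\<lambda>z. \<kappa> * f z) = emb (\<lambda>_. \<kappa>) * emb f"
  by (intro emb_mult tame_const)

lemma tame_expansion:
  assumes "tame f" "f \<noteq> (\<lambda>_. 0)"
  shows "\<exists>c M. represents c f \<and> (\<forall>M. c M \<noteq> 0 \<longrightarrow> reduced q M) \<and> leading c M \<and>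
    w (emb f) = ereal (- wt q M)"
proof -
  obtain c where c: "represents c f" "\<And>M. c M \<noteq> 0 \<Longrightarrow> reduced q M"
    using assms(1) unfolding tame_def by blast
  have "\<exists>M. c M \<noteq> 0"
  proof (rule ccontr)
    assume "\<nexists>M. c M \<noteq> 0"
    hence "((\<lambda>M. 0) has_sum f z) (UNIV :: int multiset set)" for z
      using c(1) by (simp add: represents_def)
    hence "f z = 0" for z
      using has_sum_unique[of _ UNIV "f z" 0] has_sum_0_simp by blast
    thus False
      using assms(2) by blast
  qed
  moreover have "admissible c"
    using c(1) by (simp add: represents_def)
  ultimately obtain M where "leading c M"
    using ex_leading by blast
  thus ?thesis
    using c w_emb[OF c] by blast
qed

lemma w_mon: "reduced q M \<Longrightarrow> w (emb (\<lambda>z. mon z M)) = ereal (- wt q M)"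
  by (rule w_emb[OF represents_mon]) (auto simp: leading_def split: if_splits)

abbreviation E :: 'f
  where "E \<equiv> emb (e 0)"

lemma w_E: "w E = ereal (- 1)"
  using w_mon[of "{#0#}"] q_ge_2 by (simp add: reduced_def)

lemma E_nonzero: "E \<noteq> 0"
  using w_E w_simps(6) by auto

lemma w_E_powi: "w (E powi i) = ereal (- real_of_int i)"
proof -
  have pow: "w (E ^ n) = ereal (- real n)" for n
    using w_simps(7)[OF w_E] by simp
  show ?thesis
  proof (cases "i \<ge> 0")
    case True
    thus ?thesis
      using pow[of "nat i"] by (simp add: power_int_def)
  next
    case False
    have "w (E powi i) + w (E ^ nat (- i)) = 0"
      using False E_nonzero
      by (simp add: power_int_def w_simps(5) flip: w_simps(3) power_mult_distrib)
    thus ?thesis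
      using False pow[of "nat (- i)"] by (cases "w (E powi i)") auto
  qed
qed

lemma w_const:
  assumes "\<kappa> \<in> L" "\<kappa> \<noteq> 0"
  shows "w (emb (\<lambda>_. \<kappa>)) = 0"
proof -
  have "w (emb (\<lambda>_. \<kappa>)) = ereal (- wt q {#})"
    using represents_cmult[OF represents_mon[of "{#}"] assms(1)] assms(2) q_ge_2
    by (intro w_emb[where c = "\<lambda>M. \<kappa> * (if M = {#} then 1 else 0)"])
       (auto simp: leading_def reduced_def split: if_splits)
  thus ?thesis
    by (simp add: zero_ereal_def)
qed

lemma w_tame0:
  assumes "tame0 f"
  shows "w (emb f) > ereal (- 1)" and "f \<noteq> (\<lambda>_. 0) \<Longrightarrow> w (emb f) \<le> 0"
proof -
  have "ereal (- 1) < w (emb f) \<and> w (emb f) \<le> 0" if nz: "f \<noteq> (\<lambda>_. 0)"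
  proof -
    obtain c M where c: "represents c f" "\<And>M. c M \<noteq> 0 \<Longrightarrow> reduced q M" "leading c M"
      "w (emb f) = ereal (- wt q M)"
      using tame_expansion[OF tame0_imp_tame[OF assms] nz] by blast
    have "wt q M < 1"
      using tame0_coeff[OF assms c(1,2)] c(3) by (auto simp: leading_def)
    thus ?thesis
      using c(4) by (simp add: zero_ereal_def)
  qed
  thus "w (emb f) > ereal (- 1)" "f \<noteq> (\<lambda>_. 0) \<Longrightarrow> w (emb f) \<le> 0"
    by (cases "f = (\<lambda>_. 0)", auto simp: emb_0 w_simps(6))
qed

text \<open>The intervals (i - 1, i] for different i are disjoint, so nonzero terms of an expansion
  have distinct values, increasing with i, and cannot cancel.\<close>

lemma w_term:
  assumes "tame0 f"
  shows "w (emb f * E powi (- i)) > ereal (real_of_int i - 1)"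
    and "f \<noteq> (\<lambda>_. 0) \<Longrightarrow> w (emb f * E powi (- i)) \<le> ereal (real_of_int i)"
proof -
  have "w (emb f * E powi (- i)) = w (emb f) + ereal (real_of_int i)"
    by (simp add: w_simps(3) w_E_powi)
  thus "w (emb f * E powi (- i)) > ereal (real_of_int i - 1)"
    "f \<noteq> (\<lambda>_. 0) \<Longrightarrow> w (emb f * E powi (- i)) \<le> ereal (real_of_int i)"
    using w_tame0[OF assms] by (cases "w (emb f)"; simp)+
qed

lemma w_sum_gt:
  assumes "\<And>i. i \<in> A \<Longrightarrow> b < w (F i)" "b < \<infinity>"
  shows "b < w (sum F A)"
  using assms by (induction A rule: infinite_finite_induct) (auto simp: w_simps(6,8))

section \<open>Finite expansions in powers of e\<close>

definition expn :: "int set \<Rightarrow> (int \<Rightarrow> 'x \<Rightarrow> 'k) \<Rightarrow> 'f"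
  where "expn A a = (\<Sum>i\<in>A. emb (a i) * E powi (- i))"

lemma expn_gt:
  assumes "\<And>i. tame0 (a i)" "\<And>i. i \<in> A \<Longrightarrow> n < i"
  shows "w (expn A a) > ereal (real_of_int n)"
  unfolding expn_def
proof (rule w_sum_gt)
  fix i assume "i \<in> A"
  hence "ereal (real_of_int n) \<le> ereal (real_of_int i - 1)"
    using assms(2)[of i] by simp
  also have "\<dots> < w (emb (a i) * E powi (- i))"
    by (rule w_term(1)[OF assms(1)])
  finally show "ereal (real_of_int n) < w (emb (a i) * E powi (- i))" .
qed simp

lemma expn_diff:
  assumes "\<And>i. tame0 (a i)" "\<And>i. tame0 (b i)"
  shows "expn A a - expn A b = expn A (\<lambda>i z. a i z - b i z)"
  unfolding expn_def
  by (simp add: emb_diff tame0_imp_tame assms sum_subtractf left_diff_distrib)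

lemma expn_superset:
  assumes "finite B" "A \<subseteq> B" "\<And>i. i \<in> B - A \<Longrightarrow> a i = (\<lambda>_. 0)"
  shows "expn B a = expn A a"
  unfolding expn_def using assms by (intro sum.mono_neutral_right) (auto simp: emb_0)

text \<open>Let k \<le> i be the least index with a nonzero coefficient. Its term has value at most
  k, yet it is the difference of the full sum and the terms of larger index, both of value greater
  than k.\<close>

lemma expn_coeff_zero:
  assumes "finite A" "\<And>i. tame0 (a i)" "w (expn A a) > ereal (real_of_int m)" "i \<in> A" "i \<le> m"
  shows "a i = (\<lambda>_. 0)"
proof (rule ccontr)
  assume "a i \<noteq> (\<lambda>_. 0)"
  define S where "S = {i\<in>A. a i \<noteq> (\<lambda>_. 0)}"
  have "finite S" "i \<in> S"
    using assms(1,4) \<open>a i \<noteq> (\<lambda>_. 0)\<close> by (auto simp: S_def)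
  define k where "k = Min S"
  have k: "k \<in> S" "\<And>j. j \<in> S \<Longrightarrow> k \<le> j"
    using \<open>finite S\<close> \<open>i \<in> S\<close> unfolding k_def by (auto intro: Min_in)
  have "expn A a = expn S a"
    using assms(1) by (intro expn_superset) (auto simp: S_def)
  also have "\<dots> = emb (a k) * E powi (- k) + expn (S - {k}) a"
    unfolding expn_def using \<open>finite S\<close> k(1) by (rule sum.remove)
  finally have eq: "emb (a k) * E powi (- k) = expn A a - expn (S - {k}) a"
    by simp
  have "real_of_int k \<le> real_of_int m"
    using k(2)[OF \<open>i \<in> S\<close>] assms(5) by simp
  hence "w (expn A a) > ereal (real_of_int k)"
    using assms(3) by (metis ereal_less_eq(3) le_less_trans)
  moreover have "w (expn (S - {k}) a) > ereal (real_of_int k)"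
    using k(2) by (intro expn_gt assms(2)) (auto simp: order_less_le)
  ultimately have "w (emb (a k) * E powi (- k)) > ereal (real_of_int k)"
    unfolding eq by (rule w_simps(9))
  moreover have "w (emb (a k) * E powi (- k)) \<le> ereal (real_of_int k)"
    using k(1) by (intro w_term(2) assms(2)) (simp add: S_def)
  ultimately show False
    by simp
qed

section \<open>The ring T[1/e] and its density\<close>

lemma E_powi_add: "E powi (i + j) = E powi i * E powi j"
  using E_nonzero by (simp add: power_int_add)

definition localized :: "'f set"
  where "localized = {emb h * E powi (- int n) | h n. tame h}"

lemma localized_emb: "tame h \<Longrightarrow> emb h * E powi (- int n) \<in> localized"
  by (auto simp: localized_def)

lemma localized_mult:
  assumes "x \<in> localized" "y \<in> localized"
  shows "x * y \<in> localized"
proof -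
  obtain g m h n where "tame g" "tame h" "x = emb g * E powi (- int m)" "y = emb h * E powi (- int n)"
    using assms by (auto simp: localized_def)
  moreover from this have "x * y = emb (\<lambda>z. g z * h z) * E powi (- int (m + n))"
    using E_powi_add[of "- int m" "- int n"] by (simp add: emb_mult mult_ac)
  ultimately show ?thesis
    using localized_emb tame_mult by metis
qed

lemma localized_raise:
  assumes "tame h"
  shows "emb h * E powi (- int m) = emb (\<lambda>z. h z * e 0 z ^ k) * E powi (- int (m + k))"
proof -
  have "emb (\<lambda>z. h z * e 0 z ^ k) = emb h * E ^ k"
    using assms by (simp add: emb_mult tame_power tame_e emb_power)
  moreover have "E powi (- int m) = E ^ k * E powi (- int (m + k))"
    using E_powi_add[of "int k" "- int (m + k)"] by simp
  ultimately show ?thesis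
    by simp
qed

lemma localized_add:
  assumes "x \<in> localized" "y \<in> localized"
  shows "x + y \<in> localized"
proof -
  obtain g m h n where gh: "tame g" "tame h"
    "x = emb g * E powi (- int m)" "y = emb h * E powi (- int n)"
    using assms by (auto simp: localized_def)
  have t: "tame (\<lambda>z. g z * e 0 z ^ n)" "tame (\<lambda>z. h z * e 0 z ^ m)"
    by (intro tame_mult tame_power tame_e gh)+
  have "x + y = emb (\<lambda>z. g z * e 0 z ^ n + h z * e 0 z ^ m) * E powi (- int (m + n))"
    using localized_raise[OF gh(1), of m n] localized_raise[OF gh(2), of n m] gh(3,4) emb_add[OF t]
    by (simp add: distrib_right add.commute)
  thus ?thesis
    using localized_emb tame_add[OF t] by metis
qed

lemma localized_tame: "tame h \<Longrightarrow> emb h \<in> localized"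
  using localized_emb[of h 0] by simp

lemma localized_1: "1 \<in> localized"
  using localized_tame[OF tame_const[OF L_closed(2)]] by (simp add: emb_1)

lemma localized_power: "x \<in> localized \<Longrightarrow> x ^ n \<in> localized"
  by (induction n) (auto intro: localized_mult localized_1)

lemma localized_sum: "(\<And>i. i < n \<Longrightarrow> F i \<in> localized) \<Longrightarrow> (\<Sum>i<(n::nat). F i) \<in> localized"
  using localized_tame[OF tame_0] by (induction n) (auto intro: localized_add simp: emb_0)

lemma localized_finite_expansion:
  assumes "x \<in> localized"
  shows "\<exists>A a. finite A \<and> (\<forall>i. tame0 (a i)) \<and> (\<forall>i. i \<notin> A \<longrightarrow> a i = (\<lambda>_. 0)) \<and> x = expn A a"
proof -
  obtain h m where h: "tame h" "x = emb h * E powi (- int m)"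
    using assms by (auto simp: localized_def)
  obtain n b where b: "\<And>i. tame0 (b i)" "\<And>z. h z = (\<Sum>i\<le>n. e 0 z ^ i * b i z)"
    using tame_imp_poly0[OF h(1)] unfolding poly0_def by blast
  have tb: "tame (\<lambda>z. e 0 z ^ i * b i z)" for i
    by (intro tame_mult tame_power tame_e tame0_imp_tame b(1))
  have tsum: "tame (\<lambda>z. \<Sum>i\<le>n. e 0 z ^ i * b i z)" for n
  proof (induction n)
    case 0
    show ?case
      using tb[of 0] by simp
  next
    case (Suc n)
    show ?case
      using tame_add[OF Suc tb[of "Suc n"]] by simp
  qed
  have "emb (\<lambda>z. \<Sum>i\<le>n. e 0 z ^ i * b i z) = (\<Sum>i\<le>n. E ^ i * emb (b i))" for n
  proof (induction n)
    case (Suc n)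
    have "emb (\<lambda>z. e 0 z ^ Suc n * b (Suc n) z) = E ^ Suc n * emb (b (Suc n))"
      by (subst emb_mult) (simp_all only: emb_power tame_e tame_power tame0_imp_tame b(1))
    thus ?case
      using Suc emb_add[OF tsum[of n] tb[of "Suc n"]] by simp
  next
    case 0
    show ?case
      by simp
  qed
  moreover have "h = (\<lambda>z. \<Sum>i\<le>n. e 0 z ^ i * b i z)"
    using b(2) by blast
  ultimately have emb_h: "emb h = (\<Sum>i\<le>n. E ^ i * emb (b i))"
    by simp
  \<comment> \<open>The coefficient of e^i in the numerator belongs to e^(i - m), that is to index m
    - i, as indices count negative powers.\<close>
  define A where "A = (\<lambda>i. int m - int i) ` {..n}"
  define a where "a j = (if j \<in> A then b (nat (int m - j)) else (\<lambda>_. 0))" for j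
  have "expn A a = (\<Sum>i\<le>n. emb (a (int m - int i)) * E powi (- (int m - int i)))"
    unfolding expn_def A_def by (subst sum.reindex) (auto simp: inj_on_def)
  also have "\<dots> = (\<Sum>i\<le>n. E ^ i * emb (b i) * E powi (- int m))"
  proof (rule sum.cong)
    fix i assume "i \<in> {..n}"
    hence "a (int m - int i) = b i"
      by (auto simp: a_def A_def)
    moreover have "E powi (- (int m - int i)) = E ^ i * E powi (- int m)"
      using E_nonzero power_int_add[of E "int i" "- int m"] by simp
    ultimately show "emb (a (int m - int i)) * E powi (- (int m - int i)) =
        E ^ i * emb (b i) * E powi (- int m)"
      by simp
  qed simp
  also have "\<dots> = x"
    by (simp add: h(2) emb_h sum_distrib_right)
  finally have "x = expn A a"
    by simp
  moreover have "finite A" "\<And>i. i \<notin> A \<Longrightarrow> a i = (\<lambda>_. 0)"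
    by (simp_all add: A_def a_def)
  moreover have "tame0 (a i)" for i
    using b(1) tame0_0 by (simp add: a_def)
  ultimately show ?thesis
    by blast
qed

text \<open>
  Multiplying \<open>g\<close> by a monomial makes the leading exponent an integer \<open>n\<close>, so that the product is
  \<open>\<kappa> e\<^sup>n (1 - u)\<close> with \<open>u\<close> of positive valuation; then \<open>1 / (1 - u)\<close> is a geometric series.
\<close>

lemma unit_form:
  assumes "tame g" "g \<noteq> (\<lambda>_. 0)"
  shows "\<exists>r u. r \<in> localized \<and> u \<in> localized \<and> w u > 0 \<and> inverse (emb g) = r / (1 - u)"
proof -
  obtain c M where c: "w (emb g) = ereal (- wt q M)"
    using tame_expansion[OF assms] by blast
  obtain a k where a: "wt q M = real a / real q ^ k"
    using wt_eq_fraction[OF q_ge_2] by blast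
  \<comment> \<open>The numerator a itself serves as the integer exponent: it is at least a / q^k,
    and the difference is again a fraction with denominator q^k, hence the weight of a reduced
    multiset.\<close>
  have "a \<le> a * q ^ k"
    using q_ge_2 by simp
  hence "real a - wt q M = real (a * q ^ k - a) / real q ^ k"
    using q_ge_2 by (simp add: a field_simps of_nat_diff)
  then obtain \<mu> where \<mu>: "reduced q \<mu>" "wt q \<mu> = real a - wt q M"
    using ex_reduced_fraction[OF q_ge_2] by metis
  define G where "G z = g z * mon z \<mu>" for z
  have tG: "tame G"
    unfolding G_def[abs_def] by (intro tame_mult assms(1) tame_mon)
  have emb_G: "emb G = emb g * emb (\<lambda>z. mon z \<mu>)"
    unfolding G_def[abs_def] by (intro emb_mult assms(1) tame_mon)
  hence wG: "w (emb G) = ereal (- real a)"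
    using c w_mon[OF \<mu>(1)] \<mu>(2) by (simp add: w_simps(3))
  have "G \<noteq> (\<lambda>_. 0)"
    using wG emb_0 w_simps(6) by auto
  from tame_expansion[OF tG this] obtain cG MG where cG: "represents cG G" "\<And>M. cG M \<noteq> 0 \<Longrightarrow> reduced q M" "leading cG MG"
    "wt q MG = real a"
    using wG by force
  \<comment> \<open>For a \<ge> q this power is not itself a reduced monomial; only the weight a of
    its leading monomial is known. That suffices, as \<open>G\<close> has the same leading weight
    and a reduced multiset is determined by its weight.\<close>
  define P where "P z = e 0 z ^ a" for z
  have tP: "tame P" and emb_P: "emb P = E ^ a"
    unfolding P_def[abs_def] by (auto intro: tame_power tame_e emb_power)
  have wP: "w (emb P) = ereal (- real a)"
    using w_E_powi[of "int a"] by (simp add: emb_P)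
  have "P \<noteq> (\<lambda>_. 0)"
    using wP emb_0 w_simps(6) by auto
  from tame_expansion[OF tP this] obtain cP MP where cP: "represents cP P" "\<And>M. cP M \<noteq> 0 \<Longrightarrow> reduced q M" "leading cP MP"
    "wt q MP = real a"
    using wP by force
  have nz: "cG MG \<noteq> 0" "cP MP \<noteq> 0"
    using cG(3) cP(3) by (simp_all add: leading_def)
  have "MP = MG"
    using cG(4) cP(4) by (intro reduced_wt_inj[OF q_ge_2] cP(2) cG(2) nz) simp
  define \<kappa> where "\<kappa> = cG MG * inverse (cP MG)"
  have "cG M \<in> L" "cP M \<in> L" for M
    using cG(1) cP(1) by (auto simp: represents_def admissible_def)
  hence \<kappa>: "\<kappa> \<in> L" "\<kappa> \<noteq> 0"
    using nz \<open>MP = MG\<close> by (auto simp: \<kappa>_def intro: L_closed)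
  define H where "H z = G z - \<kappa> * P z" for z
  have tH: "tame H"
    unfolding H_def[abs_def] by (intro tame_diff tame_cmult tG tP \<kappa>(1))
  have emb_H: "emb H = emb G - emb (\<lambda>_. \<kappa>) * E ^ a"
    unfolding H_def[abs_def] by (simp add: emb_diff tG tame_cmult tP \<kappa>(1) emb_cmult emb_P)
  \<comment> \<open>Both leading terms sit at \<open>MG\<close> and cancel by the choice of
    \<open>\<kappa>\<close>, so the leading weight of \<open>H\<close> is strictly below a.\<close>
  have wH: "w (emb H) > ereal (- real a)"
  proof (cases "H = (\<lambda>_. 0)")
    case True
    thus ?thesis
      by (simp add: emb_0 w_simps(6))
  next
    case False
    define cH where "cH M = cG M - \<kappa> * cP M" for M
    have rH: "represents cH H"
      unfolding H_def[abs_def] cH_def[abs_def]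
      by (intro represents_diff represents_cmult cG(1) cP(1) \<kappa>(1))
    have supp: "cG M \<noteq> 0 \<or> cP M \<noteq> 0" if "cH M \<noteq> 0" for M
      using that by (auto simp: cH_def)
    have redH: "reduced q M" if "cH M \<noteq> 0" for M
      using supp[OF that] cG(2) cP(2) by blast
    obtain c' M' where M': "represents c' H" "\<And>M. c' M \<noteq> 0 \<Longrightarrow> reduced q M" "leading c' M'"
      "w (emb H) = ereal (- wt q M')"
      using tame_expansion[OF tH False] by blast
    have "c' = cH"
      by (rule represents_unique[OF M'(1,2) rH redH])
    hence "cH M' \<noteq> 0"
      using M'(3) by (simp add: leading_def)
    moreover have "cH MG = 0"
      using nz \<open>MP = MG\<close> by (simp add: cH_def \<kappa>_def)
    ultimately have "M' \<noteq> MG"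
      by auto
    moreover have "wt q M' \<le> real a"
      using supp[OF \<open>cH M' \<noteq> 0\<close>] cG(3,4) cP(3,4) by (auto simp: leading_def)
    ultimately have "wt q M' < real a"
      using reduced_wt_inj[OF q_ge_2 redH[OF \<open>cH M' \<noteq> 0\<close>] cG(2)[OF nz(1)]] cG(4)
      by (cases "wt q M' = real a") auto
    thus ?thesis
      using M'(4) by simp
  qed
  define K where "K = emb (\<lambda>_. inverse \<kappa>)"
  have iK: "inverse \<kappa> \<in> L"
    using \<kappa>(1) by (rule L_closed)
  have K: "emb (\<lambda>_. \<kappa>) * K = 1"
    using emb_cmult[OF tame_const[OF iK] \<kappa>(1)] \<kappa>(2) by (simp add: K_def emb_1)
  \<comment> \<open>Since \<open>G\<close> is \<kappa> e^a + H, dividing by \<kappa> e^a gives 1 -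
    u; \<open>r\<close> collects the factors by which g is multiplied on the way.\<close>
  define u where "u = - (K * emb H * E powi (- int a))"
  define r where "r = emb (\<lambda>z. mon z \<mu>) * (K * E powi (- int a))"
  have K_loc: "K \<in> localized"
    unfolding K_def by (intro localized_tame tame_const iK)
  have E_loc: "E powi (- int n) \<in> localized" for n
    using localized_emb[OF tame_const[OF L_closed(2)], of n] by (simp add: emb_1)
  have "- 1 \<in> L"
    by (intro L_closed)
  hence "emb (\<lambda>_. - 1) = - 1"
    using emb_add[OF tame_const tame_const, of "- 1" 1] L_closed(2)
    by (simp add: emb_0 emb_1 eq_neg_iff_add_eq_0)
  hence m1: "- 1 \<in> localized"
    using localized_tame[OF tame_const[OF \<open>- 1 \<in> L\<close>]] by simp
  have "u = - 1 * (K * emb H * E powi (- int a))"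
    by (simp add: u_def)
  hence "u \<in> localized"
    using m1 K_loc localized_tame[OF tH] E_loc by (metis localized_mult)
  moreover have "r \<in> localized"
    unfolding r_def by (intro localized_mult K_loc E_loc localized_tame tame_mon)
  moreover have "w u > 0"
  proof -
    have "w K = 0"
      unfolding K_def using iK \<kappa>(2) by (intro w_const) auto
    hence "w u = w (emb H) + ereal (real a)"
      using w_E_powi[of "- int a"] by (simp add: u_def w_simps(3,4))
    thus ?thesis
      using wH by (cases "w (emb H)") (auto simp: zero_ereal_def)
  qed
  moreover have "inverse (emb g) = r / (1 - u)"
  proof -
    have Ea: "E ^ a * E powi (- int a) = 1"
      using E_nonzero by (simp add: power_int_minus)
    have "emb G * (K * E powi (- int a)) = (emb (\<lambda>_. \<kappa>) * K) * (E ^ a * E powi (- int a)) +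
        K * emb H * E powi (- int a)"
    proof -
      have "emb G = emb (\<lambda>_. \<kappa>) * E ^ a + emb H"
        using emb_H by simp
      thus ?thesis
        by (simp only: distrib_left distrib_right mult_ac)
    qed
    also have "\<dots> = 1 - u"
      by (simp add: K Ea u_def)
    finally have eq: "emb g * r = 1 - u"
      by (simp add: emb_G r_def mult.assoc)
    have "1 - u \<noteq> 0"
      using \<open>w u > 0\<close> w_simps(5) by auto
    hence "emb g \<noteq> 0" "r \<noteq> 0"
      by (auto simp flip: eq)
    thus ?thesis
      by (simp add: divide_inverse flip: eq)
  qed
  ultimately show ?thesis
    by blast
qed

text \<open>With h = f / g = f r / (1 - u), truncating the geometric series after k terms leaves
  exactly the error h u^k, and its value w h + k w u exceeds any bound.\<close>

lemma localized_dense: "\<exists>y\<in>localized. w (x - y) > ereal B"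
proof -
  obtain f g where fg: "tame f" "tame g" "g \<noteq> (\<lambda>_. 0)" "w (x - emb f / emb g) > ereal B"
    using dense by blast
  obtain r u where ru: "r \<in> localized" "u \<in> localized" "w u > 0" "inverse (emb g) = r / (1 - u)"
    using unit_form[OF fg(2,3)] by blast
  have "1 - u \<noteq> 0"
    using ru(3) w_simps(5) by auto
  define h where "h = emb f / emb g"
  have h: "h = emb f * r / (1 - u)"
    using ru(4) by (simp add: h_def divide_inverse mult.assoc)
  have "\<exists>k. w (h * u ^ k) > ereal B"
  proof (cases "h = 0 \<or> u = 0")
    case True
    hence "w (h * u ^ 1) > ereal B"
      by (auto simp: w_simps(6))
    thus ?thesis ..
  next
    case False
    then obtain a b where ab: "w h = ereal a" "w u = ereal b"
      using w_simps(1,2) by (metis ereal_cases)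
    have "b > 0"
      using ru(3) ab by (simp add: zero_ereal_def)
    then obtain k :: nat where "B - a < real k * b"
      using reals_Archimedean3 by blast
    moreover have "w (h * u ^ k) = ereal (a + real k * b)"
      by (simp add: w_simps(3) w_simps(7)[OF ab(2)] ab(1))
    ultimately show ?thesis
      by (intro exI[of _ k]) simp
  qed
  then obtain k where k: "w (h * u ^ k) > ereal B"
    by blast
  define y where "y = emb f * r * (\<Sum>i<k. u ^ i)"
  have "y \<in> localized"
    unfolding y_def using ru fg(1)
    by (intro localized_mult localized_sum localized_power localized_tame)
  moreover have "h - y = h * u ^ k"
  proof -
    have "y * (1 - u) = emb f * r * (1 - u ^ k)"
      by (simp add: y_def one_diff_power_eq mult_ac)
    moreover have hu: "h * (1 - u) = emb f * r"
      using \<open>1 - u \<noteq> 0\<close> by (simp add: h)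
    ultimately have "(h - y) * (1 - u) = emb f * r - emb f * r * (1 - u ^ k)"
      by (simp only: left_diff_distrib[of h])
    also have "\<dots> = emb f * r * u ^ k"
      by (simp add: right_diff_distrib)
    also have "\<dots> = h * (1 - u) * u ^ k"
      by (simp only: hu)
    also have "\<dots> = (h * u ^ k) * (1 - u)"
      by (simp only: mult_ac)
    finally have "(h - y) * (1 - u) = (h * u ^ k) * (1 - u)" .
    thus ?thesis
      using \<open>1 - u \<noteq> 0\<close> by simp
  qed
  ultimately have "w ((x - h) + (h - y)) > ereal B"
    using fg(4) k by (intro w_simps(8)) (simp_all add: h_def)
  thus ?thesis
    using \<open>y \<in> localized\<close> by auto
qed

text \<open>The starting index is quantified inside the characterisation, so uniqueness also
  compares expansions that start at different places. For existence, the finite expansions of ever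
  better approximations are combined diagonally.\<close>

lemma unique_expansion:
  "\<exists>!a. (\<forall>i. tame0 (a i)) \<and> (\<exists>i0. (\<forall>i<i0. a i = (\<lambda>_. 0)) \<and>
    val_tendsto w (\<lambda>N. \<Sum>i=i0..N. emb (a i) * E powi (- i)) x at_top)"
proof (rule ex_ex1I)
  have "\<exists>A a. finite A \<and> (\<forall>i. tame0 (a i)) \<and> (\<forall>i. i \<notin> A \<longrightarrow> a i = (\<lambda>_. 0)) \<and>
      w (x - expn A a) > ereal (real n)" for n
    using localized_dense[of "real n" x] localized_finite_expansion by metis
  hence "\<exists>A. \<forall>n. \<exists>a. finite (A n) \<and> (\<forall>i. tame0 (a i)) \<and> (\<forall>i. i \<notin> A n \<longrightarrow> a i = (\<lambda>_. 0)) \<and>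
      w (x - expn (A n) a) > ereal (real n)"
    by (intro choice allI)
  then obtain A where "\<forall>n. \<exists>a. finite (A n) \<and> (\<forall>i. tame0 (a i)) \<and>
      (\<forall>i. i \<notin> A n \<longrightarrow> a i = (\<lambda>_. 0)) \<and> w (x - expn (A n) a) > ereal (real n)"
    by blast
  from choice[OF this] obtain a where a_all: "\<forall>n. finite (A n) \<and> (\<forall>i. tame0 (a n i)) \<and>
      (\<forall>i. i \<notin> A n \<longrightarrow> a n i = (\<lambda>_. 0)) \<and> w (x - expn (A n) (a n)) > ereal (real n)"
    by blast
  have fin: "finite (A n)" and t0: "tame0 (a n i)" and out: "i \<notin> A n \<Longrightarrow> a n i = (\<lambda>_. 0)"
    and approx: "w (x - expn (A n) (a n)) > ereal (real n)" for n i
    using a_all by auto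
  \<comment> \<open>The approximations of precision m and n differ by an element of value greater
    than m, so their coefficients agree up to index m.\<close>
  have stable: "a m i = a n i" if "m \<le> n" "i \<le> int m" for m n i
  proof (cases "i \<in> A m \<union> A n")
    case True
    have "ereal (real m) \<le> ereal (real n)"
      using that(1) by simp
    hence "w (x - expn (A n) (a n)) > ereal (real m)"
      using approx[of n] by (rule le_less_trans)
    from w_simps(9)[OF this approx[of m]]
    have "w (expn (A m) (a m) - expn (A n) (a n)) > ereal (real_of_int (int m))"
      by simp
    moreover have "expn (A m) (a m) = expn (A m \<union> A n) (a m)"
      "expn (A n) (a n) = expn (A m \<union> A n) (a n)"
      using fin out by (intro expn_superset[symmetric]; auto)+
    ultimately have "w (expn (A m \<union> A n) (\<lambda>i z. a m i z - a n i z)) > ereal (real_of_int (int m))"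
      by (simp add: expn_diff t0)
    hence "(\<lambda>z. a m i z - a n i z) = (\<lambda>_. 0)"
      using fin True that(2)
      by (intro expn_coeff_zero[where a = "\<lambda>i z. a m i z - a n i z"]) (auto intro: tame0_diff t0)
    thus ?thesis
      by (auto simp: fun_eq_iff)
  next
    case False
    thus ?thesis
      using out by simp
  qed
  \<comment> \<open>Index i is read off from the approximation of precision i; negative indices use
    precision 0, which already settles all indices \<le> 0.\<close>
  define b where "b i = a (nat i) i" for i
  \<comment> \<open>The inserted 0 ensures that indices below i0 are negative, where every
    approximation agrees with the one of precision 0; being outside \<open>A 0\<close>, they carry
    coefficient zero.\<close>
  define i0 where "i0 = Min (insert 0 (A 0))"
  have below: "a n i = (\<lambda>_. 0)" if "i < i0" for n i
  proof -
    have "\<not> i0 \<le> i"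
      using that by simp
    hence "i \<notin> insert 0 (A 0)" "i \<le> 0"
      unfolding i0_def using fin by (auto simp: Min_le_iff)
    thus ?thesis
      using stable[of 0 n i] out[of i 0] by simp
  qed
  have "w (expn {i0..N} b - x) > ereal (real_of_int N)" if N: "N \<ge> 0" for N
  proof -
    define n where "n = nat N"
    have n: "int n = N"
      using N by (simp add: n_def)
    have "b i = a n i" if "i \<in> {i0..N}" for i
      using that N unfolding b_def by (intro stable) (auto simp: n_def)
    hence "expn {i0..N} b = expn {i0..N} (a n)"
      by (simp add: expn_def)
    moreover have "expn (A n) (a n) = expn ({i0..N} \<union> {i\<in>A n. N < i}) (a n)"
    proof -
      have "expn (A n \<union> {i0..N}) (a n) = expn (A n) (a n)"
        using fin out by (intro expn_superset) auto
      moreover have "expn (A n \<union> {i0..N}) (a n) = expn ({i0..N} \<union> {i\<in>A n. N < i}) (a n)"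
        using fin out below by (intro expn_superset) (auto simp: not_le)
      ultimately show ?thesis
        by simp
    qed
    moreover have "\<dots> = expn {i0..N} (a n) + expn {i\<in>A n. N < i} (a n)"
      unfolding expn_def using fin by (intro sum.union_disjoint) auto
    ultimately have eq: "expn {i0..N} b - x = - (x - expn (A n) (a n)) - expn {i\<in>A n. N < i} (a n)"
      by simp
    have "w (expn {i\<in>A n. N < i} (a n)) > ereal (real_of_int N)"
      by (intro expn_gt t0) simp
    moreover have "w (- (x - expn (A n) (a n))) > ereal (real_of_int N)"
      using approx[of n] n unfolding w_simps(4) by (metis of_int_of_nat_eq)
    ultimately show ?thesis
      unfolding eq by (intro w_simps(9))
  qed
  hence "\<forall>\<^sub>F N in at_top. w (expn {i0..N} b - x) > ereal r" for r
  proof (intro eventually_mono[OF eventually_ge_at_top[of "max 0 \<lceil>r\<rceil>"]])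
    fix N assume N: "max 0 \<lceil>r\<rceil> \<le> N"
    hence "ereal r \<le> ereal (real_of_int N)"
      by (simp add: ceiling_le_iff)
    also have "\<dots> < w (expn {i0..N} b - x)"
      using \<open>\<And>N. 0 \<le> N \<Longrightarrow> ereal (real_of_int N) < w (expn {i0..N} b - x)\<close> N by simp
    finally show "ereal r < w (expn {i0..N} b - x)" .
  qed
  hence "val_tendsto w (\<lambda>N. \<Sum>i=i0..N. emb (b i) * E powi (- i)) x at_top"
    by (simp add: val_tendsto_def tendsto_PInfty expn_def)
  moreover have "\<forall>i<i0. b i = (\<lambda>_. 0)"
    by (simp add: b_def below)
  moreover have "\<forall>i. tame0 (b i)"
    by (simp add: b_def t0)
  ultimately show "\<exists>a. (\<forall>i. tame0 (a i)) \<and> (\<exists>i0. (\<forall>i<i0. a i = (\<lambda>_. 0)) \<and>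
      val_tendsto w (\<lambda>N. \<Sum>i=i0..N. emb (a i) * E powi (- i)) x at_top)"
    by blast
next
  fix a b
  assume a: "(\<forall>i. tame0 (a i)) \<and> (\<exists>i0. (\<forall>i<i0. a i = (\<lambda>_. 0)) \<and>
      val_tendsto w (\<lambda>N. \<Sum>i=i0..N. emb (a i) * E powi (- i)) x at_top)"
    and b: "(\<forall>i. tame0 (b i)) \<and> (\<exists>i0. (\<forall>i<i0. b i = (\<lambda>_. 0)) \<and>
      val_tendsto w (\<lambda>N. \<Sum>i=i0..N. emb (b i) * E powi (- i)) x at_top)"
  obtain i0 where i0: "\<forall>i<i0. a i = (\<lambda>_. 0)" "val_tendsto w (\<lambda>N. expn {i0..N} a) x at_top"
    using a by (auto simp: expn_def)
  obtain j0 where j0: "\<forall>i<j0. b i = (\<lambda>_. 0)" "val_tendsto w (\<lambda>N. expn {j0..N} b) x at_top"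
    using b by (auto simp: expn_def)
  have t0: "tame0 (a i)" "tame0 (b i)" for i
    using a b by auto
  show "a = b"
  proof
    fix i
    show "a i = b i"
    proof (cases "i < min i0 j0")
      case True
      thus ?thesis
        using i0(1) j0(1) by simp
    next
      case False
      have "\<forall>\<^sub>F N in at_top. ereal (real_of_int i) < w (expn {i0..N} a - x)"
        "\<forall>\<^sub>F N in at_top. ereal (real_of_int i) < w (expn {j0..N} b - x)"
        using i0(2) j0(2) unfolding val_tendsto_def tendsto_PInfty by auto
      hence "\<forall>\<^sub>F N in at_top. i \<le> N \<and> ereal (real_of_int i) < w (expn {i0..N} a - x) \<and>
          ereal (real_of_int i) < w (expn {j0..N} b - x)"
        by (intro eventually_conj eventually_ge_at_top)
      then obtain N where N: "i \<le> N" "ereal (real_of_int i) < w (expn {i0..N} a - x)"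
        "ereal (real_of_int i) < w (expn {j0..N} b - x)"
        using eventually_happens' trivial_limit_at_top_linorder by blast
      have "w (expn {i0..N} a - expn {j0..N} b) > ereal (real_of_int i)"
        using w_simps(9)[OF N(2,3)] by simp
      \<comment> \<open>Padding with zero coefficients gives both expansions the same index range,
        so that they can be subtracted coefficientwise.\<close>
      moreover have "expn {i0..N} a = expn {min i0 j0..N} a" "expn {j0..N} b = expn {min i0 j0..N} b"
        using i0(1) j0(1) by (intro expn_superset[symmetric]; auto)+
      ultimately have "w (expn {min i0 j0..N} (\<lambda>i z. a i z - b i z)) > ereal (real_of_int i)"
        by (simp add: expn_diff t0)
      hence "(\<lambda>z. a i z - b i z) = (\<lambda>_. 0)"
        using N(1) False
        by (intro expn_coeff_zero[where a = "\<lambda>i z. a i z - b i z" and A = "{min i0 j0..N}" and m = i])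
           (auto intro: tame0_diff t0)
      thus ?thesis
        by (auto simp: fun_eq_iff)
    qed
  qed
qed

end

section \<open>The Carlitz exponential\<close>

lemma CARD_field_ge_2: "CARD('a::{finite,field}) \<ge> 2"
proof -
  have "card {0, 1 :: 'a} \<le> CARD('a)"
    by (intro card_mono) auto
  thus ?thesis
    by simp
qed

context
  fixes \<phi> :: "'a::{finite,field} fls \<Rightarrow> 'c::{nonarch_field,complete_space}" and q :: nat
  assumes C: "is_C_infinity \<phi>" and q_eq: "q = CARD('a)"
begin

lemma q_ge_2: "q \<ge> 2"
  unfolding q_eq by (rule CARD_field_ge_2)

private abbreviation \<theta> :: 'c
  where "\<theta> \<equiv> theta \<phi>"

lemma C_infinity_hom: "field_hom \<phi>"
  using C by (simp add: is_C_infinity_def)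

lemma field_hom_fls_const: "field_hom (\<lambda>a. \<phi> (fls_const a))"
  unfolding field_hom_def
  by (simp add: field_hom_simps(6)[OF C_infinity_hom] fls_plus_const fls_const_mult_const
      flip: field_hom_simps(4,5)[OF C_infinity_hom])

lemma CHAR_C_infinity: "CHAR('c) = CHAR('a)"
  by (rule field_hom_CHAR[OF field_hom_fls_const])

lemma frobenius_add: "(x + y) ^ q = x ^ q + (y :: 'c) ^ q"
proof -
  obtain n where n: "q = CHAR('a) ^ n"
    unfolding q_eq using CARD_finite_field_eq_CHAR_power by blast
  have "CHAR('a) > 0"
    by (rule finite_imp_CHAR_pos) simp
  hence "prime CHAR('c)"
    unfolding CHAR_C_infinity by (rule prime_CHAR_semidom)
  thus ?thesis
    by (rule freshmans_dream') (use n CHAR_C_infinity in simp)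
qed

lemma frobenius_diff: "(x - y) ^ q = x ^ q - (y :: 'c) ^ q"
  using frobenius_add[of "x - y" y] by (simp add: algebra_simps)

lemma absv_theta: "absv \<theta> = real q"
proof -
  have "\<forall>f. f \<noteq> 0 \<longrightarrow> absv (\<phi> f) = real q powi (- fls_subdegree f)"
    using C by (simp add: is_C_infinity_def q_eq)
  from this[rule_format, of fls_X] have "absv (\<phi> fls_X) = inverse (real q)"
    by (simp add: power_int_minus)
  thus ?thesis
    by (simp add: theta_def absv_inverse)
qed

lemma theta_nonzero: "\<theta> \<noteq> 0"
  using absv_theta q_ge_2 by auto

lemma absv_carlitz_d: "absv (carlitz_d \<phi> i) = real q ^ (i * q ^ i)"
proof -
  have "absv (\<theta> ^ (q ^ i) - \<theta> ^ (q ^ j)) = real q ^ (q ^ i)" if "j < i" for j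
  proof -
    have "real q ^ (q ^ j) < real q ^ (q ^ i)"
      using that q_ge_2 by (intro power_strict_increasing) auto
    thus ?thesis
      by (subst absv_diff_eq) (simp_all add: absv_power absv_theta)
  qed
  hence "absv (carlitz_d \<phi> i) = (\<Prod>j<i. real q ^ (q ^ i))"
    unfolding carlitz_d_def absv_prod q_eq[symmetric] by (intro prod.cong) auto
  also have "\<dots> = real q ^ (i * q ^ i)"
    by (simp add: mult.commute flip: power_mult)
  finally show ?thesis .
qed

lemma carlitz_d_nonzero: "carlitz_d \<phi> i \<noteq> 0"
  using absv_carlitz_d[of i] q_ge_2 by auto

lemma carlitz_d_0: "carlitz_d \<phi> 0 = 1"
  by (simp add: carlitz_d_def)

text \<open>The factor with j = 0 is split off; by Frobenius the factors with j \<ge> 1 are the q-th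
  powers of the factors of d_i.\<close>

lemma carlitz_d_Suc: "carlitz_d \<phi> (Suc i) = (\<theta> ^ (q ^ Suc i) - \<theta>) * carlitz_d \<phi> i ^ q"
proof -
  have "(\<Prod>j<i. \<theta> ^ (q ^ Suc i) - \<theta> ^ (q ^ Suc j)) = (\<Prod>j<i. (\<theta> ^ (q ^ i) - \<theta> ^ (q ^ j)) ^ q)"
    by (simp add: frobenius_diff power_mult[symmetric] mult.commute)
  thus ?thesis
    unfolding carlitz_d_def q_eq[symmetric] prod.lessThan_Suc_shift prod_power_distrib
    by (simp del: power_Suc)
qed

lemma absv_carlitz_term:
  "absv (X ^ (q ^ i) / carlitz_d \<phi> i) = (absv X / real q ^ i) ^ (q ^ i)"
  by (simp add: absv_divide absv_power absv_carlitz_d power_divide power_mult)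

text \<open>The i-th term has absolute value (absv X / q^i)^(q^i), which is at most 2^(-i) once q^i
  \<ge> 2 absv X. The unconditional sum is then identified with the ordered \<open>suminf\<close> of
  the definition.\<close>

lemma carlitz_exp_has_sum:
  "((\<lambda>i. X ^ (q ^ i) / carlitz_d \<phi> i) has_sum carlitz_exp \<phi> X) UNIV"
proof -
  have q: "q \<ge> 2"
    by (rule q_ge_2)
  obtain N where N: "2 * absv X < real q ^ N"
    using real_arch_pow[of "real q" "2 * absv X"] q by auto
  have le: "absv (X ^ (q ^ i) / carlitz_d \<phi> i) \<le> (1 / 2) ^ i" if "i \<ge> N" for i
  proof -
    have "real q ^ N \<le> real q ^ i"
      using that q by (intro power_increasing) auto
    hence "2 * absv X \<le> real q ^ i"
      using N by linarith
    hence "absv X / real q ^ i \<le> 1 / 2"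
      using q by (simp add: field_simps)
    hence "(absv X / real q ^ i) ^ (q ^ i) \<le> (1 / 2) ^ (q ^ i)"
      using q by (intro power_mono) auto
    also have "\<dots> \<le> (1 / 2) ^ i"
    proof (rule power_decreasing)
      have "i < 2 ^ i" "2 ^ i \<le> q ^ i"
        using q by (auto intro: power_mono)
      thus "i \<le> q ^ i"
        by linarith
    qed auto
    finally show ?thesis
      by (simp add: absv_carlitz_term)
  qed
  have "(\<lambda>i. X ^ (q ^ i) / carlitz_d \<phi> i) summable_on UNIV"
  proof (rule summable_on_nonarch)
    fix \<epsilon> :: real assume "\<epsilon> > 0"
    then obtain M where M: "(1 / 2) ^ M < \<epsilon>"
      using real_arch_pow_inv[of \<epsilon> "1 / 2"] by auto
    have "i < max N M" if "absv (X ^ (q ^ i) / carlitz_d \<phi> i) \<ge> \<epsilon>" for i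
    proof (rule ccontr)
      assume "\<not> i < max N M"
      hence "i \<ge> N" "(1 / 2 :: real) ^ i \<le> (1 / 2) ^ M"
        by (auto intro!: power_decreasing)
      thus False
        using le[of i] M that by linarith
    qed
    hence "{i \<in> UNIV. absv (X ^ (q ^ i) / carlitz_d \<phi> i) \<ge> \<epsilon>} \<subseteq> {..<max N M}"
      by blast
    thus "finite {i \<in> UNIV. absv (X ^ (q ^ i) / carlitz_d \<phi> i) \<ge> \<epsilon>}"
      by (rule finite_subset) simp
  qed
  hence sum: "((\<lambda>i. X ^ (q ^ i) / carlitz_d \<phi> i) has_sum
      (\<Sum>\<^sub>\<infinity>i. X ^ (q ^ i) / carlitz_d \<phi> i)) UNIV"
    by (rule has_sum_infsum)
  hence "(\<lambda>i. X ^ (q ^ i) / carlitz_d \<phi> i) sums (\<Sum>\<^sub>\<infinity>i. X ^ (q ^ i) / carlitz_d \<phi> i)"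
    by (rule has_sum_imp_sums)
  hence "carlitz_exp \<phi> X = (\<Sum>\<^sub>\<infinity>i. X ^ (q ^ i) / carlitz_d \<phi> i)"
    unfolding carlitz_exp_def q_eq[symmetric] by (rule sums_unique[symmetric])
  thus ?thesis
    using sum by simp
qed

lemma continuous_frobenius: "continuous_on UNIV (\<lambda>x :: 'c. x ^ q)"
  unfolding continuous_on_def tendsto_absv_iff frobenius_diff[symmetric] absv_power
proof (intro ballI)
  fix x :: 'c
  have "((\<lambda>y. absv (y - x)) \<longlongrightarrow> 0) (at x)"
    using tendsto_ident_at[of x UNIV] by (simp only: tendsto_absv_iff)
  have "(0 :: real) ^ q = 0"
    using q_ge_2 by simp
  with tendsto_power[OF \<open>((\<lambda>y. absv (y - x)) \<longlongrightarrow> 0) (at x)\<close>, of q]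
  show "((\<lambda>y. absv (y - x) ^ q) \<longlongrightarrow> 0) (at x)"
    by (simp only:)
qed

text \<open>The q-th power map is additive and continuous, so it applies termwise and shifts the
  index by one. The recursion for d_(j+1) supplies the factor theta^(q^(j+1)) - theta; adding theta
  times the term leaves theta^(q^(j+1)), as in the series at theta X.\<close>

lemma carlitz_exp_theta: "carlitz_exp \<phi> (\<theta> * X) = carlitz_exp \<phi> X ^ q + \<theta> * carlitz_exp \<phi> X"
proof -
  define T where "T X i = X ^ (q ^ i) / carlitz_d \<phi> i" for X i
  have sum: "(T X has_sum carlitz_exp \<phi> X) UNIV" for X
    unfolding T_def by (rule carlitz_exp_has_sum)
  have "((\<lambda>i. T X i ^ q) has_sum carlitz_exp \<phi> X ^ q) UNIV"
    by (rule has_sum_homomorphism[OF sum _ _ continuous_frobenius])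
       (use q_ge_2 in \<open>auto simp: frobenius_add\<close>)
  hence "((\<lambda>i. (case i of 0 \<Rightarrow> 0 | Suc j \<Rightarrow> T X j ^ q)) has_sum carlitz_exp \<phi> X ^ q) (range Suc)"
    by (subst has_sum_reindex) (auto simp: o_def)
  hence "((\<lambda>i. (case i of 0 \<Rightarrow> 0 | Suc j \<Rightarrow> T X j ^ q)) has_sum carlitz_exp \<phi> X ^ q) UNIV"
    by (rule has_sum_cong_neutral[THEN iffD1, rotated -1]) (auto split: nat.splits)
  hence "((\<lambda>i. (case i of 0 \<Rightarrow> 0 | Suc j \<Rightarrow> T X j ^ q) + \<theta> * T X i) has_sum
      carlitz_exp \<phi> X ^ q + \<theta> * carlitz_exp \<phi> X) UNIV"
    by (intro has_sum_add has_sum_cmult_nonarch sum)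
  moreover have "(case i of 0 \<Rightarrow> 0 | Suc j \<Rightarrow> T X j ^ q) + \<theta> * T X i = T (\<theta> * X) i" for i
  proof (cases i)
    case 0
    thus ?thesis
      by (simp add: T_def carlitz_d_0)
  next
    case (Suc j)
    have d: "carlitz_d \<phi> (Suc j) = (\<theta> ^ (q ^ Suc j) - \<theta>) * carlitz_d \<phi> j ^ q"
      "carlitz_d \<phi> (Suc j) \<noteq> 0"
      by (rule carlitz_d_Suc, rule carlitz_d_nonzero)
    have "T X j ^ q = X ^ (q ^ Suc j) / carlitz_d \<phi> j ^ q"
      by (simp add: T_def power_divide mult.commute flip: power_mult)
    also have "\<dots> = (\<theta> ^ (q ^ Suc j) - \<theta>) * X ^ (q ^ Suc j) / carlitz_d \<phi> (Suc j)"
      using d by (simp del: power_Suc)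
    finally have "T X j ^ q + \<theta> * T X (Suc j) = \<theta> ^ (q ^ Suc j) * X ^ (q ^ Suc j) / carlitz_d \<phi> (Suc j)"
      by (simp add: T_def diff_divide_distrib left_diff_distrib del: power_Suc)
    thus ?thesis
      by (simp add: Suc T_def power_mult_distrib del: power_Suc)
  qed
  ultimately have "(T (\<theta> * X) has_sum carlitz_exp \<phi> X ^ q + \<theta> * carlitz_exp \<phi> X) UNIV"
    by simp
  thus ?thesis
    using sum has_sum_unique by blast
qed

text \<open>On the unit disc every term after the first is at most absv X / q \<le> absv X / 2, so
  the linear term dominates.\<close>

lemma absv_carlitz_exp:
  assumes "absv X \<le> 1"
  shows "absv (carlitz_exp \<phi> X) = absv X"
proof -
  define T where "T i = X ^ (q ^ i) / carlitz_d \<phi> i" for i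
  have q: "q \<ge> 2"
    by (rule q_ge_2)
  have sum: "(T has_sum carlitz_exp \<phi> X) UNIV"
    unfolding T_def by (rule carlitz_exp_has_sum)
  have "((\<lambda>i. if i = 0 then - X else 0) has_sum - X) {0 :: nat}"
    by (intro has_sum_finiteI) auto
  hence "((\<lambda>i. if i = 0 then - X else 0) has_sum - X) (UNIV :: nat set)"
    by (rule has_sum_cong_neutral[THEN iffD1, rotated -1]) auto
  from has_sum_add[OF sum this]
  have "((\<lambda>i. T i + (if i = 0 then - X else 0)) has_sum (carlitz_exp \<phi> X - X)) UNIV"
    by simp
  hence "absv (carlitz_exp \<phi> X - X) \<le> absv X / 2"
  proof (rule absv_has_sum_le)
    fix i
    show "absv (T i + (if i = 0 then - X else 0)) \<le> absv X / 2"
    proof (cases i)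
      case 0
      thus ?thesis
        by (simp add: T_def carlitz_d_0)
    next
      case (Suc j)
      have "real q \<le> real q ^ i"
        using power_increasing[of 1 i "real q"] q Suc by simp
      moreover have "2 \<le> real q"
        using q by simp
      ultimately have qi: "2 \<le> real q ^ i"
        by linarith
      hence "absv X / real q ^ i \<le> absv X / 2"
        using q by (intro divide_left_mono) auto
      moreover have "(absv X / real q ^ i) ^ (q ^ i) \<le> (absv X / real q ^ i) ^ 1"
        using assms qi q by (intro power_decreasing) (auto simp: field_simps)
      moreover have "absv (T i) = (absv X / real q ^ i) ^ (q ^ i)"
        by (simp only: T_def absv_carlitz_term)
      ultimately have "absv (T i) \<le> absv X / 2"
        unfolding power_one_right by linarith
      thus ?thesis
        using Suc by simp
    qed
  qed simp
  hence le: "absv (carlitz_exp \<phi> X - X) \<le> absv X / 2" .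
  show ?thesis
  proof (cases "X = 0")
    case True
    have "absv (carlitz_exp \<phi> X - X) \<le> 0"
      using le by (simp only: True absv_zero div_0)
    hence "carlitz_exp \<phi> X - X = 0"
      using absv_nonneg[of "carlitz_exp \<phi> X - X"] absv_eq_zero_iff by (metis order_antisym)
    thus ?thesis
      by simp
  next
    case False
    hence "absv X > 0"
      by simp
    hence "absv (carlitz_exp \<phi> X - X) < absv X"
      using le by linarith
    from absv_add_eq[OF this] show ?thesis
      by simp
  qed
qed

text \<open>
  A point of absolute value \<open>q powr (1 / (q + 1))\<close>: the values \<open>exp\<^sub>C (X / \<theta>\<^sup>k)\<close> never meet the
  slope \<open>q powr (1 / (q - 1))\<close> of the Newton polygon, so both terms of \<open>Y\<^sup>q + \<theta> Y\<close> always have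
  different absolute values.
\<close>

lemma range_subset_separable: "range \<phi> \<subseteq> separable_elements (range \<phi>)"
proof
  fix x assume x: "x \<in> range \<phi>"
  have *: "0 \<in> range \<phi>" "1 \<in> range \<phi>"
    using field_hom_simps(1,6)[OF C_infinity_hom] by (metis rangeI)+
  have "- x \<in> range \<phi>"
    using x field_hom_simps(2)[OF C_infinity_hom] by (metis imageE rangeI)
  hence "Polynomial.coeff [:- x, 1:] n \<in> range \<phi>" for n
    using * by (auto simp: coeff_pCons split: nat.splits)
  moreover have "coprime [:- x, 1:] (pderiv [:- x, 1:])"
    by (simp add: pderiv_pCons flip: one_pCons)
  ultimately show "x \<in> separable_elements (range \<phi>)"
    unfolding separable_elements_def by (intro CollectI exI[of _ "[:- x, 1:]"]) simp
qed

lemma theta_in_range: "\<theta> \<in> range \<phi>"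
proof -
  have "\<phi> fls_X * \<phi> (inverse fls_X) = 1"
    using field_hom_simps(5,6)[OF C_infinity_hom] by (metis fls_X_nonzero right_inverse)
  hence "\<theta> = \<phi> (inverse fls_X)"
    unfolding theta_def by (rule inverse_unique)
  thus ?thesis
    by simp
qed

text \<open>The polynomial x^(q+1) - theta is separable: p divides q, so its derivative is x^q, and
  x times the derivative minus the polynomial is the unit theta.\<close>

lemma ex_generic_point: "\<exists>X :: 'c. X ^ (q + 1) = \<theta>"
proof -
  define P where "P = Polynomial.monom 1 (q + 1) - [:\<theta>:]"
  have *: "0 \<in> range \<phi>" "1 \<in> range \<phi>" "- \<theta> \<in> range \<phi>"
    using field_hom_simps(1,2,6)[OF C_infinity_hom] theta_in_range by (metis imageE rangeI)+
  have "Polynomial.coeff P n \<in> range \<phi>" for n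
    using * by (auto simp: P_def coeff_pCons split: nat.splits)
  hence "\<forall>n. Polynomial.coeff P n \<in> separable_elements (range \<phi>)"
    using range_subset_separable by blast
  moreover have "Polynomial.degree P > 0"
  proof -
    have "Polynomial.coeff P (q + 1) = 1"
      by (simp add: P_def coeff_pCons)
    thus ?thesis
      by (metis add_gr_0 le_degree less_le_trans zero_less_one zero_neq_one)
  qed
  moreover have "coprime P (pderiv P)"
  proof (rule coprimeI)
    fix d assume d: "d dvd P" "d dvd pderiv P"
    have "CHAR('c) dvd q"
      unfolding CHAR_C_infinity q_eq
      using CARD_finite_field_eq_CHAR_power[where 'a = 'a] by (metis dvd_power)
    hence "of_nat q = (0 :: 'c)"
      by (simp add: of_nat_eq_0_iff_char_dvd)
    hence "pderiv P = Polynomial.monom 1 q"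
      by (simp add: P_def pderiv_diff pderiv_monom pderiv_pCons)
    hence "d dvd [:0, 1:] * Polynomial.monom 1 q"
      using d(2) by (simp only: dvd_mult)
    moreover have "[:0, 1:] * Polynomial.monom 1 q - P = [:\<theta>:]"
      by (simp add: P_def monom_Suc)
    ultimately have "d dvd [:\<theta>:]"
      using d(1) by (metis dvd_diff)
    moreover have "[:\<theta>:] dvd 1"
      using theta_nonzero by (simp add: is_unit_const_poly_iff dvd_field_iff)
    ultimately show "d dvd 1"
      by (rule dvd_trans)
  qed
  moreover have "separably_closed (separable_elements (range \<phi>))"
    using C by (simp add: is_C_infinity_def)
  ultimately obtain X where "poly P X = 0"
    unfolding separably_closed_def by blast
  thus ?thesis
    by (intro exI[of _ X]) (simp add: P_def poly_monom)
qed

text \<open>In terms of exponents of q: for k \<ge> 1 the argument lies in the unit disc, which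
  gives s - 1 - k. The linear term of the recursion still dominates on the way to k = 0 and k = -1,
  with exponents s - 1 and s. From there on the q-th power dominates, and each step multiplies the
  exponent by q.\<close>

lemma generic_growth:
  fixes X :: 'c
  assumes X: "X ^ (q + 1) = \<theta>"
  defines "s \<equiv> 1 + 1 / (real q + 1)"
  shows "absv (carlitz_exp \<phi> (X / \<theta> powi k)) \<le> real q powr (s * real q powi (- 1 - k))"
    and "k \<le> - 1 \<Longrightarrow>
      absv (carlitz_exp \<phi> (X / \<theta> powi k)) = real q powr (s * real q powi (- 1 - k))"
proof -
  have q: "real q \<ge> 2"
    using q_ge_2 by linarith
  define F where "F k = carlitz_exp \<phi> (X / \<theta> powi k)" for k
  have rec: "F (k - 1) = F k ^ q + \<theta> * F k" for k
  proof -
    have "\<theta> powi k = \<theta> * \<theta> powi (k - 1)"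
      using theta_nonzero by (simp add: power_int_diff)
    hence "X / \<theta> powi (k - 1) = \<theta> * (X / \<theta> powi k)"
      using theta_nonzero by simp
    thus ?thesis
      by (simp only: F_def carlitz_exp_theta)
  qed
  have absX: "absv X = real q powr (s - 1)"
  proof -
    have pos: "absv X > 0"
      using X theta_nonzero by auto
    have "absv X ^ (q + 1) = real q"
      using X absv_theta by (metis absv_power)
    hence "absv X powr (real q + 1) = real q"
      using pos by (subst (asm) powr_realpow[symmetric]) (auto simp: add.commute)
    hence "(absv X powr (real q + 1)) powr (s - 1) = real q powr (s - 1)"
      by simp
    thus ?thesis
      using pos q by (simp add: powr_powr s_def)
  qed
  \<comment> \<open>Comparing q x with 1 + x decides which term of F^q + theta F dominates; equality
    holds only at the critical exponent x = 1 / (q - 1).\<close>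
  have big: "absv (F (k - 1)) = real q powr (real q * x)"
    if "absv (F k) = real q powr x" "real q * x > 1 + x" for k x
  proof -
    have 1: "absv (F k ^ q) = real q powr (real q * x)"
      using q that(1) by (simp add: absv_power powr_powr mult.commute flip: powr_realpow)
    moreover have "absv (\<theta> * F k) = real q powr (1 + x)"
      using q that(1) by (simp add: absv_mult absv_theta powr_add)
    ultimately show ?thesis
      unfolding rec using q that(2) by (subst absv_add_eq) (auto intro: powr_less_mono)
  qed
  have small: "absv (F (k - 1)) = real q powr (1 + x)"
    if "absv (F k) = real q powr x" "real q * x < 1 + x" for k x
  proof -
    have "absv (F k ^ q) = real q powr (real q * x)"
      using q that(1) by (simp add: absv_power powr_powr mult.commute flip: powr_realpow)
    moreover have "absv (\<theta> * F k) = real q powr (1 + x)"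
      using q that(1) by (simp add: absv_mult absv_theta powr_add)
    ultimately show ?thesis
      unfolding rec using q that(2)
      by (subst add.commute, subst absv_add_eq) (auto intro: powr_less_mono)
  qed
  \<comment> \<open>The exponent s - 1 = 1 / (q + 1) lies below the critical 1 / (q - 1) and s lies
    above it, so the regime changes exactly at k = -1.\<close>
  have s: "s - 1 > 0" "real q * (s - 1) < 1" "s > 1" "s < 2"
    using q by (simp_all add: s_def field_simps)
  have F_pos: "absv (F (int i + 1)) = real q powr (s - 1 - real (i + 1))" for i
  proof -
    have "absv (X / \<theta> powi (int i + 1)) = real q powr (s - 1) / real q ^ (i + 1)"
    proof -
      have "\<theta> powi (int i + 1) = \<theta> ^ (i + 1)"
        by (metis of_nat_1 of_nat_add power_int_of_nat)
      thus ?thesis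
        by (simp only: absv_divide absX absv_power absv_theta)
    qed
    also have "\<dots> = real q powr (s - 1 - real (i + 1))"
    proof -
      have "real q powr real (i + 1) = real q ^ (i + 1)"
        using q by (intro powr_realpow) simp
      thus ?thesis
        by (simp only: powr_diff[of "real q" "s - 1"])
    qed
    finally have *: "absv (X / \<theta> powi (int i + 1)) = real q powr (s - 1 - real (i + 1))" .
    have "real q * (s - 1) \<ge> s - 1"
      using q s(1) by simp
    hence "s - 1 - real (i + 1) \<le> 0"
      using s(2) by simp
    hence "real q powr (s - 1 - real (i + 1)) \<le> real q powr 0"
      using q by (intro powr_mono) auto
    hence "absv (X / \<theta> powi (int i + 1)) \<le> 1"
      using q unfolding * by simp
    thus ?thesis
      unfolding F_def by (subst absv_carlitz_exp) (simp_all add: *)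
  qed
  have F_0: "absv (F 0) = real q powr (s - 1)"
  proof -
    have "real q * (s - 2) \<le> 2 * (s - 2)"
      using s(4) q by (intro mult_right_mono_neg) auto
    also have "\<dots> < 1 + (s - 2)"
      using s(4) by simp
    finally show ?thesis
      using small[of 1 "s - 2"] F_pos[of 0] by (simp add: algebra_simps)
  qed
  have F_1: "absv (F (- 1)) = real q powr s"
    using small[of 0 "s - 1", OF F_0] s by simp
  have F_neg: "absv (F (- 1 - int i)) = real q powr (s * real q ^ i)" for i
  proof (induction i)
    case (Suc i)
    have "1 * 1 < s * real q ^ i * (real q - 1)"
    proof -
      have "1 \<le> real q ^ i" "1 \<le> real q - 1"
        using q by simp_all
      hence "1 * (1 * 1) \<le> 1 * (real q ^ i * (real q - 1))"
        by (intro mult_left_mono mult_mono) auto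
      also have "\<dots> < s * (real q ^ i * (real q - 1))"
        using s(3) q by (intro mult_strict_right_mono) auto
      finally show ?thesis
        by (simp add: mult.assoc)
    qed
    hence "real q * (s * real q ^ i) > 1 + s * real q ^ i"
      by (simp add: algebra_simps)
    from big[OF Suc this] show ?case
      by (simp add: algebra_simps)
  qed (simp add: F_1)
  have neg: "absv (F k) = real q powr (s * real q powi (- 1 - k))" if "k \<le> - 1" for k
  proof -
    have "k = - 1 - int (nat (- 1 - k))" "- 1 - k = int (nat (- 1 - k))"
      using that by auto
    thus ?thesis
      using F_neg[of "nat (- 1 - k)"] by (metis power_int_of_nat)
  qed
  \<comment> \<open>Passing from i to i + 1 lowers the left side by 1 and the right side by s (1 -
    1/q) q^(-i), which is at most 1.\<close>
  have ineq: "s - real i \<le> s * inverse (real q) ^ i" for i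
  proof (induction i)
    case (Suc i)
    have "s * (real q - 1) \<le> real q"
      using s(2,3) by (simp add: algebra_simps)
    hence "s * (real q - 1) / real q \<le> 1"
      using q by simp
    also have "s * (real q - 1) / real q = s * (1 - inverse (real q))"
      using q by (simp add: field_simps)
    finally have "s * (1 - inverse (real q)) \<le> 1" .
    moreover have "inverse (real q) ^ i \<le> 1"
      using q by (intro power_le_one) (auto simp: field_simps)
    moreover have "s * (1 - inverse (real q)) \<ge> 0"
      using q s(3) by (intro mult_nonneg_nonneg) (auto simp: field_simps)
    ultimately have "inverse (real q) ^ i * (s * (1 - inverse (real q))) \<le> 1"
      using mult_le_one[of "inverse (real q) ^ i" "s * (1 - inverse (real q))"] by blast
    thus ?case
      using Suc by (simp add: algebra_simps)
  qed simp
  show "absv (carlitz_exp \<phi> (X / \<theta> powi k)) = real q powr (s * real q powi (- 1 - k))"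
    if "k \<le> - 1"
    using neg[OF that] by (simp add: F_def)
  show "absv (carlitz_exp \<phi> (X / \<theta> powi k)) \<le> real q powr (s * real q powi (- 1 - k))"
  proof (cases "k \<le> - 1")
    case True
    thus ?thesis
      using neg[of k] by (simp add: F_def)
  next
    case False
    define i where "i = nat (k + 1)"
    have k: "k = int i - 1"
      using False by (simp add: i_def)
    have "absv (F k) = real q powr (s - real i)"
    proof (cases "k = 0")
      case True
      thus ?thesis
        using F_0 by (simp add: i_def)
    next
      case False
      thus ?thesis
        using F_pos[of "nat (k - 1)"] \<open>\<not> k \<le> - 1\<close> by (simp add: i_def algebra_simps)
    qed
    also have "\<dots> \<le> real q powr (s * inverse (real q) ^ i)"
      using q ineq by (intro powr_mono) auto
    also have "inverse (real q) ^ i = real q powi (- 1 - k)"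
      by (simp add: k power_int_minus power_inverse)
    finally show ?thesis
      by (simp add: F_def)
  qed
qed

end

section \<open>Base \<open>q\<close> expansions and reduced multisets\<close>

text \<open>A digit function with finite support is the multiplicity function of a multiset, so
  uniqueness of base q expansions is injectivity of the weight on reduced multisets. This evaluates
  the definite description in \<open>q_digit\<close>.\<close>

lemma is_q_expansion_wt:
  assumes q: "q \<ge> 2" and red: "reduced q M"
  shows "is_q_expansion q (wt q M) d \<longleftrightarrow> d = count M"
proof
  assume d: "is_q_expansion q (wt q M) d"
  have "finite {k. 0 < d k}"
    using d by (simp add: is_q_expansion_def)
  hence count: "count (Abs_multiset d) = d"
    by (rule count_Abs_multiset)
  have "set_mset (Abs_multiset d) = {k. d k \<noteq> 0}"
    by (simp add: set_mset_def count)
  hence "wt q (Abs_multiset d) = wt q M"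
    using d by (simp add: wt_eq_sum count is_q_expansion_def)
  moreover have "reduced q (Abs_multiset d)"
    using d by (simp add: reduced_def count is_q_expansion_def)
  ultimately have "Abs_multiset d = M"
    by (intro reduced_wt_inj[OF q] red) auto
  thus "d = count M"
    using count by simp
next
  assume "d = count M"
  moreover have "{k. count M k \<noteq> 0} = set_mset M"
    by (auto simp: not_in_iff)
  ultimately show "is_q_expansion q (wt q M) d"
    using red by (simp add: is_q_expansion_def reduced_def wt_eq_sum)
qed

lemma q_digit_wt: "q \<ge> 2 \<Longrightarrow> reduced q M \<Longrightarrow> q_digit q (wt q M) = count M"
  unfolding q_digit_def by (rule the_equality) (simp_all add: is_q_expansion_wt)

lemma digit_sum_wt:
  assumes "q \<ge> 2" "reduced q M"
  shows "digit_sum q (wt q M) = size M"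
proof -
  have "{k. count M k \<noteq> 0} = set_mset M"
    by (auto simp: not_in_iff)
  thus ?thesis
    by (simp add: digit_sum_def q_digit_wt assms size_multiset_overloaded_eq)
qed

text \<open>Denominators p^n and q^n give the same numbers: p^n divides q^n, and q^n = p^(s
  n).\<close>

lemma Zp_nonneg_CHAR:
  assumes q: "q = CARD('a::{finite,field})"
  shows "Zp_nonneg CHAR('a) = wt q ` {M. reduced q M}"
proof -
  have q2: "q \<ge> 2"
    unfolding q by (rule CARD_field_ge_2)
  obtain s where s: "q = CHAR('a) ^ s" "s > 0"
    unfolding q by (rule CARD_finite_field_eq_CHAR_power)
  have p: "CHAR('a) > 0"
    using q2 s by (metis gr0I not_numeral_le_zero power_eq_0_iff)
  show ?thesis
  proof (intro equalityI subsetI)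
    fix j assume "j \<in> Zp_nonneg CHAR('a)"
    then obtain a n where j: "j = real a / real CHAR('a) ^ n"
      by (auto simp: Zp_nonneg_def)
    have "n \<le> s * n"
      using s(2) by simp
    hence "real q ^ n = real CHAR('a) ^ n * real CHAR('a) ^ (s * n - n)"
      by (simp add: s(1) flip: power_mult power_add)
    hence "j = real (a * CHAR('a) ^ (s * n - n)) / real q ^ n"
      using p by (simp add: j)
    moreover obtain M where "reduced q M"
      "wt q M = real (a * CHAR('a) ^ (s * n - n)) / real q ^ n"
      using ex_reduced_fraction[OF q2] by blast
    ultimately show "j \<in> wt q ` {M. reduced q M}"
      by (intro image_eqI[of _ _ M]) auto
  next
    fix j assume "j \<in> wt q ` {M. reduced q M}"
    then obtain M where "j = wt q M"
      by blast
    then obtain a n where "j = real a / real q ^ n"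
      using wt_eq_fraction[OF q2] by blast
    hence "j = real a / real CHAR('a) ^ (s * n)"
      by (simp add: s(1) power_mult)
    thus "j \<in> Zp_nonneg CHAR('a)"
      by (auto simp: Zp_nonneg_def)
  qed
qed


section \<open>The tame series of the Carlitz exponential\<close>

locale carlitz_setting =
  fixes \<phi> :: "'a::{finite,field} fls \<Rightarrow> 'c::{nonarch_field,complete_space}"
    and \<pi> :: 'c
    and \<iota> :: "'c \<Rightarrow> 'k::{nonarch_field,complete_space}"
    and S :: "nat set" and t :: "nat \<Rightarrow> 'k" and L :: "'k set" and q :: nat
  assumes C_infinity: "is_C_infinity \<phi>"
    and period: "is_carlitz_period \<phi> \<pi>"
    and K_Sigma: "is_K_Sigma \<iota> S t"
    and L_subfield: "is_subfield L"
    and A_subset: "\<iota> ` A_ring \<phi> \<subseteq> L"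
    and q_eq: "q = CARD('a)"
begin

lemmas iota_simps = field_hom_simps[OF K_Sigma[unfolded is_K_Sigma_def, THEN conjunct1]]

text \<open>The Gauss norm of a constant polynomial is the absolute value of its
  coefficient.\<close>

lemma absv_iota: "absv (\<iota> c) = absv c"
proof -
  define P where "P = (Poly_Mapping.single 0 c :: (nat \<Rightarrow>\<^sub>0 nat) \<Rightarrow>\<^sub>0 'c)"
  have "P \<in> polys_in UNIV S"
    by (auto simp: polys_in_def P_def split: if_splits)
  hence "absv (eval_poly \<iota> t P) = gauss_norm P"
    using K_Sigma by (simp add: is_K_Sigma_def)
  moreover have "eval_poly \<iota> t P = \<iota> c"
    by (cases "c = 0") (simp_all add: eval_poly_def P_def iota_simps(1))
  moreover have "gauss_norm P = absv c"
    by (cases "c = 0") (simp_all add: gauss_norm_def P_def)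
  ultimately show ?thesis
    by simp
qed

lemma iota_theta_in: "\<iota> (theta \<phi>) \<in> L"
proof -
  have "theta \<phi> = poly [:0, 1:] (theta \<phi>)"
    by simp
  moreover have "\<phi> (fls_const 0) = 0" "\<phi> (fls_const 1) = 1"
    using field_hom_simps(1,6)[OF field_hom_fls_const[OF C_infinity q_eq]] by auto
  hence "0 \<in> Fq_set \<phi>" "1 \<in> Fq_set \<phi>"
    unfolding Fq_set_def by (metis rangeI)+
  hence "\<forall>n. Polynomial.coeff [:0, 1:] n \<in> Fq_set \<phi>"
    by (auto simp: coeff_pCons split: nat.splits)
  ultimately have "theta \<phi> \<in> A_ring \<phi>"
    unfolding A_ring_def by blast
  thus ?thesis
    using A_subset by blast
qed

lemma e_fun_pred: "e_fun \<phi> \<pi> (k - 1) z = e_fun \<phi> \<pi> k z ^ q + theta \<phi> * e_fun \<phi> \<pi> k z"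
proof -
  have nz: "theta \<phi> \<noteq> 0"
    by (rule theta_nonzero[OF C_infinity q_eq])
  have "theta \<phi> powi k = theta \<phi> * theta \<phi> powi (k - 1)"
    using nz by (simp add: power_int_diff)
  hence "\<pi> * z / theta \<phi> powi (k - 1) = theta \<phi> * (\<pi> * z / theta \<phi> powi k)"
    using nz by simp
  thus ?thesis
    by (simp only: e_fun_def carlitz_exp_theta[OF C_infinity q_eq])
qed

lemma e_fun_tendsto_0: "(\<lambda>n. \<iota> (e_fun \<phi> \<pi> (int n) z)) \<longlonglongrightarrow> 0"
proof -
  have q: "q \<ge> 2"
    by (rule q_ge_2[OF C_infinity q_eq])
  have absv: "absv (\<pi> * z / theta \<phi> powi (int n)) = absv (\<pi> * z) * inverse (real q) ^ n" for n
    by (simp only: absv_divide absv_power absv_theta[OF C_infinity q_eq] power_int_of_nat)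
       (simp only: power_inverse divide_inverse)
  have lim: "(\<lambda>n. absv (\<pi> * z) * inverse (real q) ^ n) \<longlonglongrightarrow> 0"
    using q by (intro tendsto_mult_right_zero LIMSEQ_realpow_zero) (auto simp: field_simps)
  have "\<forall>\<^sub>F n in sequentially. absv (\<pi> * z) * inverse (real q) ^ n < 1"
    using lim by (rule order_tendstoD) simp
  hence "\<forall>\<^sub>F n in sequentially.
      absv (\<pi> * z) * inverse (real q) ^ n = absv (\<iota> (e_fun \<phi> \<pi> (int n) z))"
    by eventually_elim
       (simp add: absv_iota e_fun_def absv absv_carlitz_exp[OF C_infinity q_eq] del: power_int_of_nat)
  from Lim_transform_eventually[OF lim this] show ?thesis
    by (simp add: tendsto_absv_iff)
qed

text \<open>At theta^n X / \<pi> the function e_k takes the value exp_C(X / theta^(k - n)). The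
  exact range k - n \<le> -1 becomes k < n, and the factorisation of q^(-1 - (k - n)) as q^(n - 1)
  q^(-k) exhibits the rate ln q * s * q^(n - 1).\<close>

lemma ex_growth:
  "\<exists>\<zeta> Y. (\<forall>k n. absv (\<iota> (e_fun \<phi> \<pi> k (\<zeta> n))) \<le> exp (Y n * real q powi (- k))) \<and>
     (\<forall>k n. k < int n \<longrightarrow> absv (\<iota> (e_fun \<phi> \<pi> k (\<zeta> n))) = exp (Y n * real q powi (- k))) \<and>
     filterlim Y at_top sequentially"
proof -
  have q: "real q \<ge> 2"
    using q_ge_2[OF C_infinity q_eq] by simp
  have nz: "theta \<phi> \<noteq> 0"
    by (rule theta_nonzero[OF C_infinity q_eq])
  have \<pi>: "\<pi> \<noteq> 0"
    using period by (simp add: is_carlitz_period_def)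
  obtain X :: 'c where X: "X ^ (q + 1) = theta \<phi>"
    using ex_generic_point[OF C_infinity q_eq] by blast
  define s where "s = 1 + 1 / (real q + 1)"
  define \<zeta> where "\<zeta> n = theta \<phi> ^ n * X / \<pi>" for n
  define Y where "Y n = ln (real q) * (s * real q powi (int n - 1))" for n
  have e: "absv (\<iota> (e_fun \<phi> \<pi> k (\<zeta> n))) = absv (carlitz_exp \<phi> (X / theta \<phi> powi (k - int n)))"
    for k n
  proof -
    have "\<pi> * \<zeta> n / theta \<phi> powi k = X / theta \<phi> powi (k - int n)"
      using nz \<pi> by (simp add: \<zeta>_def power_int_diff)
    thus ?thesis
      by (simp add: e_fun_def absv_iota)
  qed
  have Y: "real q powr (s * real q powi (- 1 - (k - int n))) = exp (Y n * real q powi (- k))" for k n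
  proof -
    have "real q powi (- 1 - (k - int n)) = real q powi (int n - 1) * real q powi (- k)"
      using q by (subst power_int_add[symmetric]) (auto simp: algebra_simps)
    thus ?thesis
      using q by (simp add: powr_def Y_def mult_ac)
  qed
  have "filterlim Y at_top sequentially"
  proof (rule filterlim_at_top_mono)
    have pos: "ln (real q) * s / real q > 0"
      using q by (auto simp: s_def intro!: divide_pos_pos mult_pos_pos add_pos_nonneg)
    show "filterlim (\<lambda>n. ln (real q) * s / real q * real n) at_top sequentially"
      by (rule filterlim_tendsto_pos_mult_at_top[OF tendsto_const pos filterlim_real_sequentially])
    have "real n \<le> real q ^ n" for n
    proof -
      have "n < 2 ^ n"
        by simp
      hence "real n \<le> 2 ^ n"
        by (metis less_imp_le of_nat_le_iff of_nat_numeral of_nat_power)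
      also have "\<dots> \<le> real q ^ n"
        using q by (intro power_mono) auto
      finally show ?thesis .
    qed
    hence "ln (real q) * s / real q * real n \<le> ln (real q) * s / real q * real q ^ n" for n
      using pos by (intro mult_left_mono) auto
    moreover have "ln (real q) * s / real q * real q ^ n = Y n" for n
      using q by (simp add: Y_def power_int_diff)
    ultimately show "\<forall>\<^sub>F n in sequentially. ln (real q) * s / real q * real n \<le> Y n"
      by (intro always_eventually allI) metis
  qed
  moreover have "absv (\<iota> (e_fun \<phi> \<pi> k (\<zeta> n))) \<le> exp (Y n * real q powi (- k))" for k n
    using generic_growth(1)[OF C_infinity q_eq X, of "k - int n"] unfolding e Y[symmetric] s_def .
  moreover have "absv (\<iota> (e_fun \<phi> \<pi> k (\<zeta> n))) = exp (Y n * real q powi (- k))" if "k < int n" for k n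
    using generic_growth(2)[OF C_infinity q_eq X, of "k - int n"] that
    unfolding e Y[symmetric] s_def by simp
  ultimately show ?thesis
    by (intro exI[of _ \<zeta>] exI[of _ Y]) blast
qed

lemma ex_tame_system:
  "\<exists>\<zeta> Y. tame_system q (\<lambda>k z. \<iota> (e_fun \<phi> \<pi> k z)) (\<iota> (theta \<phi>)) L \<zeta> Y"
proof -
  obtain \<zeta> Y where "\<And>k n. absv (\<iota> (e_fun \<phi> \<pi> k (\<zeta> n))) \<le> exp (Y n * real q powi (- k))"
    "\<And>k n. k < int n \<Longrightarrow> absv (\<iota> (e_fun \<phi> \<pi> k (\<zeta> n))) = exp (Y n * real q powi (- k))"
    "filterlim Y at_top sequentially"
    using ex_growth by blast
  hence "tame_system q (\<lambda>k z. \<iota> (e_fun \<phi> \<pi> k z)) (\<iota> (theta \<phi>)) L \<zeta> Y"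
    by unfold_locales
       (use q_ge_2[OF C_infinity q_eq] e_fun_tendsto_0 L_subfield iota_theta_in in
         \<open>simp_all add: e_fun_pred iota_simps(4,5,7)\<close>)
  thus ?thesis
    by blast
qed

end

locale carlitz_tame =
  carlitz_setting \<phi> \<pi> \<iota> S t L q + tame_system q "\<lambda>k z. \<iota> (e_fun \<phi> \<pi> k z)" "\<iota> (theta \<phi>)" L \<zeta> Y
  for \<phi> :: "'a::{finite,field} fls \<Rightarrow> 'c::{nonarch_field,complete_space}"
    and \<pi> and \<iota> :: "'c \<Rightarrow> 'k::{nonarch_field,complete_space}" and S t L q \<zeta> Y
begin

lemma iota_e_monomial:
  assumes "reduced q M"
  shows "\<iota> (e_monomial \<phi> \<pi> (wt q M) z) = mon z M"
proof -
  have prod: "\<iota> (prod F B) = (\<Prod>i\<in>B. \<iota> (F i))" for F :: "int \<Rightarrow> 'c" and B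
    by (induction B rule: infinite_finite_induct) (simp_all add: iota_simps(5,6))
  have "{k. count M k \<noteq> 0} = set_mset M"
    by (auto simp: not_in_iff)
  thus ?thesis
    by (simp add: e_monomial_def q_digit_wt[OF q_ge_2 assms] prod iota_simps(7) mon_def
        image_prod_mset_multiplicity flip: q_eq)
qed

text \<open>Carries coefficients over from real exponents to multisets; the value 0 at unreduced
  multisets prevents an exponent from being counted several times.\<close>

definition family :: "(real \<Rightarrow> 'k) \<Rightarrow> int multiset \<Rightarrow> 'k"
  where "family c M = (if reduced q M then c (wt q M) else 0)"

lemma bij_betw_wt: "bij_betw (wt q) {M. reduced q M} (Zp_nonneg CHAR('a))"
  unfolding Zp_nonneg_CHAR[OF q_eq] by (intro bij_betw_imageI inj_onI) (auto intro: reduced_wt_inj[OF q_ge_2])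

lemma has_sum_family:
  "((\<lambda>j. c j * \<iota> (e_monomial \<phi> \<pi> j z)) has_sum y) (Zp_nonneg CHAR('a)) \<longleftrightarrow>
   ((\<lambda>M. family c M * mon z M) has_sum y) UNIV"
proof -
  have "((\<lambda>j. c j * \<iota> (e_monomial \<phi> \<pi> j z)) has_sum y) (Zp_nonneg CHAR('a)) \<longleftrightarrow>
     ((\<lambda>M. c (wt q M) * \<iota> (e_monomial \<phi> \<pi> (wt q M) z)) has_sum y) {M. reduced q M}"
    by (rule has_sum_reindex_bij_betw[OF bij_betw_wt, symmetric])
  also have "\<dots> \<longleftrightarrow> ((\<lambda>M. family c M * mon z M) has_sum y) UNIV"
    by (rule has_sum_cong_neutral) (auto simp: family_def iota_e_monomial)
  finally show ?thesis .
qed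

text \<open>An upper bound on the exponents bounds the elements from below, since an element k alone
  contributes q^(-k) to the weight.\<close>

lemma represents_family:
  assumes "is_tame_expansion \<phi> \<pi> \<iota> L c f"
  shows "represents (family c) f"
proof -
  obtain D b B where c: "\<And>j. c j \<in> L" "\<And>j. c j \<noteq> 0 \<Longrightarrow> digit_sum q j \<le> D"
    "\<And>j. c j \<noteq> 0 \<Longrightarrow> j \<le> b" "\<And>j. absv (c j) \<le> B"
    using assms unfolding is_tame_expansion_def bdd_above_def q_eq by blast
  obtain n where n: "b < real q ^ n"
    using real_arch_pow[of "real q" b] q_ge_2 by auto
  have "family c M \<in> L" "absv (family c M) \<le> max B 0" for M
    using c(1,4)[of "wt q M"] L_closed(1) by (auto simp: family_def)
  moreover have "size M \<le> D" if "family c M \<noteq> 0" for M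
    using that c(2)[of "wt q M"] by (auto simp: family_def digit_sum_wt[OF q_ge_2] split: if_splits)
  moreover have "- int n \<le> k" if "family c M \<noteq> 0" "k \<in># M" for M k
  proof (rule ccontr)
    assume "\<not> - int n \<le> k"
    hence "real q powi (- (- int n)) \<le> real q powi (- k)"
      by (intro powi_mono[OF q_ge_2]) simp
    also have "\<dots> \<le> wt q M"
      by (rule wt_ge_member[OF that(2)])
    also have "\<dots> \<le> b"
      using that(1) c(3) by (auto simp: family_def split: if_splits)
    finally show False
      using n by simp
  qed
  ultimately have "admissible (family c)"
    unfolding admissible_def by blast
  thus ?thesis
    using assms unfolding represents_def is_tame_expansion_def has_sum_family by blast
qed

lemma is_tame_expansion_of_represents:
  assumes "represents d f" "\<And>M. d M \<noteq> 0 \<Longrightarrow> reduced q M"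
  shows "\<exists>c. is_tame_expansion \<phi> \<pi> \<iota> L c f \<and> family c = d"
proof -
  define c where "c j = (if j \<in> Zp_nonneg CHAR('a) then d (inv_into {M. reduced q M} (wt q) j) else 0)" for j
  have c_wt: "c (wt q M) = d M" if "reduced q M" for M
    using that bij_betw_wt bij_betw_inv_into_left[OF bij_betw_wt, of M] bij_betwE[OF bij_betw_wt]
    by (auto simp: c_def)
  have out: "c j = 0" if "j \<notin> Zp_nonneg CHAR('a)" for j
    using that by (simp add: c_def)
  have nz: "\<exists>M. reduced q M \<and> j = wt q M \<and> c j = d M" if "c j \<noteq> 0" for j
  proof -
    have "j \<in> wt q ` {M. reduced q M}"
      using that out[of j] unfolding Zp_nonneg_CHAR[OF q_eq] by blast
    thus ?thesis
      using c_wt by auto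
  qed
  obtain D k0 B where d: "\<And>M. d M \<in> L" "\<And>M. d M \<noteq> 0 \<Longrightarrow> size M \<le> D"
    "\<And>M k. d M \<noteq> 0 \<Longrightarrow> k \<in># M \<Longrightarrow> k0 \<le> k" "\<And>M. absv (d M) \<le> B"
    using admissibleE assms(1) unfolding represents_def by metis
  have fam: "family c = d"
    using c_wt assms(2) by (auto simp: family_def fun_eq_iff)
  have "c j \<in> L" "absv (c j) \<le> max B 0" for j
    using d(1,4) L_closed(1) by (auto simp: c_def intro: max.coboundedI1)
  moreover have "digit_sum CARD('a) j \<le> D" if "c j \<noteq> 0" for j
    using nz[OF that] that d(2) by (auto simp: digit_sum_wt[OF q_ge_2] simp flip: q_eq)
  moreover have "j \<le> real D * real q powi (- k0)" if cj: "c j \<noteq> 0" for j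
  proof -
    obtain M where M: "reduced q M" "j = wt q M" "d M \<noteq> 0"
      using nz[OF cj] cj by auto
    have "wt q M \<le> real (size M) * real q powi (- k0)"
      using d(3)[OF M(3)] by (intro wt_le_size[OF q_ge_2]) auto
    also have "\<dots> \<le> real D * real q powi (- k0)"
      using d(2)[OF M(3)] by (intro mult_right_mono) auto
    finally show ?thesis
      by (simp add: M(2))
  qed
  moreover have "((\<lambda>j. c j * \<iota> (e_monomial \<phi> \<pi> j z)) has_sum f z) (Zp_nonneg CHAR('a))" for z
    using assms(1) unfolding has_sum_family fam represents_def by blast
  ultimately have "is_tame_expansion \<phi> \<pi> \<iota> L c f"
    unfolding is_tame_expansion_def bdd_above_def using out by blast
  thus ?thesis
    using fam by blast
qed

lemma family_reduced: "family c M \<noteq> 0 \<Longrightarrow> reduced q M"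
  by (simp add: family_def split: if_splits)

lemma tame_series_eq: "tame_series \<phi> \<pi> \<iota> L = {f. tame f}"
  unfolding tame_series_def tame_def
  using represents_family is_tame_expansion_of_represents family_reduced by blast

lemma tame_series0_eq: "tame_series0 \<phi> \<pi> \<iota> L = {f. tame0 f}"
proof (intro equalityI subsetI)
  fix f assume "f \<in> tame_series0 \<phi> \<pi> \<iota> L"
  then obtain c where c: "is_tame_expansion \<phi> \<pi> \<iota> L c f" "\<And>j. c j \<noteq> 0 \<Longrightarrow> j < 1"
    by (auto simp: tame_series0_def)
  have "reduced q M \<and> wt q M < 1" if "family c M \<noteq> 0" for M
    using that c(2) by (auto simp: family_def split: if_splits)
  thus "f \<in> {f. tame0 f}"
    using represents_family[OF c(1)] unfolding tame0_def by blast
next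
  fix f assume "f \<in> {f. tame0 f}"
  then obtain d where d: "represents d f" "\<And>M. d M \<noteq> 0 \<Longrightarrow> reduced q M \<and> wt q M < 1"
    unfolding tame0_def by blast
  then obtain c where c: "is_tame_expansion \<phi> \<pi> \<iota> L c f" "family c = d"
    using is_tame_expansion_of_represents by blast
  have "j < 1" if "c j \<noteq> 0" for j
  proof -
    have "j \<in> Zp_nonneg CHAR('a)"
      using c(1) that unfolding is_tame_expansion_def by blast
    then obtain M where M: "reduced q M" "j = wt q M"
      using Zp_nonneg_CHAR[OF q_eq] by auto
    hence "d M \<noteq> 0"
      using that c(2) by (auto simp: family_def)
    thus ?thesis
      using d(2) M(2) by blast
  qed
  thus "f \<in> tame_series0 \<phi> \<pi> \<iota> L"
    using c(1) unfolding tame_series0_def by blast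
qed

lemma tame_expansion_unique:
  assumes "is_tame_expansion \<phi> \<pi> \<iota> L c f" "is_tame_expansion \<phi> \<pi> \<iota> L c' f"
  shows "c = c'"
proof
  fix j
  have eq: "family c = family c'"
    using assms by (intro represents_unique represents_family family_reduced)
  show "c j = c' j"
  proof (cases "j \<in> Zp_nonneg CHAR('a)")
    case True
    then obtain M where "reduced q M" "j = wt q M"
      using Zp_nonneg_CHAR[OF q_eq] by auto
    thus ?thesis
      using fun_cong[OF eq, of M] by (simp add: family_def)
  next
    case False
    hence "c j = 0" "c' j = 0"
      using assms unfolding is_tame_expansion_def by blast+
    thus ?thesis
      by simp
  qed
qed

text \<open>Uniqueness of tame expansions evaluates the definite description in
  \<open>tame_coeff\<close>, and the leading multiset shows that a greatest exponent is
  attained.\<close>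

lemma tame_val_eq:
  assumes "represents d f" "\<And>M. d M \<noteq> 0 \<Longrightarrow> reduced q M" "leading d M"
  shows "tame_val \<phi> \<pi> \<iota> L f = ereal (- wt q M)"
proof -
  obtain c where c: "is_tame_expansion \<phi> \<pi> \<iota> L c f" "family c = d"
    using is_tame_expansion_of_represents[OF assms(1,2)] by blast
  have coeff: "tame_coeff \<phi> \<pi> \<iota> L f = c"
    unfolding tame_coeff_def using c(1) tame_expansion_unique by (intro the_equality) blast+
  have dM: "d M \<noteq> 0" "\<And>N. d N \<noteq> 0 \<Longrightarrow> wt q N \<le> wt q M"
    using assms(3) by (auto simp: leading_def)
  have "f \<noteq> (\<lambda>_. 0)"
    using represents_zero_imp_zero[of d M] assms(1,2) dM(1) by blast
  moreover have "(GREATEST j. c j \<noteq> 0) = wt q M"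
  proof (rule Greatest_equality)
    show "c (wt q M) \<noteq> 0"
      using dM(1) assms(2)[OF dM(1)] c(2) by (auto simp: family_def)
    fix j assume j: "c j \<noteq> 0"
    hence "j \<in> Zp_nonneg CHAR('a)"
      using c(1) unfolding is_tame_expansion_def by blast
    then obtain N where N: "reduced q N" "j = wt q N"
      using Zp_nonneg_CHAR[OF q_eq] by auto
    hence "d N \<noteq> 0"
      using j c(2) by (auto simp: family_def)
    thus "j \<le> wt q M"
      using dM(2) N(2) by blast
  qed
  ultimately show ?thesis
    by (simp add: tame_val_def coeff)
qed

end

theorem proposition3p25:
  fixes \<phi> :: "'a::{finite,field} fls \<Rightarrow> 'c::{nonarch_field,complete_space}"
    and \<pi> :: 'c
    and \<iota> :: "'c \<Rightarrow> 'k::{nonarch_field,complete_space}"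
    and S :: "nat set"
    and t :: "nat \<Rightarrow> 'k"
    and \<tau> :: "'k \<Rightarrow> 'k"
    and L :: "'k set"
    and emb :: "('c \<Rightarrow> 'k) \<Rightarrow> 'f::field"
    and w :: "'f \<Rightarrow> ereal"
  assumes "is_C_infinity \<phi>"
    and "is_carlitz_period \<phi> \<pi>"
    and "finite S" and "0 \<notin> S"
    and "is_K_Sigma \<iota> S t"
    and "is_tau \<phi> \<iota> S t \<tau>"
    and "is_subfield L" and "\<iota> ` A_ring \<phi> \<subseteq> L" and "\<tau> ` L \<subseteq> L"
    and "is_completed_fraction_field (tame_series \<phi> \<pi> \<iota> L) (tame_val \<phi> \<pi> \<iota> L) emb w"
  shows "\<forall>f::'f. \<exists>!a :: int \<Rightarrow> 'c \<Rightarrow> 'k.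
    (\<forall>i. a i \<in> tame_series0 \<phi> \<pi> \<iota> L) \<and>
    (\<exists>i0. (\<forall>i<i0. a i = (\<lambda>_. 0)) \<and>
      val_tendsto w
        (\<lambda>N. \<Sum>i=i0..N. emb (a i) * emb (\<lambda>z. \<iota> (e_fun \<phi> \<pi> 0 z)) powi (- i)) f at_top)"
proof -
  define q where "q = CARD('a)"
  interpret carlitz_setting \<phi> \<pi> \<iota> S t L q
    using assms by unfold_locales (simp_all add: q_def)
  \<comment> \<open>The test points and rates are auxiliary; neither the ring nor the valuation
    depends on this choice.\<close>
  obtain \<zeta> Y where "tame_system q (\<lambda>k z. \<iota> (e_fun \<phi> \<pi> k z)) (\<iota> (theta \<phi>)) L \<zeta> Y"
    using ex_tame_system by blast
  then interpret tame_system q "\<lambda>k z. \<iota> (e_fun \<phi> \<pi> k z)" "\<iota> (theta \<phi>)" L \<zeta> Y .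
  interpret carlitz_tame \<phi> \<pi> \<iota> S t L q \<zeta> Y ..
  note frac = assms(10)[unfolded is_completed_fraction_field_def tame_series_eq]
  interpret completed_tame_system q "\<lambda>k z. \<iota> (e_fun \<phi> \<pi> k z)" "\<iota> (theta \<phi>)" L \<zeta> Y emb w
  proof
    show "emb (\<lambda>_. 1) = 1" "additive_valuation w"
      using frac by blast+
    show "emb (\<lambda>z. f z + g z) = emb f + emb g" "emb (\<lambda>z. f z * g z) = emb f * emb g"
      if "tame f" "tame g" for f g
      using frac that by blast+
    show "w (emb f) = ereal (- wt q M)"
      if "represents c f" "\<And>M. c M \<noteq> 0 \<Longrightarrow> reduced q M" "leading c M" for c f M
      using frac represents_imp_tame[OF that(1)] tame_val_eq[OF that] by auto
    show "\<exists>f g. tame f \<and> tame g \<and> g \<noteq> (\<lambda>_. 0) \<and> w (x - emb f / emb g) > ereal B" for x B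
      using frac by blast
  qed
  show ?thesis
    unfolding tame_series0_eq mem_Collect_eq using unique_expansion by blast
qed

end
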